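(* Let $q$ be a prime power, let $m$ and $d$ be even integers with $2\le d\le m$, and let $Y$ be a nonempty elliptic $d$-code in $\mathscr Q(m,q)$. Then $\lvert Y\rvert\le q^{m(m-d+1)/2}$. Moreover, equality holds if and only if $Y$ is a $t$-design for $t=m-d+1$.
   Context: Let $q$ be a prime power, $m\ge1$, and $V$ an $m$-dimensional $\mathbb F_q$-vector space. $\mathscr Q(m,q)$ is the set of quadratic forms on $V$ and $\mathscr S(m,q)$ the set of symmetric bilinear forms on $V$. The rank of $S\in\mathscr S(m,q)$ is the codimension of $\{x\in V:S(x,y)=0\ \forall y\in V\}$. For $Q\in\mathscr Q(m,q)$ let $S_Q(x,y)=Q(x+y)-Q(x)-Q(y)$; the radical of $Q$ is $\{x: S_Q(x,y)=0\ \forall y,\ Q(x)=0\}$ and the rank of $Q$ is its codimension. Quadratic forms $Q,Q'$ are equivalent if $Q'(x)=aQ(Lx)$ for some $a\in\mathbb F_q^*$, $L\in GL(V)$; symmetric bilinear forms $S,S'$ are equivalent if $S'(x,y)=aS(Lx,Ly)$ for such $a,L$. Fix $\lambda\in\mathbb F_q$ of absolute trace $1$ (if $q$ even) and a nonsquare $\eta\in\mathbb F_q^*$ (if $q$ odd). A quadratic form of rank $2s\ge2$ has type $1$ (hyperbolic) if it is equivalent to the form given in coordinates of some basis by $\sum_{i=1}^s x_{2i-1}x_{2i}$, and type $-1$ (elliptic) if equivalent to $\sum_{i=1}^{s-1}x_{2i-1}x_{2i}+Q_0$, where $Q_0=x_{2s-1}^2+x_{2s-1}x_{2s}+\lambda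 x_{2s}^2$ ($q$ even) or $Q_0=x_{2s-1}^2-\eta x_{2s}^2$ ($q$ odd). A symmetric bilinear form of rank $2s\ge2$ has type $1$ if equivalent to $\sum_{i=1}^s(x_{2i-1}y_{2i}+x_{2i}y_{2i-1})$ and type $-1$ if equivalent to $\sum_{i=1}^{s-1}(x_{2i-1}y_{2i}+x_{2i}y_{2i-1})+S_0$, where $S_0=x_{2s-1}y_{2s}+x_{2s}y_{2s-1}+x_{2s}y_{2s}$ ($q$ even) or $S_0=x_{2s-1}y_{2s-1}-\eta x_{2s}y_{2s}$ ($q$ odd). Each form of rank $2s\ge2$ has exactly one type; zero forms have rank $0$ and type $1$. Let $I=\{2s+1:s\in\mathbb Z\}\cup\{(2s,\tau):s\in\mathbb Z,\tau=\pm1\}$; $\mathscr Q_{2s+1}$ (resp. $\mathscr S_{2s+1}$) is the set of quadratic (resp. symmetric bilinear) forms of rank $2s+1$, and $\mathscr Q_{2s,\tau}$ (resp. $\mathscr S_{2s,\tau}$) the set of those of rank $2s$ and type $\tau$. Pairing: fix a nontrivial character $\chi$ of $(\mathbb F_q,+)$ and bases $(u_i)$, $(w_i)$ of $V$; for $Q$ pick $A$ with $Q(\sum_i x_iu_i)=\sum_{i,j}A_{ij}x_ix_j$ (unique modulo alternating matrices); for $S$ let $B_{ij}=S(w_i,w_j)$; $\langle Q,S\rangle=\chi(\operatorname{tr}(AB))$. For $k,i\in I$ with $\mathscr Q_i\ne\emptyset$, $Q_k(i)=\sum_{S\in\mathscr S_k}\langle Q,S\rangle$ for any $Q\in\mathscr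 Q_i$. For $Y\subseteq\mathscr Q(m,q)$ the inner distribution is $a_i=\lvert\{(Q,Q')\in Y\times Y:Q-Q'\in\mathscr Q_i\}\rvert/\lvert Y\rvert$ and the dual inner distribution is $a'_k=\sum_{i\in I,\ \mathscr Q_i\ne\emptyset}Q_k(i)\,a_i$. $Y$ is a $d$-code if $\operatorname{rank}(Q-Q')\ge d$ for all distinct $Q,Q'\in Y$. For $m,d$ even, an elliptic $d$-code is a $d$-code $Y$ such that no difference $Q-Q'$ of distinct elements of $Y$ lies in $\mathscr Q_{d,1}$ (i.e. is hyperbolic of rank $d$). For an integer $t$ let $I_t=\{2s-1:1\le 2s-1\le t\}\cup\{(2s,\pm1):2\le 2s\le t\}$; $Y$ is a $t$-design if $a'_k=0$ for all $k\in I_t$. *)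

theory Defs
  imports Complex_Main "HOL-Library.Cardinality"
begin

text \<open>The trace of a finite field of order p^n over its prime field of order p.\<close>

definition absolute_trace :: "'a :: {field, finite} \<Rightarrow> 'a" where
  "absolute_trace x = (\<Sum>i<(THE n. CARD('a) = CHAR('a) ^ n). x ^ (CHAR('a) ^ i))"

definition nontrivial_additive_character :: "('a :: {field, finite} \<Rightarrow> complex) \<Rightarrow> bool" where
  "nontrivial_additive_character chi \<longleftrightarrow>
     (\<forall>x. chi x \<noteq> 0) \<and> (\<forall>x y. chi (x + y) = chi x * chi y) \<and> (\<exists>x. chi x \<noteq> 1)"

text \<open>
  The index set \<open>I\<close>: \<open>Odd_Rank r\<close> stands for an odd rank \<open>r\<close> and \<open>Even_Rank r \<tau>\<close> for an even rank \<open>r\<close>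
  together with a type \<open>\<tau> = 1\<close> or \<open>\<tau> = -1\<close>. Only \<open>form_indices\<close> enforces these restrictions.
\<close>

datatype form_index = Odd_Rank int | Even_Rank int int

definition form_indices :: "form_index set" where
  "form_indices =
     {Odd_Rank (2 * s + 1) | s. True} \<union> {Even_Rank (2 * s) \<tau> | s \<tau>. \<tau> = 1 \<or> \<tau> = -1}"

definition design_indices :: "int \<Rightarrow> form_index set" where
  "design_indices t =
     {Odd_Rank (2 * s - 1) | s. 1 \<le> 2 * s - 1 \<and> 2 * s - 1 \<le> t} \<union>
     {Even_Rank (2 * s) \<tau> | s \<tau>. 2 \<le> 2 * s \<and> 2 * s \<le> t \<and> (\<tau> = 1 \<or> \<tau> = -1)}"

text \<open>
  In the following locale the space \<open>V\<close> is the whole type \<open>'v\<close>. Its dimension is \<open>dim UNIV\<close>, which is \<open>0\<close>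
  by convention if \<open>V\<close> has no finite basis; a positive value thus includes finite-dimensionality.
\<close>

locale finite_field_space = vector_space scale
  for scale :: "'a :: {field, finite} \<Rightarrow> 'v :: ab_group_add \<Rightarrow> 'v"
begin

text \<open>Bases are ordered and indexed by \<open>1, \<dots>, dim V\<close>; values at other indices are irrelevant.\<close>

definition ordered_basis :: "(nat \<Rightarrow> 'v) \<Rightarrow> bool" where
  "ordered_basis b \<longleftrightarrow>
     inj_on b {1..dim UNIV} \<and> independent (b ` {1..dim UNIV}) \<and> span (b ` {1..dim UNIV}) = UNIV"

definition coord :: "(nat \<Rightarrow> 'v) \<Rightarrow> nat \<Rightarrow> 'v \<Rightarrow> 'a" where
  "coord b i x = representation (b ` {1..dim UNIV}) x (b i)"

definition symmetric_bilinear_forms :: "('v \<Rightarrow> 'v \<Rightarrow> 'a) set" where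
  "symmetric_bilinear_forms =
     {S. (\<forall>x. Vector_Spaces.linear scale (*) (S x)) \<and> (\<forall>x y. S x y = S y x)}"

definition polar_form :: "('v \<Rightarrow> 'a) \<Rightarrow> 'v \<Rightarrow> 'v \<Rightarrow> 'a" where
  "polar_form Q x y = Q (x + y) - Q x - Q y"

definition quadratic_forms :: "('v \<Rightarrow> 'a) set" where
  "quadratic_forms =
     {Q. (\<forall>c x. Q (scale c x) = c ^ 2 * Q x) \<and> polar_form Q \<in> symmetric_bilinear_forms}"

definition symmetric_radical :: "('v \<Rightarrow> 'v \<Rightarrow> 'a) \<Rightarrow> 'v set" where
  "symmetric_radical S = {x. \<forall>y. S x y = 0}"

definition quadratic_radical :: "('v \<Rightarrow> 'a) \<Rightarrow> 'v set" where
  "quadratic_radical Q = {x. (\<forall>y. polar_form Q x y = 0) \<and> Q x = 0}"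

definition symmetric_rank :: "('v \<Rightarrow> 'v \<Rightarrow> 'a) \<Rightarrow> nat" where
  "symmetric_rank S = dim UNIV - dim (symmetric_radical S)"

definition quadratic_rank :: "('v \<Rightarrow> 'a) \<Rightarrow> nat" where
  "quadratic_rank Q = dim UNIV - dim (quadratic_radical Q)"

definition quadratic_equivalent :: "('v \<Rightarrow> 'a) \<Rightarrow> ('v \<Rightarrow> 'a) \<Rightarrow> bool" where
  "quadratic_equivalent Q Q' \<longleftrightarrow>
     (\<exists>a L. a \<noteq> 0 \<and> Vector_Spaces.linear scale scale L \<and> bij L \<and> (\<forall>x. Q' x = a * Q (L x)))"

definition symmetric_equivalent :: "('v \<Rightarrow> 'v \<Rightarrow> 'a) \<Rightarrow> ('v \<Rightarrow> 'v \<Rightarrow> 'a) \<Rightarrow> bool" where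
  "symmetric_equivalent S S' \<longleftrightarrow>
     (\<exists>a L. a \<noteq> 0 \<and> Vector_Spaces.linear scale scale L \<and> bij L \<and> (\<forall>x y. S' x y = a * S (L x) (L y)))"

text \<open>
  The standard forms of rank \<open>2 * s\<close> (for \<open>s \<ge> 1\<close>) with respect to a basis \<open>b\<close>. The parameters \<open>lam\<close> and
  \<open>eta\<close> are an element of absolute trace 1 (used for even order) and a nonsquare (used for odd order).
\<close>

definition hyperbolic_quadratic :: "(nat \<Rightarrow> 'v) \<Rightarrow> nat \<Rightarrow> 'v \<Rightarrow> 'a" where
  "hyperbolic_quadratic b s x = (\<Sum>i=1..s. coord b (2 * i - 1) x * coord b (2 * i) x)"

definition elliptic_quadratic :: "'a \<Rightarrow> 'a \<Rightarrow> (nat \<Rightarrow> 'v) \<Rightarrow> nat \<Rightarrow> 'v \<Rightarrow> 'a" where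
  "elliptic_quadratic lam eta b s x =
     (\<Sum>i=1..s - 1. coord b (2 * i - 1) x * coord b (2 * i) x) +
     (if even CARD('a)
      then (coord b (2 * s - 1) x) ^ 2 + coord b (2 * s - 1) x * coord b (2 * s) x
             + lam * (coord b (2 * s) x) ^ 2
      else (coord b (2 * s - 1) x) ^ 2 - eta * (coord b (2 * s) x) ^ 2)"

definition hyperbolic_symmetric :: "(nat \<Rightarrow> 'v) \<Rightarrow> nat \<Rightarrow> 'v \<Rightarrow> 'v \<Rightarrow> 'a" where
  "hyperbolic_symmetric b s x y =
     (\<Sum>i=1..s. coord b (2 * i - 1) x * coord b (2 * i) y + coord b (2 * i) x * coord b (2 * i - 1) y)"

definition elliptic_symmetric :: "'a \<Rightarrow> (nat \<Rightarrow> 'v) \<Rightarrow> nat \<Rightarrow> 'v \<Rightarrow> 'v \<Rightarrow> 'a" where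
  "elliptic_symmetric eta b s x y =
     (\<Sum>i=1..s - 1. coord b (2 * i - 1) x * coord b (2 * i) y + coord b (2 * i) x * coord b (2 * i - 1) y) +
     (if even CARD('a)
      then coord b (2 * s - 1) x * coord b (2 * s) y + coord b (2 * s) x * coord b (2 * s - 1) y
             + coord b (2 * s) x * coord b (2 * s) y
      else coord b (2 * s - 1) x * coord b (2 * s - 1) y - eta * (coord b (2 * s) x * coord b (2 * s) y))"

definition quadratic_has_type :: "'a \<Rightarrow> 'a \<Rightarrow> ('v \<Rightarrow> 'a) \<Rightarrow> int \<Rightarrow> bool" where
  "quadratic_has_type lam eta Q \<tau> \<longleftrightarrow>
     (quadratic_rank Q = 0 \<and> \<tau> = 1) \<or>
     (\<exists>s\<ge>1. quadratic_rank Q = 2 * s \<and>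
        (\<exists>b. ordered_basis b \<and>
          (\<tau> = 1 \<and> quadratic_equivalent Q (hyperbolic_quadratic b s) \<or>
           \<tau> = -1 \<and> quadratic_equivalent Q (elliptic_quadratic lam eta b s))))"

definition symmetric_has_type :: "'a \<Rightarrow> ('v \<Rightarrow> 'v \<Rightarrow> 'a) \<Rightarrow> int \<Rightarrow> bool" where
  "symmetric_has_type eta S \<tau> \<longleftrightarrow>
     (symmetric_rank S = 0 \<and> \<tau> = 1) \<or>
     (\<exists>s\<ge>1. symmetric_rank S = 2 * s \<and>
        (\<exists>b. ordered_basis b \<and>
          (\<tau> = 1 \<and> symmetric_equivalent S (hyperbolic_symmetric b s) \<or>
           \<tau> = -1 \<and> symmetric_equivalent S (elliptic_symmetric eta b s))))"

definition quadratic_class :: "'a \<Rightarrow> 'a \<Rightarrow> form_index \<Rightarrow> ('v \<Rightarrow> 'a) set" where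
  "quadratic_class lam eta i =
     (case i of
        Odd_Rank r \<Rightarrow> {Q \<in> quadratic_forms. int (quadratic_rank Q) = r}
      | Even_Rank r \<tau> \<Rightarrow>
          {Q \<in> quadratic_forms. int (quadratic_rank Q) = r \<and> quadratic_has_type lam eta Q \<tau>})"

definition symmetric_class :: "'a \<Rightarrow> form_index \<Rightarrow> ('v \<Rightarrow> 'v \<Rightarrow> 'a) set" where
  "symmetric_class eta k =
     (case k of
        Odd_Rank r \<Rightarrow> {S \<in> symmetric_bilinear_forms. int (symmetric_rank S) = r}
      | Even_Rank r \<tau> \<Rightarrow>
          {S \<in> symmetric_bilinear_forms. int (symmetric_rank S) = r \<and> symmetric_has_type eta S \<tau>})"

text \<open>
  Matrices are functions on index pairs from \<open>1, \<dots>, dim V\<close>. The matrix of a quadratic form is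
  unique only modulo alternating matrices; the pairing below does not depend on the choice, as
  the product of an alternating and a symmetric matrix has trace 0.
\<close>

definition quadratic_matrix :: "(nat \<Rightarrow> 'v) \<Rightarrow> ('v \<Rightarrow> 'a) \<Rightarrow> nat \<Rightarrow> nat \<Rightarrow> 'a" where
  "quadratic_matrix u Q =
     (SOME A. \<forall>x :: nat \<Rightarrow> 'a. Q (\<Sum>i=1..dim UNIV. scale (x i) (u i)) =
        (\<Sum>i=1..dim UNIV. \<Sum>j=1..dim UNIV. A i j * x i * x j))"

definition form_pairing ::
  "('a \<Rightarrow> complex) \<Rightarrow> (nat \<Rightarrow> 'v) \<Rightarrow> (nat \<Rightarrow> 'v) \<Rightarrow> ('v \<Rightarrow> 'a) \<Rightarrow> ('v \<Rightarrow> 'v \<Rightarrow> 'a) \<Rightarrow> complex" where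
  "form_pairing chi u w Q S =
     chi (\<Sum>i=1..dim UNIV. \<Sum>j=1..dim UNIV. quadratic_matrix u Q i j * S (w j) (w i))"

text \<open>
  The number \<open>Q_k(i)\<close>, meaningful if \<open>quadratic_class lam eta i\<close> is nonempty. It does not depend on the
  representative, because each class is a single orbit under equivalence and the pairing is
  invariant up to replacing the symmetric form by an equivalent one.
\<close>

definition Q_number ::
  "'a \<Rightarrow> 'a \<Rightarrow> ('a \<Rightarrow> complex) \<Rightarrow> (nat \<Rightarrow> 'v) \<Rightarrow> (nat \<Rightarrow> 'v) \<Rightarrow> form_index \<Rightarrow> form_index \<Rightarrow> complex" where
  "Q_number lam eta chi u w k i =
     (\<Sum>S\<in>symmetric_class eta k. form_pairing chi u w (SOME Q. Q \<in> quadratic_class lam eta i) S)"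

definition inner_distribution :: "'a \<Rightarrow> 'a \<Rightarrow> ('v \<Rightarrow> 'a) set \<Rightarrow> form_index \<Rightarrow> real" where
  "inner_distribution lam eta Y i =
     real (card {(Q, Q') \<in> Y \<times> Y. (\<lambda>x. Q x - Q' x) \<in> quadratic_class lam eta i}) / real (card Y)"

text \<open>
  The sum below has only finitely many terms, since nonempty classes have rank at most \<open>dim V\<close>.
\<close>

definition dual_inner_distribution ::
  "'a \<Rightarrow> 'a \<Rightarrow> ('a \<Rightarrow> complex) \<Rightarrow> (nat \<Rightarrow> 'v) \<Rightarrow> (nat \<Rightarrow> 'v) \<Rightarrow> ('v \<Rightarrow> 'a) set \<Rightarrow> form_index \<Rightarrow> complex" where
  "dual_inner_distribution lam eta chi u w Y k =
     (\<Sum>i | i \<in> form_indices \<and> quadratic_class lam eta i \<noteq> {}.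
        Q_number lam eta chi u w k i * of_real (inner_distribution lam eta Y i))"

definition is_code :: "nat \<Rightarrow> ('v \<Rightarrow> 'a) set \<Rightarrow> bool" where
  "is_code d Y \<longleftrightarrow>
     Y \<subseteq> quadratic_forms \<and> (\<forall>Q\<in>Y. \<forall>Q'\<in>Y. Q \<noteq> Q' \<longrightarrow> d \<le> quadratic_rank (\<lambda>x. Q x - Q' x))"

definition is_elliptic_code :: "'a \<Rightarrow> 'a \<Rightarrow> nat \<Rightarrow> ('v \<Rightarrow> 'a) set \<Rightarrow> bool" where
  "is_elliptic_code lam eta d Y \<longleftrightarrow>
     is_code d Y \<and>
     (\<forall>Q\<in>Y. \<forall>Q'\<in>Y. Q \<noteq> Q' \<longrightarrow> (\<lambda>x. Q x - Q' x) \<notin> quadratic_class lam eta (Even_Rank (int d) 1))"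

definition is_design ::
  "'a \<Rightarrow> 'a \<Rightarrow> ('a \<Rightarrow> complex) \<Rightarrow> (nat \<Rightarrow> 'v) \<Rightarrow> (nat \<Rightarrow> 'v) \<Rightarrow> int \<Rightarrow> ('v \<Rightarrow> 'a) set \<Rightarrow> bool" where
  "is_design lam eta chi u w t Y \<longleftrightarrow>
     Y \<subseteq> quadratic_forms \<and> (\<forall>k\<in>design_indices t. dual_inner_distribution lam eta chi u w Y k = 0)"

end

end

theory Submission
  imports Defs "HOL-Library.FuncSet" "HOL-Computational_Algebra.Primes"
begin

text \<open>
  Delsarte's linear programming method. Write \<open>m = 2n\<close> and \<open>d = 2\<delta>\<close>. There is a weight \<open>h(S)\<close>, depending
  only on the rank of \<open>S\<close>, which is nonnegative, is positive exactly if the rank is at most \<open>m - d + 1\<close>,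
  and whose transform \<open>Q \<mapsto> \<Sum>S. h(S) \<langle>Q,S\<rangle>\<close> vanishes at every form \<open>Q\<close> of rank at least \<open>d\<close> that is not
  hyperbolic of rank \<open>d\<close>. For an elliptic \<open>d\<close>-code \<open>Y\<close> only the diagonal terms survive in
  \<open>\<Sum>S. h(S) |\<Sum>Q\<in>Y. \<langle>Q,S\<rangle>|\<^sup>2 = |Y| (\<Sum>S. h(S)) = |Y| q\<^bsup>n(m-d+1)\<^esup> h(0)\<close>. The term for \<open>S = 0\<close> is \<open>|Y|\<^sup>2 h(0)\<close>, which
  gives the bound; equality holds iff the remaining sums over \<open>Y\<close> vanish up to rank \<open>m - d + 1\<close>, and
  the dual inner distribution at a class of forms is the sum of their squared moduli over it, up to \<open>|Y|\<close>.

  The transform is computed by splitting off hyperbolic planes from \<open>Q\<close>: this turns a rank function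
  \<open>\<psi>\<close> into \<open>r \<mapsto> q\<^sup>r (\<psi> r + (q - 1) \<psi> (r + 1) - q \<psi> (r + 2))\<close>, which maps the weight for \<open>(n, \<delta>)\<close> to a multiple of
  the one for \<open>(n - 1, \<delta> - 1)\<close>.
\<close>

section \<open>Symmetric matrices over a finite field\<close>

text \<open>The weight depends on the rank of \<open>S\<close> alone, so its sums can be computed
  without knowing the numbers \<open>Q_k(i)\<close> of single classes. Its two halves come from
  rounding \<open>r / 2\<close> down and up. In either half every second rank step leaves the value
  unchanged, so the three-term expression for a split plane collapses to a difference of two
  products \<open>qfall\<close>, and this lowers \<open>k\<close> by one. After \<open>s\<close>
  planes the parameter is \<open>k - s\<close>, with three possible endings: a factor
  \<open>(q ^ 2) ^ 0 - 1 = 0\<close> if \<open>k < s\<close>; a constant weight, killed by any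
  nonzero value of the remaining form, if \<open>k = s\<close>; and, if \<open>k = s + 1\<close> and
  an elliptic plane remains, the weight \<open>(q + 1) (q ^ corank - 1)\<close>, where
  \<open>q ^ corank\<close> counts kernel vectors. Types are defined by equivalence, so two facts
  must be proved: the types of a quadratic form exclude each other, which the transform itself
  detects, and every symmetric form of even rank has a type, so that the design condition reaches
  all forms concerned. Characteristic 2 calls for non-symmetric matrices of quadratic forms and for
  a separate classification of symmetric forms.\<close>

definition vecs :: "nat \<Rightarrow> (nat \<Rightarrow> 'a::zero) set" where
  "vecs M = {x. \<forall>i\<ge>M. x i = 0}"

text \<open>Vectors and matrices are total functions that vanish outside the index range, so that
  HOL equality is the intended equality and the sets can be counted.\<close>

definition symm :: "nat \<Rightarrow> (nat \<Rightarrow> nat \<Rightarrow> 'a::zero) set" where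
  "symm M = {B. \<forall>i j. B i j = B j i \<and> (M \<le> i \<longrightarrow> B i j = 0)}"

definition border :: "nat \<Rightarrow> (nat \<Rightarrow> nat \<Rightarrow> 'a::zero) \<Rightarrow> (nat \<Rightarrow> 'a) \<Rightarrow> 'a \<Rightarrow> nat \<Rightarrow> nat \<Rightarrow> 'a" where
  "border M B b a i j =
     (if i = M then if j = M then a else if j < M then b j else 0
      else if i < M then if j = M then b i else if j < M then B i j else 0
      else 0)"

definition ker :: "nat \<Rightarrow> (nat \<Rightarrow> nat \<Rightarrow> 'a::semiring_0) \<Rightarrow> (nat \<Rightarrow> 'a) set" where
  "ker M B = {x \<in> vecs M. \<forall>i<M. (\<Sum>j<M. B i j * x j) = 0}"

definition dot :: "nat \<Rightarrow> (nat \<Rightarrow> 'a::semiring_0) \<Rightarrow> (nat \<Rightarrow> 'a) \<Rightarrow> 'a" where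
  "dot M x y = (\<Sum>i<M. x i * y i)"

text \<open>The rank is read off the size of the kernel; \<open>THE\<close> is meaningful because for symmetric \<open>B\<close> that
  size is shown to be a power of \<open>CARD('a)\<close>.\<close>

definition mrank :: "nat \<Rightarrow> (nat \<Rightarrow> nat \<Rightarrow> 'a::{finite,semiring_0}) \<Rightarrow> nat" where
  "mrank M B = (THE r. card (ker M B) * CARD('a) ^ r = CARD('a) ^ M)"

lemma vecs_0: "vecs 0 = {\<lambda>i. 0}"
  by (auto simp: vecs_def)

lemma zero_in_vecs [simp]: "(\<lambda>i. 0) \<in> vecs M"
  by (simp add: vecs_def)

lemma bij_vecs_Suc:
  "bij_betw (\<lambda>(x, a). x(M := a)) (vecs M \<times> UNIV) (vecs (Suc M) :: (nat \<Rightarrow> 'a::zero) set)"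
proof (rule bij_betwI[where g = "\<lambda>x. (x(M := 0), x M)"])
  show "(\<lambda>(x, a). x(M := a)) \<in> vecs M \<times> UNIV \<rightarrow> vecs (Suc M)"
    by (auto simp: vecs_def)
  show "(\<lambda>x. (x(M := 0), x M)) \<in> vecs (Suc M) \<rightarrow> vecs M \<times> (UNIV :: 'a set)"
    by (auto simp: vecs_def le_Suc_eq not_less_eq_eq)
qed (auto simp: vecs_def fun_eq_iff)

lemma finite_vecs [simp]: "finite (vecs M :: (nat \<Rightarrow> 'a::{finite,zero}) set)"
proof (induction M)
  case (Suc M)
  then show ?case
    using bij_betw_finite[OF bij_vecs_Suc[where ?'a = 'a and M = M]] by simp
qed (simp add: vecs_0)

lemma card_vecs: "card (vecs M :: (nat \<Rightarrow> 'a::{finite,zero}) set) = CARD('a) ^ M"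
proof (induction M)
  case (Suc M)
  then show ?case
    using bij_betw_same_card[OF bij_vecs_Suc[where ?'a = 'a and M = M]]
    by (simp add: card_cartesian_product mult.commute)
qed (simp add: vecs_0)

lemma border_symm: "B \<in> symm M \<Longrightarrow> border M B b a \<in> symm (Suc M)"
  by (auto simp: symm_def border_def)

lemma bij_symm_Suc:
  "bij_betw (\<lambda>(B, b, a). border M B b a) (symm M \<times> vecs M \<times> UNIV)
     (symm (Suc M) :: (nat \<Rightarrow> nat \<Rightarrow> 'a::zero) set)"
proof (rule bij_betwI[where g = "\<lambda>B. ((\<lambda>i j. if i < M \<and> j < M then B i j else 0),
          (\<lambda>i. if i < M then B i M else 0), B M M)"])
  show "(\<lambda>(B, b, a). border M B b a) \<in> symm M \<times> vecs M \<times> UNIV \<rightarrow> symm (Suc M)"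
    by (auto simp: border_symm)
  show "(\<lambda>B. ((\<lambda>i j. if i < M \<and> j < M then B i j else 0), (\<lambda>i. if i < M then B i M else 0), B M M))
      \<in> symm (Suc M) \<rightarrow> symm M \<times> vecs M \<times> (UNIV :: 'a set)"
    by (auto simp: symm_def vecs_def)
next
  fix X :: "(nat \<Rightarrow> nat \<Rightarrow> 'a) \<times> (nat \<Rightarrow> 'a) \<times> 'a"
  assume X: "X \<in> symm M \<times> vecs M \<times> UNIV"
  obtain B b a where X': "X = (B, b, a)" by (cases X)
  have B: "B i j = 0" if "\<not> i < M \<or> \<not> j < M" for i j
    using X that unfolding X' symm_def by (metis (mono_tags, lifting) SigmaE2 leI mem_Collect_eq)
  have b: "b i = 0" if "\<not> i < M" for i
    using X that unfolding X' vecs_def by auto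
  show "(case case X of (B, b, a) \<Rightarrow> border M B b a of
      B \<Rightarrow> ((\<lambda>i j. if i < M \<and> j < M then B i j else 0), (\<lambda>i. if i < M then B i M else 0), B M M)) = X"
    using B b by (auto simp: X' border_def fun_eq_iff)
next
  fix B :: "nat \<Rightarrow> nat \<Rightarrow> 'a"
  assume B: "B \<in> symm (Suc M)"
  have 0: "B i j = 0" if "Suc M \<le> i \<or> Suc M \<le> j" for i j
    using B that unfolding symm_def by (metis (mono_tags, lifting) mem_Collect_eq)
  have s: "B i j = B j i" for i j
    using B unfolding symm_def by blast
  show "(case ((\<lambda>i j. if i < M \<and> j < M then B i j else 0), (\<lambda>i. if i < M then B i M else 0), B M M) of
      (B, b, a) \<Rightarrow> border M B b a) = B"
    using 0 s by (auto simp: border_def fun_eq_iff not_less_eq_eq)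
qed

lemma symm_0: "symm 0 = {\<lambda>i j. 0}"
  by (auto simp: symm_def)

lemma finite_symm [simp]: "finite (symm M :: (nat \<Rightarrow> nat \<Rightarrow> 'a::{finite,zero}) set)"
proof (induction M)
  case (Suc M)
  then show ?case
    using bij_betw_finite[OF bij_symm_Suc[where ?'a = 'a and M = M]] by simp
qed (simp add: symm_0)

lemma sum_symm_Suc:
  fixes f :: "(nat \<Rightarrow> nat \<Rightarrow> 'a::{finite,zero}) \<Rightarrow> 'b::comm_monoid_add"
  shows "(\<Sum>B\<in>symm (Suc M). f B) = (\<Sum>B\<in>symm M. \<Sum>b\<in>vecs M. \<Sum>a\<in>UNIV. f (border M B b a))"
  by (subst sum.reindex_bij_betw[OF bij_symm_Suc, symmetric])
     (simp add: sum.cartesian_product case_prod_unfold)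

lemma symm_Suc_cases:
  assumes "B \<in> symm (Suc M)"
  obtains B' b a where "B' \<in> symm M" "b \<in> vecs M" "B = border M B' b a"
  using assms bij_betw_imp_surj_on[OF bij_symm_Suc[where ?'a = 'a and M = M]]
  by (force simp: image_iff)

text \<open>The injection \<open>g\<close> permutes the finite set \<open>K\<close>, so
  \<open>sum f K = z * sum f K\<close>. The vanishing character sums below come from this, with
  \<open>g\<close> a translation.\<close>

lemma twisted_sum_zero:
  fixes f :: "'b \<Rightarrow> 'c::idom"
  assumes "finite K" "inj_on g K" "g ` K \<subseteq> K" "\<And>x. x \<in> K \<Longrightarrow> f (g x) = z * f x" "z \<noteq> 1"
  shows "sum f K = 0"
proof -
  have "g ` K = K" using assms by (simp add: endo_inj_surj)
  then have "sum f K = (\<Sum>x\<in>K. f (g x))"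
    using sum.reindex[OF assms(2), of f] by simp
  also have "\<dots> = z * sum f K" using assms(4) by (simp add: sum_distrib_left)
  finally have "(1 - z) * sum f K = 0" by (simp add: algebra_simps)
  then show ?thesis using assms(5) by simp
qed

section \<open>Additive characters and orthogonality\<close>

locale additive_character =
  fixes chi :: "'a::{field,finite} \<Rightarrow> complex"
  assumes nontrivial: "nontrivial_additive_character chi"
begin

lemma chi_nonzero: "chi x \<noteq> 0" and chi_add: "chi (x + y) = chi x * chi y"
  using nontrivial unfolding nontrivial_additive_character_def by auto

lemma chi_0: "chi 0 = 1"
  using chi_add[of 0 0] chi_nonzero[of 0] by simp

lemma chi_nontrivial_multiple:
  assumes "a \<noteq> 0"
  obtains c where "chi (c * a) \<noteq> 1"
proof -
  obtain x where "chi x \<noteq> 1" using nontrivial unfolding nontrivial_additive_character_def by auto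
  then show ?thesis using that[of "x / a"] assms by simp
qed

lemma chi_of_nat: "chi (of_nat n * x) = chi x ^ n"
  by (induction n) (simp_all add: chi_0 algebra_simps chi_add)

text \<open>Translation by 1 permutes the field, so summing all its elements gives
  \<open>of_nat CARD('a) = 0\<close>; hence \<open>chi x\<close> is a root of unity.\<close>

lemma norm_chi: "norm (chi x) = 1"
proof -
  have "(of_nat CARD('a) :: 'a) = 0"
  proof -
    have "(\<Sum>x\<in>UNIV. x) = (\<Sum>x\<in>UNIV. x + (1 :: 'a))"
      using sum.reindex[of "\<lambda>x. x + (1 :: 'a)" UNIV "\<lambda>x. x"] by (simp add: surj_plus_right)
    then show ?thesis by (simp add: sum.distrib)
  qed
  then have "chi x ^ CARD('a) = 1"
    using chi_of_nat[of "CARD('a)" x] by (simp add: chi_0)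
  then have "norm (chi x) ^ CARD('a) = 1"
    by (metis norm_one norm_power)
  then show ?thesis
    using power_eq_imp_eq_base[of "norm (chi x)" "CARD('a)" 1] by simp
qed

lemma cnj_chi: "cnj (chi x) = chi (- x)"
proof -
  have "chi x * chi (- x) = 1" using chi_add[of x "-x"] by (simp add: chi_0)
  moreover have "chi x * cnj (chi x) = 1"
    using norm_chi[of x] by (metis complex_norm_square of_real_1 power_one)
  ultimately show ?thesis using chi_nonzero[of x] by (metis mult_left_cancel)
qed

lemma sum_chi_mult: "(\<Sum>a\<in>UNIV. chi (a * c)) = (if c = 0 then of_nat CARD('a) else 0)"
proof (cases "c = 0")
  case False
  then obtain x where "chi (x * c) \<noteq> 1" using chi_nontrivial_multiple by blast
  then have "(\<Sum>a\<in>UNIV. chi (a * c)) = 0"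
    by (intro twisted_sum_zero[where g = "\<lambda>a. a + x" and z = "chi (x * c)"])
       (auto simp: inj_on_def algebra_simps chi_add)
  then show ?thesis using False by simp
qed (simp add: chi_0)

end

lemma card_fibres:
  assumes "finite A" "\<And>y. y \<in> f ` A \<Longrightarrow> card {x \<in> A. f x = y} = n"
  shows "card A = card (f ` A) * n"
proof -
  have "card A = (\<Sum>y\<in>f ` A. card {x \<in> A. f x = y})"
    using sum.image_gen[OF assms(1), of "\<lambda>_. 1 :: nat" f] by simp
  also have "\<dots> = (\<Sum>y\<in>f ` A. n)" using assms(2) by simp
  finally show ?thesis by simp
qed

section \<open>Subspaces, annihilators and kernels\<close>

definition vsubspace :: "nat \<Rightarrow> (nat \<Rightarrow> 'a::semiring_0) set \<Rightarrow> bool" where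
  "vsubspace M K \<longleftrightarrow> K \<subseteq> vecs M \<and> (\<lambda>i. 0) \<in> K \<and>
     (\<forall>x\<in>K. \<forall>y\<in>K. \<forall>c. (\<lambda>i. x i + c * y i) \<in> K)"

definition perp :: "nat \<Rightarrow> (nat \<Rightarrow> 'a::semiring_0) set \<Rightarrow> (nat \<Rightarrow> 'a) \<Rightarrow> bool" where
  "perp M K b \<longleftrightarrow> (\<forall>k\<in>K. dot M b k = 0)"

lemma dot_add_scale:
  "dot M (b :: nat \<Rightarrow> 'a::comm_ring_1) (\<lambda>i. x i + c * y i) = dot M b x + c * dot M b y"
  by (simp add: dot_def sum.distrib sum_distrib_left algebra_simps)

lemma vsubspaceD:
  assumes "vsubspace M K" "x \<in> K" "y \<in> K"
  shows "(\<lambda>i. x i + c * y i) \<in> K"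
  using assms unfolding vsubspace_def by blast

lemma vsubspace_scale:
  fixes x :: "nat \<Rightarrow> 'a::comm_ring_1"
  assumes "vsubspace M K" "x \<in> K"
  shows "(\<lambda>i. c * x i) \<in> K"
  using vsubspaceD[of M K "\<lambda>i. 0" x c] assms unfolding vsubspace_def by simp

lemma ker_vsubspace: "vsubspace M (ker M (B :: nat \<Rightarrow> nat \<Rightarrow> 'a::comm_ring_1))"
proof -
  have "(\<Sum>j<M. B i j * (x j + c * y j)) = (\<Sum>j<M. B i j * x j) + c * (\<Sum>j<M. B i j * y j)"
    for i x y c
    by (simp add: sum.distrib sum_distrib_left algebra_simps)
  then show ?thesis by (auto simp: vsubspace_def ker_def vecs_def)
qed

lemma finite_ker [simp]: "finite (ker M (B :: nat \<Rightarrow> nat \<Rightarrow> 'a::{finite,semiring_0}))"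
  unfolding ker_def by simp

context additive_character
begin

text \<open>Double counting of the sum of \<open>chi (dot M b k)\<close> over all \<open>b\<close>
  and all \<open>k \<in> K\<close>: the sum over \<open>k\<close> is \<open>card K\<close> or 0
  according to whether \<open>b\<close> annihilates \<open>K\<close>, and the sum over
  \<open>b\<close> is nonzero only for \<open>k = 0\<close>.\<close>

lemma card_perp:
  fixes K :: "(nat \<Rightarrow> 'a) set"
  assumes K: "vsubspace M K"
  shows "card K * card {b \<in> vecs M. perp M K b} = CARD('a) ^ M"
proof -
  have KM: "K \<subseteq> vecs M" and K0: "(\<lambda>i. 0) \<in> K" using K by (auto simp: vsubspace_def)
  have fK: "finite K" using KM finite_subset finite_vecs by blast
  have *: "(\<Sum>k\<in>K. chi (dot M b k)) = (if perp M K b then of_nat (card K) else 0)" for b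
  proof (cases "perp M K b")
    case False
    then obtain k0 where k0: "k0 \<in> K" "dot M b k0 \<noteq> 0" by (auto simp: perp_def)
    then obtain c where c: "chi (c * dot M b k0) \<noteq> 1" using chi_nontrivial_multiple by blast
    have "(\<Sum>k\<in>K. chi (dot M b k)) = 0"
    proof (rule twisted_sum_zero[where g = "\<lambda>k i. k i + c * k0 i" and z = "chi (c * dot M b k0)"])
      show "inj_on (\<lambda>k i. k i + c * k0 i) K" by (auto simp: inj_on_def fun_eq_iff)
      show "(\<lambda>k i. k i + c * k0 i) ` K \<subseteq> K" using vsubspaceD[OF K] k0 by blast
    qed (use fK c in \<open>auto simp: dot_add_scale chi_add\<close>)
    then show ?thesis using False by simp
  qed (simp add: perp_def chi_0)
  have **: "(\<Sum>b\<in>vecs M. chi (dot M b k)) = (if k = (\<lambda>i. 0) then of_nat (CARD('a) ^ M) else 0)"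
    if k: "k \<in> K" for k
  proof (cases "k = (\<lambda>i. 0)")
    case True
    then show ?thesis by (simp add: dot_def chi_0 card_vecs)
  next
    case False
    then obtain i where i: "k i \<noteq> 0" by auto
    then have iM: "i < M" using k KM by (metis (mono_tags, lifting) mem_Collect_eq not_le_imp_less subsetD vecs_def)
    obtain c where c: "chi (c * k i) \<noteq> 1" using chi_nontrivial_multiple i by blast
    \<comment> \<open>Changing \<open>b\<close> in one coordinate where \<open>k\<close> is nonzero
      multiplies the character by \<open>chi (c * k i) \<noteq> 1\<close>.\<close>
    have d: "dot M (b(i := b i + c)) k = dot M b k + c * k i" for b
    proof -
      have "dot M (b(i := b i + c)) k = (\<Sum>j<M. b j * k j + (if j = i then c * k i else 0))"
        unfolding dot_def by (rule sum.cong) (auto simp: algebra_simps)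
      then show ?thesis using iM by (simp add: sum.distrib dot_def)
    qed
    have "(\<Sum>b\<in>vecs M. chi (dot M b k)) = 0"
    proof (rule twisted_sum_zero[where g = "\<lambda>b. b(i := b i + c)" and z = "chi (c * k i)"])
      show "inj_on (\<lambda>b. b(i := b i + c)) (vecs M)"
        by (rule inj_on_inverseI[where g = "\<lambda>b. b(i := b i - c)"]) auto
      show "(\<lambda>b. b(i := b i + c)) ` vecs M \<subseteq> vecs M" using iM by (auto simp: vecs_def)
    qed (use c in \<open>auto simp: d chi_add\<close>)
    then show ?thesis using False by simp
  qed
  have "of_nat (card K * card {b \<in> vecs M. perp M K b})
      = (\<Sum>b\<in>vecs M. if perp M K b then of_nat (card K) else (0 :: complex))"
    by (simp add: sum.If_cases Int_def)
  also have "\<dots> = (\<Sum>b\<in>vecs M. \<Sum>k\<in>K. chi (dot M b k))" by (simp add: *)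
  also have "\<dots> = (\<Sum>k\<in>K. \<Sum>b\<in>vecs M. chi (dot M b k))" by (rule sum.swap)
  also have "\<dots> = (\<Sum>k\<in>K. if k = (\<lambda>i. 0) then of_nat (CARD('a) ^ M) else 0)"
    by (rule sum.cong[OF refl]) (rule **)
  also have "\<dots> = of_nat (CARD('a) ^ M)" using fK K0 by (simp add: sum.delta)
  finally show ?thesis unfolding of_nat_eq_iff .
qed

text \<open>A symmetric map has image equal to the orthogonal complement of its kernel, as both have
  the same size.\<close>

lemma perp_ker_imp_image:
  fixes B :: "nat \<Rightarrow> nat \<Rightarrow> 'a"
  assumes B: "B \<in> symm M" and b: "b \<in> vecs M" "perp M (ker M B) b"
  obtains x where "x \<in> vecs M" "\<And>i. i < M \<Longrightarrow> b i = (\<Sum>j<M. B i j * x j)"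
proof -
  define f where "f x = (\<lambda>i. if i < M then \<Sum>j<M. B i j * x j else 0)" for x
  have fadd: "f (\<lambda>i. x i + c * y i) = (\<lambda>i. f x i + c * f y i)" for x y c
    by (auto simp: f_def fun_eq_iff sum.distrib sum_distrib_left algebra_simps)
  have fker: "f x = (\<lambda>i. 0) \<longleftrightarrow> x \<in> ker M B" if "x \<in> vecs M" for x
    using that by (auto simp: f_def ker_def fun_eq_iff)
  \<comment> \<open>The fibres of \<open>f\<close> are cosets of the kernel, so the image has
    \<open>CARD('a) ^ M / card (ker M B)\<close> elements, which by \<open>card_perp\<close> is the
    size of the annihilator of the kernel.\<close>
  have fib: "card {x \<in> vecs M. f x = y} = card (ker M B)" if "y \<in> f ` vecs M" for y
  proof -
    obtain x0 where x0: "x0 \<in> vecs M" "y = f x0" using \<open>y \<in> f ` vecs M\<close> by auto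
    have "bij_betw (\<lambda>x i. x i + 1 * x0 i) (ker M B) {x \<in> vecs M. f x = y}"
    proof (rule bij_betwI[where g = "\<lambda>x i. x i + (-1) * x0 i"])
      show "(\<lambda>x i. x i + 1 * x0 i) \<in> ker M B \<rightarrow> {x \<in> vecs M. f x = y}"
      proof
        fix x assume x: "x \<in> ker M B"
        then have "x \<in> vecs M" by (simp add: ker_def)
        moreover have "f (\<lambda>i. x i + 1 * x0 i) = y"
          using fker[OF \<open>x \<in> vecs M\<close>] x by (simp only: fadd x0) simp
        ultimately show "(\<lambda>i. x i + 1 * x0 i) \<in> {x \<in> vecs M. f x = y}"
          using x0 by (auto simp: vecs_def)
      qed
      show "(\<lambda>x i. x i + (-1) * x0 i) \<in> {x \<in> vecs M. f x = y} \<rightarrow> ker M B"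
      proof
        fix x assume x: "x \<in> {x \<in> vecs M. f x = y}"
        then have v: "(\<lambda>i. x i + (-1) * x0 i) \<in> vecs M" using x0 by (auto simp: vecs_def)
        have "f (\<lambda>i. x i + (-1) * x0 i) = (\<lambda>i. 0)" using x x0 by (simp only: fadd) auto
        then show "(\<lambda>i. x i + (-1) * x0 i) \<in> ker M B" using fker[OF v] by simp
      qed
    qed auto
    then show ?thesis by (simp add: bij_betw_same_card)
  qed
  have "card (f ` vecs M) * card (ker M B) = card {b \<in> vecs M. perp M (ker M B) b} * card (ker M B)"
  proof -
    have "CARD('a) ^ M = card (f ` vecs M) * card (ker M B)"
      using card_fibres[of "vecs M" f, OF _ fib] by (simp add: card_vecs)
    then show ?thesis using card_perp[OF ker_vsubspace, of M B] by (metis mult.commute)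
  qed
  moreover have "card (ker M B) > 0"
    using ker_vsubspace[of M B] by (auto simp: card_gt_0_iff vsubspace_def)
  ultimately have "card (f ` vecs M) = card {b \<in> vecs M. perp M (ker M B) b}" by auto
  moreover have "f ` vecs M \<subseteq> {b \<in> vecs M. perp M (ker M B) b}"
  proof -
    have "dot M (f x) k = 0" if "k \<in> ker M B" for x k
    proof -
      have "dot M (f x) k = (\<Sum>i<M. \<Sum>j<M. B i j * x j * k i)"
        by (simp add: dot_def f_def sum_distrib_right)
      also have "\<dots> = (\<Sum>j<M. \<Sum>i<M. B i j * x j * k i)" by (rule sum.swap)
      also have "\<dots> = (\<Sum>j<M. x j * (\<Sum>i<M. B j i * k i))"
        using B by (simp add: sum_distrib_left symm_def algebra_simps)
      also have "\<dots> = 0" using that by (simp add: ker_def)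
      finally show ?thesis .
    qed
    then show ?thesis by (auto simp: perp_def f_def vecs_def)
  qed
  ultimately have "f ` vecs M = {b \<in> vecs M. perp M (ker M B) b}"
    by (intro card_subset_eq) auto
  then obtain x where "x \<in> vecs M" "b = f x" using b by blast
  then show ?thesis using that[of x] by (auto simp: f_def)
qed

end

section \<open>Kernel and rank of a bordered matrix\<close>

lemma ker_border:
  assumes "x \<in> vecs M"
  shows "x(M := c) \<in> ker (Suc M) (border M B b a) \<longleftrightarrow>
     (\<forall>i<M. (\<Sum>j<M. B i j * x j) + b i * c = 0) \<and> dot M b x + a * (c::'a::comm_ring_1) = 0"
proof -
  have v: "x(M := c) \<in> vecs (Suc M)" using assms by (auto simp: vecs_def)
  have 1: "(\<Sum>j<Suc M. border M B b a i j * (x(M := c)) j) = (\<Sum>j<M. B i j * x j) + b i * c"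
    if "i < M" for i
    using that by (simp add: border_def)
  have 2: "(\<Sum>j<Suc M. border M B b a M j * (x(M := c)) j) = dot M b x + a * c"
    by (simp add: border_def dot_def)
  show ?thesis
    unfolding ker_def mem_Collect_eq All_less_Suc
    using v 1 2 by (auto simp: less_Suc_eq simp del: sum.lessThan_Suc)
qed

lemma ker_border_cases:
  assumes "y \<in> ker (Suc M) B"
  obtains x c where "x \<in> vecs M" "y = x(M := c)"
proof -
  have "y \<in> vecs (Suc M)" using assms by (simp add: ker_def)
  then have "y(M := 0) \<in> vecs M" "y = (y(M := 0))(M := y M)"
    by (auto simp: vecs_def le_Suc_eq)
  then show ?thesis using that by blast
qed

lemma upd_vecs: "x \<in> vecs M \<Longrightarrow> x(M := 0) = x"
  by (auto simp: vecs_def)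

text \<open>A kernel vector \<open>k0\<close> of \<open>B\<close> with
  \<open>dot M b k0 \<noteq> 0\<close> forces the last coordinate of every kernel vector of the
  bordered matrix to be 0. What remains is the hyperplane \<open>dot M b x = 0\<close> of
  \<open>ker M B\<close>. The kernel shrinks by the factor \<open>q\<close> while the size grows by
  1, so the rank grows by 2 for every corner entry.\<close>

lemma card_ker_border_not_perp:
  fixes B :: "nat \<Rightarrow> nat \<Rightarrow> 'a::{finite,field}"
  assumes B: "B \<in> symm M" and np: "\<not> perp M (ker M B) b"
  shows "card (ker M B) = CARD('a) * card (ker (Suc M) (border M B b a))"
proof -
  obtain k0 where k0: "k0 \<in> ker M B" "dot M b k0 \<noteq> 0" using np by (auto simp: perp_def)
  have eq: "ker (Suc M) (border M B b a) = {x \<in> ker M B. dot M b x = 0}" (is "?L = ?R")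
  proof
    show "?R \<subseteq> ?L"
    proof
      fix x assume x: "x \<in> ?R"
      then have v: "x \<in> vecs M" by (simp add: ker_def)
      have "x(M := 0) \<in> ?L" using x by (subst ker_border[OF v]) (auto simp: ker_def)
      then show "x \<in> ?L" using upd_vecs[OF v] by simp
    qed
    show "?L \<subseteq> ?R"
    proof
      fix y assume y: "y \<in> ?L"
      then obtain x c where xc: "x \<in> vecs M" "y = x(M := c)" by (rule ker_border_cases)
      have h: "\<forall>i<M. (\<Sum>j<M. B i j * x j) + b i * c = 0" "dot M b x + a * c = 0"
        using y ker_border[OF xc(1)] xc(2) by auto
      \<comment> \<open>The first \<open>M\<close> equations are paired with \<open>k0\<close>: by
        symmetry the part with \<open>B\<close> vanishes and \<open>c * dot M b k0\<close> is
        left.\<close>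
      have "(\<Sum>i<M. k0 i * ((\<Sum>j<M. B i j * x j) + b i * c)) = 0" using h by simp
      then have "(\<Sum>i<M. \<Sum>j<M. k0 i * B i j * x j) + c * dot M b k0 = 0"
        by (simp add: dot_def sum.distrib sum_distrib_left algebra_simps)
      moreover have "(\<Sum>i<M. \<Sum>j<M. k0 i * B i j * x j) = (\<Sum>j<M. x j * (\<Sum>i<M. B j i * k0 i))"
        using B by (subst sum.swap) (simp add: sum_distrib_left symm_def algebra_simps)
      moreover have "\<dots> = 0" using k0 by (simp add: ker_def)
      ultimately have "c = 0" using k0 by simp
      then show "y \<in> ?R" using h xc upd_vecs[OF xc(1)] by (auto simp: ker_def)
    qed
  qed
  have img: "dot M b ` ker M B = UNIV"
  proof -
    have "y \<in> dot M b ` ker M B" for y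
    proof (rule image_eqI[where x = "\<lambda>i. (y / dot M b k0) * k0 i"])
      show "(\<lambda>i. y / dot M b k0 * k0 i) \<in> ker M B"
        by (rule vsubspace_scale[OF ker_vsubspace k0(1)])
      show "y = dot M b (\<lambda>i. y / dot M b k0 * k0 i)"
        using dot_add_scale[of M b "\<lambda>i. 0" "y / dot M b k0" k0] k0 by (simp add: dot_def)
    qed
    then show ?thesis by blast
  qed
  have "card (ker M B) = card (dot M b ` ker M B) * card {x \<in> ker M B. dot M b x = 0}"
  proof (rule card_fibres)
    fix y
    assume "y \<in> dot M b ` ker M B"
    then obtain x0 where x0: "x0 \<in> ker M B" "y = dot M b x0" by auto
    have "bij_betw (\<lambda>x i. x i + 1 * x0 i) {x \<in> ker M B. dot M b x = 0} {x \<in> ker M B. dot M b x = y}"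
      by (rule bij_betwI[where g = "\<lambda>x i. x i + (-1) * x0 i"])
         (use vsubspaceD[OF ker_vsubspace _ x0(1), of _ 1] vsubspaceD[OF ker_vsubspace _ x0(1), of _ "-1"]
           dot_add_scale[of M b _ 1 x0] dot_add_scale[of M b _ "-1" x0] in \<open>auto simp: x0(2)\<close>)
    then show "card {x \<in> ker M B. dot M b x = y} = card {x \<in> ker M B. dot M b x = 0}"
      by (simp add: bij_betw_same_card)
  qed simp
  then show ?thesis by (simp add: img eq)
qed

text \<open>With \<open>b = B x0\<close> the first \<open>M\<close> equations say that
  \<open>x + c x0\<close> lies in \<open>ker M B\<close>, and the last one becomes
  \<open>(a - dot M b x0) * c = 0\<close>. So \<open>c\<close> is free for exactly one corner entry
  \<open>a\<close> and is 0 for all others.\<close>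

lemma card_ker_border_perp:
  fixes B :: "nat \<Rightarrow> nat \<Rightarrow> 'a::{finite,field}"
  assumes B: "B \<in> symm M" and p: "perp M (ker M B) b"
    and x0: "x0 \<in> vecs M" "\<And>i. i < M \<Longrightarrow> b i = (\<Sum>j<M. B i j * x0 j)"
  shows "a \<noteq> dot M b x0 \<Longrightarrow> card (ker (Suc M) (border M B b a)) = card (ker M B)"
    and "a = dot M b x0 \<Longrightarrow> card (ker (Suc M) (border M B b a)) = CARD('a) * card (ker M B)"
proof -
  have lin: "(\<Sum>j<M. B i j * (x j + c * x0 j)) = (\<Sum>j<M. B i j * x j) + b i * c" if "i < M" for i x c
    using that x0(2) by (simp add: sum.distrib sum_distrib_left algebra_simps)
  have key: "x(M := c) \<in> ker (Suc M) (border M B b a) \<longleftrightarrow>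
      (\<lambda>i. x i + c * x0 i) \<in> ker M B \<and> (a - dot M b x0) * c = 0" if x: "x \<in> vecs M" for x c
  proof -
    have v: "(\<lambda>i. x i + c * x0 i) \<in> vecs M" using x x0 by (auto simp: vecs_def)
    have "(\<forall>i<M. (\<Sum>j<M. B i j * x j) + b i * c = 0) \<longleftrightarrow> (\<lambda>i. x i + c * x0 i) \<in> ker M B"
      using v lin by (auto simp: ker_def)
    moreover have "dot M b x + a * c = (a - dot M b x0) * c" if "(\<lambda>i. x i + c * x0 i) \<in> ker M B"
    proof -
      have "dot M b (\<lambda>i. x i + c * x0 i) = 0" using p that unfolding perp_def by blast
      then have "dot M b x = - c * dot M b x0" unfolding dot_add_scale by (simp add: eq_neg_iff_add_eq_0)
      then show ?thesis by (simp add: algebra_simps)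
    qed
    ultimately show ?thesis using ker_border[OF x] by auto
  qed
  {
    assume a: "a \<noteq> dot M b x0"
    have "ker (Suc M) (border M B b a) = ker M B"
    proof
      show "ker (Suc M) (border M B b a) \<subseteq> ker M B"
      proof
        fix y assume y: "y \<in> ker (Suc M) (border M B b a)"
        then obtain x c where xc: "x \<in> vecs M" "y = x(M := c)" by (rule ker_border_cases)
        then have "c = 0" "x \<in> ker M B" using key[OF xc(1), of c] y a by auto
        then show "y \<in> ker M B" using xc upd_vecs[OF xc(1)] by simp
      qed
      show "ker M B \<subseteq> ker (Suc M) (border M B b a)"
      proof
        fix x assume x: "x \<in> ker M B"
        then have v: "x \<in> vecs M" by (simp add: ker_def)
        have "x(M := 0) \<in> ker (Suc M) (border M B b a)" using x by (simp add: key[OF v] del: fun_upd_apply)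
        then show "x \<in> ker (Suc M) (border M B b a)" using upd_vecs[OF v] by simp
      qed
    qed
    then show "card (ker (Suc M) (border M B b a)) = card (ker M B)" by simp
  }
  {
    assume a: "a = dot M b x0"
    have "bij_betw (\<lambda>(x, c). (\<lambda>i. x i + (- c) * x0 i)(M := c)) (ker M B \<times> UNIV)
        (ker (Suc M) (border M B b a))"
    proof (rule bij_betwI[where g = "\<lambda>y. (\<lambda>i. (y(M := 0)) i + y M * x0 i, y M)"])
      have v: "(\<lambda>i. x i + (- c) * x0 i) \<in> vecs M" if "x \<in> ker M B" for x c
        using that x0 by (auto simp: ker_def vecs_def)
      show "(\<lambda>(x, c). (\<lambda>i. x i + (- c) * x0 i)(M := c)) \<in> ker M B \<times> UNIV
          \<rightarrow> ker (Suc M) (border M B b a)"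
      proof (clarify)
        fix x c assume x: "x \<in> ker M B"
        show "(\<lambda>i. x i + (- c) * x0 i)(M := c) \<in> ker (Suc M) (border M B b a)"
          using key[OF v[OF x], of c c] a x by simp
      qed
      show "(\<lambda>y. (\<lambda>i. (y(M := 0)) i + y M * x0 i, y M)) \<in> ker (Suc M) (border M B b a)
          \<rightarrow> ker M B \<times> UNIV"
      proof
        fix y assume y: "y \<in> ker (Suc M) (border M B b a)"
        then obtain x c where xc: "x \<in> vecs M" "y = x(M := c)" by (rule ker_border_cases)
        then have "(\<lambda>i. x i + c * x0 i) \<in> ker M B" using key[OF xc(1), of c] y by auto
        moreover have "y(M := 0) = x" "y M = c" using xc upd_vecs[OF xc(1)] by auto
        ultimately show "(\<lambda>i. (y(M := 0)) i + y M * x0 i, y M) \<in> ker M B \<times> UNIV" by simp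
      qed
    next
      fix X assume "X \<in> ker M B \<times> (UNIV :: 'a set)"
      then obtain x c where X: "X = (x, c)" "x \<in> vecs M" by (auto simp: ker_def)
      have "x M = 0" "x0 M = 0" using X(2) x0(1) by (auto simp: vecs_def)
      then show "(\<lambda>i. ((case X of (x, c) \<Rightarrow> (\<lambda>i. x i + (- c) * x0 i)(M := c))(M := 0)) i +
          (case X of (x, c) \<Rightarrow> (\<lambda>i. x i + (- c) * x0 i)(M := c)) M * x0 i,
          (case X of (x, c) \<Rightarrow> (\<lambda>i. x i + (- c) * x0 i)(M := c)) M) = X"
        by (auto simp: X(1) fun_eq_iff)
    next
      fix y :: "nat \<Rightarrow> 'a"
      have "x0 M = 0" using x0(1) by (auto simp: vecs_def)
      then show "(case (\<lambda>i. (y(M := 0)) i + y M * x0 i, y M) of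
          (x, c) \<Rightarrow> (\<lambda>i. x i + (- c) * x0 i)(M := c)) = y"
        by (auto simp: fun_eq_iff)
    qed
    then show "card (ker (Suc M) (border M B b a)) = CARD('a) * card (ker M B)"
      by (simp add: bij_betw_same_card[symmetric] card_cartesian_product mult.commute)
  }
qed

lemma card_field_gt_1: "1 < CARD('a::{finite,field})"
proof -
  have "card {0, 1 :: 'a} \<le> CARD('a)" by (intro card_mono) auto
  then show ?thesis by simp
qed

context additive_character
begin

lemma ex_mrank: "B \<in> symm M \<Longrightarrow> \<exists>r\<le>M. card (ker M (B :: nat \<Rightarrow> nat \<Rightarrow> 'a)) * CARD('a) ^ r = CARD('a) ^ M"
proof (induction M arbitrary: B)
  case 0
  then show ?case by (simp add: ker_def vecs_0)
next
  case (Suc M)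
  obtain B' b a where B: "B' \<in> symm M" "b \<in> vecs M" "B = border M B' b a"
    using symm_Suc_cases[OF Suc.prems] by blast
  obtain r where r: "r \<le> M" "card (ker M B') * CARD('a) ^ r = CARD('a) ^ M" using Suc.IH[OF B(1)] by blast
  show ?case
  proof (cases "perp M (ker M B') b")
    case True
    then obtain x where x: "x \<in> vecs M" "\<And>i. i < M \<Longrightarrow> b i = (\<Sum>j<M. B' i j * x j)"
      using perp_ker_imp_image[OF B(1,2)] by blast
    show ?thesis
    proof (cases "a = dot M b x")
      case True
      then show ?thesis using r card_ker_border_perp(2)[OF B(1) \<open>perp M (ker M B') b\<close> x]
        by (intro exI[of _ r]) (simp add: B(3))
    next
      case False
      then show ?thesis using r card_ker_border_perp(1)[OF B(1) \<open>perp M (ker M B') b\<close> x]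
        by (intro exI[of _ "Suc r"]) (simp add: B(3))
    qed
  next
    case False
    have c: "card (ker M B') = CARD('a) * card (ker (Suc M) B)"
      using card_ker_border_not_perp[OF B(1) False] B(3) by simp
    \<comment> \<open>Rank \<open>M\<close> would leave only the zero vector in the kernel, whose
      size is divisible by \<open>CARD('a)\<close> here. This keeps the new rank
      \<open>r + 2\<close> at most \<open>Suc M\<close>.\<close>
    have "r \<noteq> M"
    proof
      assume "r = M"
      then have "card (ker M B') = 1" using r card_field_gt_1[where 'a='a] by simp
      then show False using c card_field_gt_1[where 'a='a] by simp
    qed
    then show ?thesis using r c by (intro exI[of _ "Suc (Suc r)"]) (simp add: mult_ac)
  qed
qed

lemma mrank_eqI:
  assumes "card (ker M (B :: nat \<Rightarrow> nat \<Rightarrow> 'a)) * CARD('a) ^ r = CARD('a) ^ M"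
  shows "mrank M B = r"
proof -
  have "card (ker M B) \<noteq> 0" using assms card_field_gt_1[where 'a='a] by (intro notI) simp
  then have "s = r" if "card (ker M B) * CARD('a) ^ s = CARD('a) ^ M" for s
    using that assms card_field_gt_1[where 'a='a] power_inject_exp[of "CARD('a)" s r]
      mult_left_cancel[of "card (ker M B)" "CARD('a) ^ s" "CARD('a) ^ r"] by simp
  then show ?thesis unfolding mrank_def using assms by blast
qed

lemma card_ker_mrank:
  assumes "B \<in> symm M"
  shows "card (ker M (B :: nat \<Rightarrow> nat \<Rightarrow> 'a)) * CARD('a) ^ mrank M B = CARD('a) ^ M" "mrank M B \<le> M"
  using ex_mrank[OF assms] mrank_eqI by blast+

lemma mrank_border_not_perp:
  assumes "B \<in> symm M" "\<not> perp M (ker M (B :: nat \<Rightarrow> nat \<Rightarrow> 'a)) b"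
  shows "mrank (Suc M) (border M B b a) = mrank M B + 2"
  using card_ker_mrank[OF assms(1)] card_ker_border_not_perp[OF assms, of a]
  by (intro mrank_eqI) (simp add: mult_ac)

lemma mrank_border_perp:
  fixes B :: "nat \<Rightarrow> nat \<Rightarrow> 'a"
  assumes "B \<in> symm M" "b \<in> vecs M" "perp M (ker M B) b"
  obtains a0 where "\<And>a. mrank (Suc M) (border M B b a) = (if a = a0 then mrank M B else mrank M B + 1)"
proof -
  obtain x where x: "x \<in> vecs M" "\<And>i. i < M \<Longrightarrow> b i = (\<Sum>j<M. B i j * x j)"
    using perp_ker_imp_image[OF assms] by blast
  have "mrank (Suc M) (border M B b a) = (if a = dot M b x then mrank M B else mrank M B + 1)" for a
    using card_ker_mrank[OF assms(1)] card_ker_border_perp[OF assms(1,3) x, of a]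
    by (intro mrank_eqI) simp
  then show ?thesis using that by blast
qed

lemma mrank_border_0:
  assumes "B \<in> symm M"
  shows "mrank (Suc M) (border M (B :: nat \<Rightarrow> nat \<Rightarrow> 'a) (\<lambda>i. 0) 0) = mrank M B"
  using card_ker_mrank[OF assms(1)] card_ker_border_perp(2)[OF assms(1), of "\<lambda>i. 0" "\<lambda>i. 0" 0]
  by (intro mrank_eqI) (simp add: perp_def dot_def)

lemma sum_border:
  fixes B :: "nat \<Rightarrow> nat \<Rightarrow> 'a" and \<psi> :: "nat \<Rightarrow> 'c::comm_ring_1"
  assumes "B \<in> symm M" "b \<in> vecs M"
  shows "(\<Sum>a\<in>UNIV. \<psi> (mrank (Suc M) (border M B b a))) =
    (if perp M (ker M B) b then \<psi> (mrank M B) + of_nat (CARD('a) - 1) * \<psi> (mrank M B + 1)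
     else of_nat CARD('a) * \<psi> (mrank M B + 2))"
proof (cases "perp M (ker M B) b")
  case True
  obtain a0 where a0: "\<And>a. mrank (Suc M) (border M B b a) = (if a = a0 then mrank M B else mrank M B + 1)"
    using mrank_border_perp[OF assms True] by blast
  have "(\<Sum>a\<in>UNIV. \<psi> (mrank (Suc M) (border M B b a)))
      = \<psi> (mrank M B) + (\<Sum>a\<in>UNIV - {a0}. \<psi> (mrank M B + 1))"
    by (subst sum.remove[of _ a0]) (auto simp: a0)
  then show ?thesis using True by (simp add: card_Diff_singleton)
next
  case False
  then show ?thesis using mrank_border_not_perp[OF assms(1) False] by simp
qed

lemma card_perp_ker:
  assumes "B \<in> symm M"
  shows "card {b \<in> vecs M. perp M (ker M (B :: nat \<Rightarrow> nat \<Rightarrow> 'a)) b} = CARD('a) ^ mrank M B"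
proof -
  have "card (ker M B) * card {b \<in> vecs M. perp M (ker M B) b} = card (ker M B) * CARD('a) ^ mrank M B"
    using card_perp[OF ker_vsubspace] card_ker_mrank[OF assms] by simp
  moreover have "card (ker M B) \<noteq> 0"
    using card_ker_mrank[OF assms] card_field_gt_1[where 'a='a] by (intro notI) simp
  ultimately show ?thesis by simp
qed

text \<open>Bordering a matrix of rank \<open>r\<close> and size \<open>M\<close> by a vector outside the \<open>q\<^sup>r\<close> vectors of its image raises
  the rank by 2; bordering by a vector of the image keeps the rank for one corner entry and raises it
  by 1 for the others.\<close>

definition rank_step :: "nat \<Rightarrow> (nat \<Rightarrow> 'c::comm_ring_1) \<Rightarrow> nat \<Rightarrow> 'c" where
  "rank_step M \<psi> r =
     (of_nat (CARD('a) ^ M) - of_nat (CARD('a) ^ r)) * (of_nat CARD('a) * \<psi> (r + 2)) +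
     of_nat (CARD('a) ^ r) * (\<psi> r + of_nat (CARD('a) - 1) * \<psi> (r + 1))"

lemma sum_symm_rank_step:
  fixes \<psi> :: "nat \<Rightarrow> 'c::comm_ring_1"
  shows "(\<Sum>B\<in>symm (Suc M). \<psi> (mrank (Suc M) (B :: nat \<Rightarrow> nat \<Rightarrow> 'a))) =
     (\<Sum>B\<in>symm M. rank_step M \<psi> (mrank M (B :: nat \<Rightarrow> nat \<Rightarrow> 'a)))"
  unfolding sum_symm_Suc
proof (rule sum.cong[OF refl])
  fix B :: "nat \<Rightarrow> nat \<Rightarrow> 'a" assume B: "B \<in> symm M"
  let ?P = "{b \<in> vecs M. perp M (ker M B) b}" and ?r = "mrank M B"
  have "(\<Sum>b\<in>vecs M. \<Sum>a\<in>UNIV. \<psi> (mrank (Suc M) (border M B b a))) =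
      (\<Sum>b\<in>vecs M. if perp M (ker M B) b then \<psi> ?r + of_nat (CARD('a) - 1) * \<psi> (?r + 1)
     else of_nat CARD('a) * \<psi> (?r + 2))"
    by (rule sum.cong[OF refl]) (rule sum_border[OF B])
  also have "\<dots> = of_nat (card ?P) * (\<psi> ?r + of_nat (CARD('a) - 1) * \<psi> (?r + 1)) +
      of_nat (card (vecs M - ?P)) * (of_nat CARD('a) * \<psi> (?r + 2))"
  proof -
    have "vecs M \<inter> {x. perp M (ker M B) x} = ?P" "vecs M \<inter> - {x. perp M (ker M B) x} = vecs M - ?P"
      by auto
    then show ?thesis by (simp add: sum.If_cases)
  qed
  also have "card ?P = CARD('a) ^ ?r" by (rule card_perp_ker[OF B])
  also have "(of_nat (card (vecs M - ?P)) :: 'c) = of_nat (CARD('a) ^ M) - of_nat (CARD('a) ^ ?r)"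
  proof -
    have "card ?P \<le> card (vecs M :: (nat \<Rightarrow> 'a) set)" by (intro card_mono) auto
    then show ?thesis
      by (subst card_Diff_subset) (auto simp: card_perp_ker[OF B] card_vecs of_nat_diff)
  qed
  finally show "(\<Sum>b\<in>vecs M. \<Sum>a\<in>UNIV. \<psi> (mrank (Suc M) (border M B b a))) = rank_step M \<psi> ?r"
    by (simp add: rank_step_def)
qed

section \<open>Character sums over symmetric matrices\<close>

text \<open>For symmetric \<open>B\<close>, the only case considered, this is
  \<open>tr (A B)\<close>.\<close>

definition mat_pairing :: "nat \<Rightarrow> (nat \<Rightarrow> nat \<Rightarrow> 'a) \<Rightarrow> (nat \<Rightarrow> nat \<Rightarrow> 'a) \<Rightarrow> 'a" where
  "mat_pairing M A B = (\<Sum>i<M. \<Sum>j<M. A i j * B i j)"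

definition rank_sum :: "nat \<Rightarrow> (nat \<Rightarrow> complex) \<Rightarrow> (nat \<Rightarrow> nat \<Rightarrow> 'a) \<Rightarrow> complex" where
  "rank_sum M \<psi> A = (\<Sum>B\<in>symm M. \<psi> (mrank M B) * chi (mat_pairing M A B))"

definition hyp_step :: "(nat \<Rightarrow> complex) \<Rightarrow> nat \<Rightarrow> complex" where
  "hyp_step \<psi> r = of_nat CARD('a) ^ r *
     (\<psi> r + of_nat (CARD('a) - 1) * \<psi> (r + 1) - of_nat CARD('a) * \<psi> (r + 2))"

lemma sum_times_unit:
  fixes f :: "nat \<Rightarrow> 'a"
  assumes "i < M"
  shows "(\<Sum>k<M. f k * (if k = i then 1 else 0)) = f i"
proof -
  have "(\<Sum>k<M. f k * (if k = i then 1 else 0)) = (\<Sum>k<M. if k = i then f k else 0)"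
    by (rule sum.cong) auto
  then show ?thesis using assms by simp
qed

lemma sum_chi_perp:
  assumes "i < M"
  shows "(\<Sum>b\<in>vecs M. chi (b i)) = 0"
proof -
  obtain c where c: "chi c \<noteq> 1" using nontrivial unfolding nontrivial_additive_character_def by auto
  show ?thesis
  proof (rule twisted_sum_zero[where g = "\<lambda>b. b(i := b i + c)" and z = "chi c"])
    show "inj_on (\<lambda>b. b(i := b i + c)) (vecs M)"
      by (rule inj_on_inverseI[where g = "\<lambda>b. b(i := b i - c)"]) auto
  qed (use assms c finite_vecs[where M = M and ?'a = 'a] in \<open>auto simp: vecs_def chi_add\<close>)
qed

text \<open>For a vector \<open>b\<close> orthogonal to \<open>ker B\<close> the character \<open>b \<mapsto> chi (b i)\<close> is trivial exactly if the
  \<open>i\<close>-th unit vector lies in the kernel.\<close>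

lemma sum_chi_perp_ker:
  assumes B: "B \<in> symm M" and i: "i < M"
  shows "(\<Sum>b\<in>{b \<in> vecs M. perp M (ker M B) b}. chi (b i)) =
     (if \<forall>j<M. B j i = 0 then of_nat (CARD('a) ^ mrank M B) else 0)"
proof (cases "\<forall>j<M. B j i = 0")
  case True
  have "(\<lambda>j. if j = i then 1 else 0) \<in> ker M B"
    using True i by (auto simp: ker_def vecs_def sum_times_unit)
  then have "chi (b i) = 1" if "perp M (ker M B) b" for b
    using that sum_times_unit[OF i, of b] chi_0 unfolding perp_def dot_def by metis
  then have "(\<Sum>b\<in>{b \<in> vecs M. perp M (ker M B) b}. chi (b i)) = (\<Sum>b\<in>{b \<in> vecs M. perp M (ker M B) b}. 1)"
    by (intro sum.cong) auto
  then show ?thesis using True card_perp_ker[OF B] by simp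
next
  case False
  then obtain j where j: "j < M" "B j i \<noteq> 0" by auto
  obtain c where c: "chi (c * B j i) \<noteq> 1" using chi_nontrivial_multiple j by blast
  have "(\<Sum>b\<in>{b \<in> vecs M. perp M (ker M B) b}. chi (b i)) = 0"
  proof (rule twisted_sum_zero[where g = "\<lambda>b k. b k + c * B j k" and z = "chi (c * B j i)"])
    show "inj_on (\<lambda>b k. b k + c * B j k) {b \<in> vecs M. perp M (ker M B) b}"
      by (auto simp: inj_on_def fun_eq_iff)
    show "(\<lambda>b k. b k + c * B j k) ` {b \<in> vecs M. perp M (ker M B) b} \<subseteq> {b \<in> vecs M. perp M (ker M B) b}"
    proof clarify
      fix b assume b: "b \<in> vecs M" "perp M (ker M B) b"
      have s: "B j k = 0" if "M \<le> k" for k using B that unfolding symm_def by (metis (mono_tags, lifting) mem_Collect_eq)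
      have "dot M (\<lambda>k. b k + c * B j k) x = 0" if x: "x \<in> ker M B" for x
      proof -
        have "dot M (\<lambda>k. b k + c * B j k) x = dot M b x + c * (\<Sum>k<M. B j k * x k)"
          by (simp add: dot_def sum.distrib sum_distrib_left algebra_simps)
        then show ?thesis using x b j by (simp add: perp_def ker_def)
      qed
      then show "(\<lambda>k. b k + c * B j k) \<in> vecs M \<and> perp M (ker M B) (\<lambda>k. b k + c * B j k)"
        using b s by (auto simp: vecs_def perp_def)
    qed
  qed (use c in \<open>auto simp: chi_add\<close>)
  then show ?thesis using False by simp
qed

text \<open>\<open>A'\<close> adds a plane \<open>x_M x_(M+1)\<close> to the form of
  \<open>A\<close>. It pairs with the single entry \<open>B M (M + 1)\<close>, which is
  \<open>b' M\<close> when the matrix is bordered twice. Summing \<open>chi (b' M)\<close> over the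
  outer border kills every inner matrix whose last column is nonzero.\<close>

lemma rank_sum_hyperbolic:
  assumes Amm: "\<And>i j. i < M + 2 \<Longrightarrow> j < M + 2 \<Longrightarrow>
      A' i j = (if i < M \<and> j < M then A i j else if i = M \<and> j = M + 1 then 1 else 0)"
  shows "rank_sum (M + 2) \<psi> A' = rank_sum M (hyp_step \<psi>) A"
proof -
  let ?q = "of_nat CARD('a) :: complex"
  have pair: "mat_pairing (Suc (Suc M)) A' (border (Suc M) (border M B b a) b' a') = mat_pairing M A B + b' M"
    if "B \<in> symm M" for B b a b' a'
  proof -
    have "mat_pairing (Suc (Suc M)) A' (border (Suc M) (border M B b a) b' a') =
      (\<Sum>i<M. \<Sum>j<M. A' i j * B i j) + b' M"
      unfolding mat_pairing_def using Amm by (simp add: border_def)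
    then show ?thesis unfolding mat_pairing_def using Amm by simp
  qed
  have inner: "(\<Sum>b'\<in>vecs (Suc M). \<Sum>a'\<in>UNIV. \<psi> (mrank (Suc (Suc M)) (border (Suc M) B1 b' a')) * chi (b' M))
     = (if \<forall>j<Suc M. B1 j M = 0 then hyp_step \<psi> (mrank (Suc M) B1) else 0)"
    if B1: "B1 \<in> symm (Suc M)" for B1
  proof -
    let ?P = "{b \<in> vecs (Suc M). perp (Suc M) (ker (Suc M) B1) b}" and ?r = "mrank (Suc M) B1"
    let ?u = "\<psi> ?r + of_nat (CARD('a) - 1) * \<psi> (?r + 1)" and ?v = "?q * \<psi> (?r + 2)"
    have "(\<Sum>b'\<in>vecs (Suc M). \<Sum>a'\<in>UNIV. \<psi> (mrank (Suc (Suc M)) (border (Suc M) B1 b' a')) * chi (b' M)) =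
      (\<Sum>b'\<in>vecs (Suc M). (if perp (Suc M) (ker (Suc M) B1) b' then ?u else ?v) * chi (b' M))"
      using sum_border[OF B1, of _ \<psi>] by (intro sum.cong) (simp_all flip: sum_distrib_right)
    \<comment> \<open>The value \<open>?v\<close> taken off the image is extended to all
      \<open>b'\<close>, where its character sum vanishes; only the excess \<open>?u - ?v\<close> on
      the image contributes.\<close>
    also have "\<dots> = (\<Sum>b'\<in>vecs (Suc M). ?v * chi (b' M) + (?u - ?v) * (if perp (Suc M) (ker (Suc M) B1) b' then chi (b' M) else 0))"
      by (rule sum.cong) (auto simp: algebra_simps)
    also have "\<dots> = ?v * (\<Sum>b'\<in>vecs (Suc M). chi (b' M)) + (?u - ?v) * (\<Sum>b'\<in>?P. chi (b' M))"
      by (simp only: sum.distrib sum_distrib_left sum.inter_filter[OF finite_vecs])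
    also have "\<dots> = (if \<forall>j<Suc M. B1 j M = 0 then hyp_step \<psi> ?r else 0)"
      using sum_chi_perp_ker[OF B1, of M] sum_chi_perp[of M "Suc M"] by (auto simp: hyp_step_def)
    finally show ?thesis .
  qed
  have "rank_sum (M + 2) \<psi> A' = (\<Sum>B\<in>symm M. \<Sum>b\<in>vecs M. \<Sum>a\<in>UNIV. \<Sum>b'\<in>vecs (Suc M). \<Sum>a'\<in>UNIV.
      \<psi> (mrank (Suc (Suc M)) (border (Suc M) (border M B b a) b' a')) * chi (mat_pairing M A B + b' M))"
    unfolding rank_sum_def by (simp add: sum_symm_Suc pair)
  also have "\<dots> = (\<Sum>B\<in>symm M. \<Sum>b\<in>vecs M. \<Sum>a\<in>UNIV. chi (mat_pairing M A B) *
      (if \<forall>j<Suc M. border M B b a j M = 0 then hyp_step \<psi> (mrank (Suc M) (border M B b a)) else 0))"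
    by (intro sum.cong refl, subst inner[symmetric])
       (auto simp: border_symm chi_add sum_distrib_left mult_ac)
  also have "\<dots> = (\<Sum>B\<in>symm M. chi (mat_pairing M A B) * hyp_step \<psi> (mrank M B))"
  proof (rule sum.cong[OF refl])
    fix B :: "nat \<Rightarrow> nat \<Rightarrow> 'a" assume B: "B \<in> symm M"
    \<comment> \<open>The last column of the inner matrix consists of \<open>b\<close> and
      \<open>a\<close>, so the survivor is \<open>B\<close> bordered by zeros, of the same rank as
      \<open>B\<close>.\<close>
    have iff: "(\<forall>j<Suc M. border M B b a j M = 0) \<longleftrightarrow> b = (\<lambda>i. 0) \<and> a = 0" if "b \<in> vecs M" for b a
      using that by (auto simp: border_def vecs_def fun_eq_iff less_Suc_eq not_le)
         (metis not_le)+
    have "(\<Sum>b\<in>vecs M. \<Sum>a\<in>UNIV. chi (mat_pairing M A B) *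
      (if \<forall>j<Suc M. border M B b a j M = 0 then hyp_step \<psi> (mrank (Suc M) (border M B b a)) else 0))
      = (\<Sum>b\<in>vecs M. if b = (\<lambda>i. 0 :: 'a) then \<Sum>a\<in>UNIV. if a = (0 :: 'a) then chi (mat_pairing M A B) * hyp_step \<psi> (mrank M B) else 0 else 0)"
      by (rule sum.cong[OF refl]) (use mrank_border_0[OF B] in \<open>auto simp: iff simp flip: sum_distrib_left\<close>)
    then show "(\<Sum>b\<in>vecs M. \<Sum>a\<in>UNIV. chi (mat_pairing M A B) *
      (if \<forall>j<Suc M. border M B b a j M = 0 then hyp_step \<psi> (mrank (Suc M) (border M B b a)) else 0))
      = chi (mat_pairing M A B) * hyp_step \<psi> (mrank M B)"
      by (simp add: sum.delta)
  qed
  finally show ?thesis by (simp add: rank_sum_def mult.commute)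
qed

end

section \<open>The weight function\<close>

text \<open>For a prime power \<open>b\<close> this is the number of injective linear maps from a
  \<open>k\<close>-dimensional to an \<open>N\<close>-dimensional space over the field with
  \<open>b\<close> elements; it is used with \<open>b = q ^ 2\<close>. Its zeros at
  \<open>N < k\<close> determine the support of the weight.\<close>

definition qfall :: "real \<Rightarrow> nat \<Rightarrow> nat \<Rightarrow> real" where
  "qfall b k N = (\<Prod>i<k. b ^ N - b ^ i)"

lemma qfall_0 [simp]: "qfall b 0 N = 1"
  by (simp add: qfall_def)

lemma qfall_eq_0: "N < k \<Longrightarrow> qfall b k N = 0"
  by (auto simp: qfall_def)

lemma qfall_pos: "1 < b \<Longrightarrow> k \<le> N \<Longrightarrow> 0 < qfall b k N"
  unfolding qfall_def by (rule prod_pos) auto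

lemma qfall_Suc: "qfall b (Suc k) N = qfall b k N * (b ^ N - b ^ k)"
  by (simp add: qfall_def)

lemma qfall_Suc_Suc: "qfall b (Suc k) (Suc N) = (b ^ Suc N - 1) * b ^ k * qfall b k N"
proof -
  have "qfall b (Suc k) (Suc N) = (b ^ Suc N - 1) * (\<Prod>i<k. b * (b ^ N - b ^ i))"
    unfolding qfall_def prod.lessThan_Suc_shift by (simp add: algebra_simps)
  then show ?thesis unfolding prod.distrib by (simp add: qfall_def)
qed

text \<open>The difference operator that lowers \<open>k\<close>. The truncated \<open>k - 1\<close>
  is harmless at \<open>k = 0\<close>, where \<open>b ^ 0 - 1 = 0\<close>.\<close>

lemma qfall_diff:
  "qfall b k (Suc N) - qfall b k N = b ^ N * (b ^ k - 1) * qfall b (k - 1) N"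
proof (cases k)
  case (Suc j)
  show ?thesis using qfall_Suc_Suc[of b j N] qfall_Suc[of b j N] by (simp add: Suc algebra_simps)
qed simp

text \<open>Both sides are \<open>qfall b (Suc k) (Suc N)\<close>, with a factor split off at either
  end of the product.\<close>

lemma qfall_ratio: "(b ^ Suc N - 1) * b ^ k * qfall b k N = (b ^ Suc N - b ^ k) * qfall b k (Suc N)"
  using qfall_Suc_Suc[of b k N] qfall_Suc[of b k "Suc N"] by (metis mult.commute)

text \<open>Here \<open>r / 2\<close> is rounded up for \<open>c = 0\<close> and down for \<open>c = 1\<close>. Both half weights satisfy recursions
  under \<open>hyp_step\<close> that differ by a factor \<open>q\<close>, which the factor \<open>q ^ k\<close> in \<open>weight\<close> balances.\<close>

definition half_weight :: "real \<Rightarrow> nat \<Rightarrow> nat \<Rightarrow> nat \<Rightarrow> nat \<Rightarrow> real" where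
  "half_weight q c n k r = qfall (q ^ 2) k (n - (r + 1 - c) div 2)"

definition weight :: "real \<Rightarrow> nat \<Rightarrow> nat \<Rightarrow> nat \<Rightarrow> real" where
  "weight q n k r = half_weight q 1 n k r + q ^ k * half_weight q 0 n k r"

text \<open>The rank \<open>r + 1\<close> shares its rounded half with \<open>r\<close> or with
  \<open>r + 2\<close>, depending on parity and on \<open>c\<close>. So the combination collapses to
  a difference of two consecutive \<open>qfall\<close> values, and its prefactor is
  \<open>q ^ c * (q ^ 2) ^ l\<close> for either parity of \<open>r\<close>.\<close>

lemma half_weight_hyp:
  assumes "r + 2 \<le> 2 * n" "c \<le> 1"
  shows "q ^ r * (half_weight q c n k r + (q - 1) * half_weight q c n k (r + 1)
       - q * half_weight q c n k (r + 2))
     = q ^ c * (q ^ 2) ^ (n - 1) * ((q ^ 2) ^ k - 1) * half_weight q c (n - 1) (k - 1) r"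
proof -
  define l where "l = (r + 1 - c) div 2"
  define N where "N = n - 1 - l"
  have l: "n = Suc N + l" using assms unfolding l_def N_def by (cases c) auto
  let ?P = "\<lambda>N. qfall (q ^ 2) k N"
  have "q ^ r * (half_weight q c n k r + (q - 1) * half_weight q c n k (r + 1)
       - q * half_weight q c n k (r + 2)) = q ^ c * (q ^ 2) ^ l * (?P (Suc N) - ?P N)"
  proof (cases "even r")
    case True
    then obtain s where s: "r = 2 * s" by auto
    show ?thesis
    proof (cases "c = 0")
      case True
      then have "l = s" using s l_def by simp
      then show ?thesis using True s l by (simp add: half_weight_def algebra_simps flip: power_mult)
    next
      case False
      then have "c = 1" using assms by simp
      then have "l = s" using s l_def by simp
      then show ?thesis using \<open>c = 1\<close> s l by (simp add: half_weight_def algebra_simps flip: power_mult)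
    qed
  next
    case False
    then obtain s where s: "r = 2 * s + 1" by (auto elim: oddE)
    show ?thesis
    proof (cases "c = 0")
      case True
      then have "l = Suc s" using s l_def by simp
      then show ?thesis using True s l
        by (simp add: half_weight_def algebra_simps power_mult power2_eq_square)
    next
      case False
      then have "c = 1" using assms by simp
      then have "l = s" using s l_def by simp
      then show ?thesis using \<open>c = 1\<close> s l
        by (simp add: half_weight_def algebra_simps power_mult power2_eq_square)
    qed
  qed
  also have "\<dots> = q ^ c * (q ^ 2) ^ (n - 1) * ((q ^ 2) ^ k - 1) * half_weight q c (n - 1) (k - 1) r"
  proof -
    have "half_weight q c (n - 1) (k - 1) r = qfall (q ^ 2) (k - 1) N"
      by (simp only: half_weight_def N_def l_def)
    then show ?thesis unfolding qfall_diff using l by (simp add: power_add)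
  qed
  finally show ?thesis .
qed

text \<open>The half with \<open>c = 1\<close> gains a factor \<open>q\<close> that the half with
  \<open>c = 0\<close> lacks, and \<open>q ^ k = q * q ^ (k - 1)\<close> makes up for it. For
  \<open>k = 0\<close> both sides vanish.\<close>

lemma weight_hyp:
  assumes "r + 2 \<le> 2 * n"
  shows "q ^ r * (weight q n k r + (q - 1) * weight q n k (r + 1) - q * weight q n k (r + 2))
     = q * (q ^ 2) ^ (n - 1) * ((q ^ 2) ^ k - 1) * weight q (n - 1) (k - 1) r"
proof -
  have "q ^ r * (weight q n k r + (q - 1) * weight q n k (r + 1) - q * weight q n k (r + 2))
     = q ^ 1 * (q ^ 2) ^ (n - 1) * ((q ^ 2) ^ k - 1) * half_weight q 1 (n - 1) (k - 1) r
     + q ^ k * (q ^ 0 * (q ^ 2) ^ (n - 1) * ((q ^ 2) ^ k - 1) * half_weight q 0 (n - 1) (k - 1) r)"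
    unfolding half_weight_hyp[OF assms order_refl, symmetric] half_weight_hyp[OF assms zero_le_one, symmetric]
    by (simp add: weight_def algebra_simps)
  then show ?thesis by (cases k) (simp_all add: weight_def algebra_simps)
qed

lemma weight_0_right: "weight q n 0 r = 2"
  by (simp add: weight_def half_weight_def)

text \<open>Adding the halves merges the two roundings into one exponential in the corank
  \<open>2 * n - r\<close>, for both parities. The term \<open>q ^ (2 * n - r)\<close> is the kernel
  size that \<open>rank_sum_corank\<close> treats.\<close>

lemma weight_1:
  assumes "r \<le> 2 * n"
  shows "weight q n 1 r = (q + 1) * (q ^ (2 * n - r) - 1)"
proof (cases "even r")
  case True
  then obtain s where s: "r = 2 * s" by auto
  have "2 * n - r = 2 * (n - s)" using s by simp
  then show ?thesis unfolding weight_def half_weight_def qfall_def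
    by (simp add: s algebra_simps flip: power_mult)
next
  case False
  then obtain s where s: "r = 2 * s + 1" by (auto elim: oddE)
  define j where "j = n - Suc s"
  have j: "n = Suc s + j" using assms s by (simp add: j_def)
  then have "2 * n - r = 2 * j + 1" using s by simp
  then show ?thesis unfolding weight_def half_weight_def qfall_def
    by (simp add: s j algebra_simps power_mult power2_eq_square power_mult_distrib)
qed

text \<open>The half that rounds down is positive as long as \<open>r div 2 \<le> n - k\<close>,
  which includes the odd rank \<open>2 * (n - k) + 1\<close>; the half that rounds up is already 0
  at that rank. This is the origin of \<open>m - d + 1\<close>.\<close>

lemma weight_nonneg_pos:
  assumes "1 < q" "k \<le> n" "r \<le> 2 * n"
  shows "r \<le> 2 * (n - k) + 1 \<Longrightarrow> 0 < weight q n k r"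
    and "2 * (n - k) + 1 < r \<Longrightarrow> weight q n k r = 0"
proof -
  have q2: "1 < q ^ 2" using assms by simp
  have nn: "0 \<le> half_weight q c n k r" for c
    unfolding half_weight_def
    using qfall_pos[OF q2, of k "n - (r + 1 - c) div 2"] qfall_eq_0[of "n - (r + 1 - c) div 2" k]
    by (metis less_eq_real_def not_le_imp_less order_refl)
  {
    assume "r \<le> 2 * (n - k) + 1"
    then have "0 < half_weight q 1 n k r"
      unfolding half_weight_def using assms by (intro qfall_pos[OF q2]) auto
    then show "0 < weight q n k r"
      using nn[of 0] assms unfolding weight_def by (intro add_pos_nonneg) auto
  }
  {
    assume "2 * (n - k) + 1 < r"
    then show "weight q n k r = 0"
      using assms unfolding weight_def half_weight_def by (auto simp: qfall_eq_0)
  }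
qed

section \<open>Sums of the weight over all symmetric matrices\<close>

context additive_character
begin

text \<open>The same collapse as in \<open>half_weight_hyp\<close>; the additional term with
  \<open>q ^ (M + 1)\<close> stems from the total number \<open>q ^ M\<close> of border
  vectors.\<close>

lemma rank_step_half_weight:
  assumes "c \<le> 1" "r \<le> M"
  shows "rank_step M (half_weight (real CARD('a)) c n k) r =
    real CARD('a) ^ (M + 1) * half_weight (real CARD('a)) c n k (r + 2) +
    real CARD('a) ^ c * (real CARD('a) ^ 2) ^ ((r + 1 - c) div 2) *
      (half_weight (real CARD('a)) c n k r - half_weight (real CARD('a)) c n k (r + 2))"
proof -
  have q: "real (CARD('a) - 1) = real CARD('a) - 1"
    using card_field_gt_1[where 'a='a] by simp
  consider s where "r = 2 * s" "c = 0" | s where "r = 2 * s" "c = 1"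
    | s where "r = 2 * s + 1" "c = 0" | s where "r = 2 * s + 1" "c = 1"
    using assms(1) by (metis le_neq_implies_less less_one odd_two_times_div_two_succ dvd_mult_div_cancel)
  then show ?thesis
    unfolding rank_step_def q half_weight_def
    by cases (simp_all add: algebra_simps power_mult power2_eq_square power_mult_distrib)
qed

definition half_weight_sum :: "nat \<Rightarrow> nat \<Rightarrow> nat \<Rightarrow> nat \<Rightarrow> real" where
  "half_weight_sum c n k M =
     (\<Sum>B\<in>symm M. half_weight (real CARD('a)) c n k (mrank M (B :: nat \<Rightarrow> nat \<Rightarrow> 'a)))"

text \<open>For \<open>M + 1 = 2 * n + c\<close> the half weight is an eigenfunction of
  \<open>rank_step\<close>; \<open>qfall_ratio\<close> makes the quotient independent of
  \<open>r\<close>.\<close>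

lemma half_weight_sum_step1:
  assumes c: "c \<le> 1" and k: "k \<le> n" and M: "M + 1 = 2 * n + c"
  shows "half_weight_sum c n k (Suc M) = real CARD('a) ^ (2 * (n - k) + c) * half_weight_sum c n k M"
proof -
  let ?q = "real CARD('a)"
  have q: "?q \<noteq> 0" using card_field_gt_1[where 'a='a] by simp
  have "rank_step M (half_weight ?q c n k) r = ?q ^ (2 * (n - k) + c) * half_weight ?q c n k r"
    if r: "r \<le> M" for r
  proof -
    define l where "l = (r + 1 - c) div 2"
    have l: "l \<le> n" using r M l_def by simp
    have l2: "(r + 2 + 1 - c) div 2 = Suc l" using c unfolding l_def by (cases c) auto
    have nk: "?q ^ (2 * n) = ?q ^ (2 * (n - k)) * (?q ^ 2) ^ k"
    proof -
      have "2 * n = 2 * (n - k) + 2 * k" using k by simp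
      then show ?thesis by (metis power_add power_mult)
    qed
    show ?thesis
    proof (cases "n - l")
      \<comment> \<open>By truncated subtraction the half weight is \<open>qfall _ k 0\<close> at
        \<open>r\<close> and at \<open>r + 2\<close>, hence 0 unless \<open>k = 0\<close>.\<close>
      case 0
      then have "l = n" using l by simp
      then show ?thesis
        using k M unfolding rank_step_half_weight[OF c r] half_weight_def l2 l_def[symmetric]
        by (cases k) (simp_all add: qfall_eq_0 power_add)
    next
      case (Suc N)
      define P where "P = qfall (?q ^ 2) k (Suc N)"
      define P' where "P' = qfall (?q ^ 2) k N"
      have nl: "?q ^ (2 * n) = (?q ^ 2) ^ l * (?q ^ 2) ^ Suc N"
      proof -
        have "2 * n = 2 * l + 2 * Suc N" using Suc l by simp
        then show ?thesis by (metis power_add power_mult)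
      qed
      have ratio: "((?q ^ 2) ^ Suc N - 1) * (?q ^ 2) ^ k * P' = ((?q ^ 2) ^ Suc N - (?q ^ 2) ^ k) * P"
        unfolding P_def P'_def by (rule qfall_ratio)
      have "n - Suc l = N" using Suc by simp
      moreover have "?q ^ (M + 1) = ?q ^ c * ((?q ^ 2) ^ l * (?q ^ 2) ^ Suc N)"
        unfolding M nl[symmetric] by (simp add: power_add)
      ultimately have "rank_step M (half_weight ?q c n k) r
          = ?q ^ c * ((?q ^ 2) ^ l * (?q ^ 2) ^ Suc N) * P' + ?q ^ c * (?q ^ 2) ^ l * (P - P')"
        using Suc unfolding rank_step_half_weight[OF c r] half_weight_def l2 l_def[symmetric]
        by (simp add: P_def P'_def)
      also have "\<dots> = ?q ^ c * (?q ^ 2) ^ l * (((?q ^ 2) ^ Suc N - 1) * P' + P)"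
        by (simp add: algebra_simps)
      finally have rs: "rank_step M (half_weight ?q c n k) r
          = ?q ^ c * (?q ^ 2) ^ l * (((?q ^ 2) ^ Suc N - 1) * P' + P)" .
      \<comment> \<open>The factor \<open>(q ^ 2) ^ k\<close> is inserted so that
        \<open>ratio\<close> applies, and is cancelled at the end.\<close>
      have "(?q ^ 2) ^ k * rank_step M (half_weight ?q c n k) r
          = ?q ^ c * (?q ^ 2) ^ l * (((?q ^ 2) ^ Suc N - 1) * (?q ^ 2) ^ k * P' + (?q ^ 2) ^ k * P)"
        unfolding rs by (simp add: algebra_simps)
      also have "\<dots> = ?q ^ c * ((?q ^ 2) ^ l * (?q ^ 2) ^ Suc N) * P"
        unfolding ratio by (simp add: algebra_simps)
      also have "\<dots> = (?q ^ 2) ^ k * (?q ^ (2 * (n - k) + c) * P)"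
        unfolding nl[symmetric] nk by (simp add: power_add)
      finally have "rank_step M (half_weight ?q c n k) r = ?q ^ (2 * (n - k) + c) * P"
        using q by simp
      moreover have "half_weight ?q c n k r = P"
        unfolding half_weight_def l_def[symmetric] Suc P_def ..
      ultimately show ?thesis by simp
    qed
  qed
  then show ?thesis
    unfolding half_weight_sum_def sum_symm_rank_step sum_distrib_left
    by (intro sum.cong refl) (simp add: card_ker_mrank(2))
qed

text \<open>Adding 2 to the rank raises its rounded half by one, so the value for
  \<open>Suc n\<close> at rank \<open>r + 2\<close> is the value for \<open>n\<close> at rank
  \<open>r\<close>; the remaining difference is given by \<open>qfall_diff\<close>.\<close>

lemma half_weight_sum_step2:
  assumes c: "c \<le> 1"
  shows "half_weight_sum c (Suc n) k (Suc (2 * n + c)) =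
    real CARD('a) ^ (2 * n + c + 1) * half_weight_sum c n k (2 * n + c) +
    real CARD('a) ^ c * (real CARD('a) ^ 2) ^ n * ((real CARD('a) ^ 2) ^ k - 1) *
      half_weight_sum c n (k - 1) (2 * n + c)"
proof -
  let ?q = "real CARD('a)"
  have "rank_step (2 * n + c) (half_weight ?q c (Suc n) k) r = ?q ^ (2 * n + c + 1) * half_weight ?q c n k r
      + ?q ^ c * (?q ^ 2) ^ n * ((?q ^ 2) ^ k - 1) * half_weight ?q c n (k - 1) r"
    if r: "r \<le> 2 * n + c" for r
  proof -
    define l where "l = (r + 1 - c) div 2"
    define N where "N = n - l"
    have l: "n = N + l" using r l_def N_def by simp
    have l2: "(r + 2 + 1 - c) div 2 = Suc l" using c unfolding l_def by (cases c) auto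
    have diff: "qfall (?q ^ 2) k (Suc N) - qfall (?q ^ 2) k N
        = (?q ^ 2) ^ N * ((?q ^ 2) ^ k - 1) * qfall (?q ^ 2) (k - 1) N"
      by (rule qfall_diff)
    show ?thesis
      unfolding rank_step_half_weight[OF c r] half_weight_def l2 l_def[symmetric]
      using l diff by (simp add: power_add)
  qed
  then show ?thesis
    unfolding half_weight_sum_def sum_symm_rank_step sum_distrib_left sum.distrib[symmetric]
    by (intro sum.cong refl) (simp add: card_ker_mrank(2))
qed

text \<open>Both terms of \<open>half_weight_sum_step2\<close> carry the same power of
  \<open>q\<close>, so their \<open>qfall\<close> factors recombine through
  \<open>qfall_diff\<close>. \<open>IH\<close> is general in \<open>k\<close> because
  \<open>k\<close> and \<open>k - 1\<close> both occur.\<close>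

lemma half_weight_sum_odd_step:
  assumes c: "c \<le> 1" and k: "k \<le> Suc n"
    and IH: "\<And>k. half_weight_sum c n k (2 * n + c) =
      real CARD('a) ^ ((n - k + c) * (2 * n + 1)) * qfall (real CARD('a) ^ 2) k n"
  shows "half_weight_sum c (Suc n) k (Suc (2 * n + c)) =
    real CARD('a) ^ (c + (Suc n - k + c) * (2 * n + 1)) * qfall (real CARD('a) ^ 2) k (Suc n)"
proof -
  let ?q = "real CARD('a)"
  define e where "e = Suc n - k + c"
  have 1: "?q ^ (2 * n + c + 1) * half_weight_sum c n k (2 * n + c)
      = ?q ^ (c + e * (2 * n + 1)) * qfall (?q ^ 2) k n"
  proof (cases "k \<le> n")
    case True
    then have "e = Suc (n - k + c)" by (simp add: e_def)
    then have exp: "2 * n + c + 1 + (n - k + c) * (2 * n + 1) = c + e * (2 * n + 1)" by simp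
    show ?thesis unfolding IH mult.assoc[symmetric] power_add[symmetric] exp by simp
  next
    \<comment> \<open>Here \<open>k = Suc n\<close>: the exponents no longer agree, but
      \<open>qfall _ k n\<close> is 0 on both sides.\<close>
    case False
    then show ?thesis unfolding IH by (simp add: qfall_eq_0)
  qed
  have 2: "?q ^ c * (?q ^ 2) ^ n * ((?q ^ 2) ^ k - 1) * half_weight_sum c n (k - 1) (2 * n + c)
      = ?q ^ (c + e * (2 * n + 1)) * ((?q ^ 2) ^ n * ((?q ^ 2) ^ k - 1) * qfall (?q ^ 2) (k - 1) n)"
  proof (cases k)
    case (Suc j)
    then have "n - (k - 1) + c = e" by (simp add: e_def)
    then show ?thesis unfolding IH by (simp add: power_add)
  qed simp
  show ?thesis
    unfolding half_weight_sum_step2[OF c] 1 2 e_def[symmetric] qfall_diff[symmetric]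
    by (simp add: algebra_simps)
qed

text \<open>The size grows by two per step: \<open>half_weight_sum_odd_step\<close> and then
  \<open>half_weight_sum_step1\<close>, starting from matrices of size \<open>c\<close>.\<close>

lemma half_weight_sum_eq:
  assumes c: "c \<le> 1"
  shows "half_weight_sum c n k (2 * n + c) =
    real CARD('a) ^ ((n - k + c) * (2 * n + 1)) * qfall (real CARD('a) ^ 2) k n"
proof (induction n arbitrary: k)
  case 0
  have card1: "card (symm (Suc 0) :: (nat \<Rightarrow> nat \<Rightarrow> 'a) set) = CARD('a)"
    using sum_symm_Suc[of "\<lambda>_ :: nat \<Rightarrow> nat \<Rightarrow> 'a. 1 :: nat" 0] by (simp add: symm_0 vecs_0)
  show ?case
  proof (cases "c = 0")
    case True
    then show ?thesis by (cases k) (simp_all add: half_weight_sum_def half_weight_def symm_0 qfall_eq_0)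
  next
    case False
    then have "c = 1" using c by simp
    then show ?thesis by (cases k) (simp_all add: half_weight_sum_def half_weight_def card1 qfall_eq_0)
  qed
next
  case (Suc n)
  show ?case
  proof (cases "k \<le> Suc n")
    case True
    have exp: "2 * (Suc n - k) + c + (c + (Suc n - k + c) * (2 * n + 1)) = (Suc n - k + c) * (2 * Suc n + 1)"
      by (simp add: algebra_simps)
    have "half_weight_sum c (Suc n) k (Suc (Suc (2 * n + c))) = real CARD('a) ^ (2 * (Suc n - k) + c) *
        (real CARD('a) ^ (c + (Suc n - k + c) * (2 * n + 1)) * qfall (real CARD('a) ^ 2) k (Suc n))"
      using half_weight_sum_step1[OF c True, of "Suc (2 * n + c)"] half_weight_sum_odd_step[OF c True Suc.IH]
      by simp
    then show ?thesis
      unfolding mult.assoc[symmetric] power_add[symmetric] exp by simp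
  next
    case False
    then show ?thesis by (simp add: half_weight_sum_def half_weight_def qfall_eq_0)
  qed
qed

text \<open>Size \<open>2 * n\<close> ends a double step for \<open>c = 0\<close> but lies in the
  middle of one for \<open>c = 1\<close>. The factor \<open>q ^ k\<close> changes sides:
  \<open>weight\<close> puts it on the half with \<open>c = 0\<close>, and the summation produces it
  for the half with \<open>c = 1\<close>. The total is therefore again a multiple of
  \<open>weight\<close> at rank 0.\<close>

lemma sum_weight:
  assumes n: "1 \<le> n" and k: "k \<le> n"
  shows "(\<Sum>B\<in>symm (2 * n). weight (real CARD('a)) n k (mrank (2 * n) (B :: nat \<Rightarrow> nat \<Rightarrow> 'a))) =
    real CARD('a) ^ (n * (2 * (n - k) + 1)) * weight (real CARD('a)) n k 0"
proof -
  let ?q = "real CARD('a)"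
  obtain j where j: "n = Suc j" using n by (cases n) auto
  have 0: "half_weight_sum 0 n k (2 * n) = ?q ^ ((n - k) * (2 * n + 1)) * qfall (?q ^ 2) k n"
    using half_weight_sum_eq[of 0 n k] by simp
  have 1: "half_weight_sum 1 n k (2 * n) = ?q ^ (1 + (n - k + 1) * (2 * j + 1)) * qfall (?q ^ 2) k n"
    using half_weight_sum_odd_step[OF order_refl, of k j] half_weight_sum_eq[of 1 j] k j by simp
  obtain e where e: "n = e + k" using k by (metis le_add_diff_inverse2)
  have e0: "k + (n - k) * (2 * n + 1) = n * (2 * (n - k) + 1)" unfolding e by (simp add: algebra_simps)
  have "e + k = Suc j" using e j by simp
  then have "1 + (e + 1) * (2 * j + 1) = Suc j * (2 * e + 1) + k" by (simp add: algebra_simps)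
  moreover have "n - k = e" using e by simp
  ultimately have e1: "1 + (n - k + 1) * (2 * j + 1) = n * (2 * (n - k) + 1) + k"
    unfolding j[symmetric] by simp
  have "(\<Sum>B\<in>symm (2 * n). weight ?q n k (mrank (2 * n) (B :: nat \<Rightarrow> nat \<Rightarrow> 'a))) =
      half_weight_sum 1 n k (2 * n) + ?q ^ k * half_weight_sum 0 n k (2 * n)"
    by (simp add: weight_def half_weight_sum_def sum.distrib sum_distrib_left)
  also have "\<dots> = ?q ^ (n * (2 * (n - k) + 1) + k) * qfall (?q ^ 2) k n
      + ?q ^ (k + (n - k) * (2 * n + 1)) * qfall (?q ^ 2) k n"
    unfolding 0 1 e1 by (simp add: power_add)
  also have "\<dots> = ?q ^ (n * (2 * (n - k) + 1)) * weight ?q n k 0"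
    unfolding e0 by (simp add: weight_def half_weight_def algebra_simps power_add)
  finally show ?thesis .
qed

lemma hyp_step_weight:
  assumes "r + 2 \<le> 2 * n"
  shows "hyp_step (\<lambda>r. of_real (weight (real CARD('a)) n k r)) r =
    of_real (real CARD('a) * (real CARD('a) ^ 2) ^ (n - 1) * ((real CARD('a) ^ 2) ^ k - 1) *
      weight (real CARD('a)) (n - 1) (k - 1) r)"
proof -
  have "(of_nat (CARD('a) - 1) :: complex) = of_nat CARD('a) - 1"
    using card_field_gt_1[where 'a='a] by simp
  then show ?thesis
    unfolding weight_hyp[OF assms, symmetric] hyp_step_def by simp
qed

end

section \<open>Frames and matrices of forms\<close>

context finite_field_space
begin

definition comb :: "(nat \<Rightarrow> 'v) \<Rightarrow> nat \<Rightarrow> (nat \<Rightarrow> 'a) \<Rightarrow> 'v" where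
  "comb b k x = (\<Sum>i<k. scale (x i) (b i))"

text \<open>An ordered basis of \<open>U\<close> indexed from 0, encoded as a bijection from
  coordinate vectors so that cardinalities can be read off; \<open>frame_iff\<close> gives the usual
  description.\<close>

definition frame :: "(nat \<Rightarrow> 'v) \<Rightarrow> nat \<Rightarrow> 'v set \<Rightarrow> bool" where
  "frame b k U \<longleftrightarrow> bij_betw (comb b k) (vecs k) U"

lemma comb_add: "comb b k (\<lambda>i. x i + y i) = comb b k x + comb b k y"
  by (simp add: comb_def scale_left_distrib sum.distrib)

lemma comb_diff: "comb b k (\<lambda>i. x i - y i) = comb b k x - comb b k y"
  by (simp add: comb_def scale_left_diff_distrib sum_subtractf)

lemma comb_scale: "comb b k (\<lambda>i. c * x i) = scale c (comb b k x)"
  by (simp add: comb_def scale_sum_right)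

lemma comb_0 [simp]: "comb b k (\<lambda>i. 0) = 0"
  by (simp add: comb_def)

lemma comb_cong: "(\<And>i. i < k \<Longrightarrow> x i = y i) \<Longrightarrow> (\<And>i. i < k \<Longrightarrow> b i = c i) \<Longrightarrow> comb b k x = comb c k y"
  by (simp add: comb_def)

lemma comb_restrict: "comb b k (\<lambda>i. if i < k then x i else 0) = comb b k x"
  by (simp add: comb_def)

lemma comb_append:
  "comb b (k + l) x = comb b k x + comb (\<lambda>i. b (k + i)) l (\<lambda>i. x (k + i))"
  by (induction l) (simp_all add: comb_def add.assoc)

lemma comb_unit: "i < k \<Longrightarrow> comb b k (\<lambda>j. if j = i then 1 else 0) = b i"
proof -
  assume "i < k"
  have "comb b k (\<lambda>j. if j = i then 1 else 0) = (\<Sum>j<k. if j = i then b j else 0)"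
    unfolding comb_def by (rule sum.cong) auto
  then show ?thesis using \<open>i < k\<close> by simp
qed

lemma comb_span: "comb b k x \<in> span (b ` {..<k})"
  unfolding comb_def by (intro span_sum span_scale span_base) auto

lemma inj_comb_iff:
  "inj_on (comb b k) (vecs k) \<longleftrightarrow> (\<forall>x\<in>vecs k. comb b k x = 0 \<longrightarrow> x = (\<lambda>i. 0))"
proof
  assume *: "\<forall>x\<in>vecs k. comb b k x = 0 \<longrightarrow> x = (\<lambda>i. 0)"
  show "inj_on (comb b k) (vecs k)"
  proof
    fix x y :: "nat \<Rightarrow> 'a" assume xy: "x \<in> vecs k" "y \<in> vecs k" "comb b k x = comb b k y"
    then have "(\<lambda>i. x i - y i) \<in> vecs k" by (simp add: vecs_def)
    moreover have "comb b k (\<lambda>i. x i - y i) = 0" using xy by (simp add: comb_diff)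
    ultimately have "(\<lambda>i. x i - y i) = (\<lambda>i. 0)" using * by blast
    then show "x = y" by (auto simp: fun_eq_iff)
  qed
next
  assume "inj_on (comb b k) (vecs k)"
  then show "\<forall>x\<in>vecs k. comb b k x = 0 \<longrightarrow> x = (\<lambda>i. 0)"
    by (metis comb_0 inj_onD zero_in_vecs)
qed

lemma image_comb: "comb b k ` vecs k = span (b ` {..<k})"
proof
  show "comb b k ` vecs k \<subseteq> span (b ` {..<k})" using comb_span by blast
  have "subspace (comb b k ` vecs k)"
    unfolding subspace_def
  proof (intro conjI ballI allI)
    show "0 \<in> comb b k ` vecs k" by (rule image_eqI[of _ _ "\<lambda>i. 0"]) auto
    fix v w assume "v \<in> comb b k ` vecs k" "w \<in> comb b k ` vecs k"
    then obtain x y where "x \<in> vecs k" "y \<in> vecs k" "v = comb b k x" "w = comb b k y" by blast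
    then show "v + w \<in> comb b k ` vecs k"
      by (intro image_eqI[of _ _ "\<lambda>i. x i + y i"]) (auto simp: comb_add vecs_def)
  next
    fix c v assume "v \<in> comb b k ` vecs k"
    then obtain x where "x \<in> vecs k" "v = comb b k x" by blast
    then show "scale c v \<in> comb b k ` vecs k"
      by (intro image_eqI[of _ _ "\<lambda>i. c * x i"]) (auto simp: comb_scale vecs_def)
  qed
  moreover have "b ` {..<k} \<subseteq> comb b k ` vecs k"
  proof
    fix v assume "v \<in> b ` {..<k}"
    then obtain i where "i < k" "v = b i" by auto
    then show "v \<in> comb b k ` vecs k"
      by (intro image_eqI[of _ _ "\<lambda>j. if j = i then 1 else 0"]) (auto simp: comb_unit vecs_def)
  qed
  ultimately show "span (b ` {..<k}) \<subseteq> comb b k ` vecs k" by (simp add: span_minimal)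
qed

lemma inj_comb_iff_independent:
  "inj_on (comb b k) (vecs k) \<longleftrightarrow> inj_on b {..<k} \<and> independent (b ` {..<k})"
proof
  assume inj: "inj_on (comb b k) (vecs k)"
  have ib: "inj_on b {..<k}"
  proof
    fix i j assume ij: "i \<in> {..<k}" "j \<in> {..<k}" "b i = b j"
    then have "comb b k (\<lambda>l. if l = i then 1 else 0) = comb b k (\<lambda>l. if l = j then 1 else 0)"
      using comb_unit by simp
    then have "(\<lambda>l. if l = i then 1 else (0::'a)) = (\<lambda>l. if l = j then 1 else 0)"
      using ij by (intro inj_onD[OF inj]) (auto simp: vecs_def)
    then have "(if i = i then 1 else (0::'a)) = (if i = j then 1 else 0)" by (rule fun_cong)
    then show "i = j" by (simp split: if_splits)
  qed
  moreover have "independent (b ` {..<k})"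
  proof (rule independent_if_scalars_zero)
    fix f v assume f: "(\<Sum>x\<in>b ` {..<k}. scale (f x) x) = 0" and v: "v \<in> b ` {..<k}"
    have "comb b k (\<lambda>i. if i < k then f (b i) else 0) = 0"
      using f unfolding comb_restrict by (simp add: comb_def sum.reindex[OF ib])
    then have "(\<lambda>i. if i < k then f (b i) else 0) = (\<lambda>i. 0)"
      using inj unfolding inj_comb_iff by (simp add: vecs_def)
    then have *: "(if i < k then f (b i) else 0) = 0" for i by (rule fun_cong)
    from v obtain i where "i < k" "v = b i" by auto
    then show "f v = 0" using *[of i] by simp
  qed simp
  ultimately show "inj_on b {..<k} \<and> independent (b ` {..<k})" by blast
next
  assume *: "inj_on b {..<k} \<and> independent (b ` {..<k})"
  show "inj_on (comb b k) (vecs k)" unfolding inj_comb_iff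
  proof (intro ballI impI ext)
    fix x :: "nat \<Rightarrow> 'a" and i
    assume x: "x \<in> vecs k" "comb b k x = 0"
    let ?f = "\<lambda>v. x (the_inv_into {..<k} b v)"
    have "(\<Sum>v\<in>b ` {..<k}. scale (?f v) v) = 0"
      using x(2) * by (simp add: sum.reindex comb_def the_inv_into_f_f)
    then have "?f (b i) = 0" if "i < k"
      using that * by (intro independentD[where s = "b ` {..<k}"]) auto
    then show "x i = 0" using x * by (cases "i < k") (auto simp: the_inv_into_f_f vecs_def)
  qed
qed

lemma frame_iff: "frame b k U \<longleftrightarrow> inj_on b {..<k} \<and> independent (b ` {..<k}) \<and> span (b ` {..<k}) = U"
  unfolding frame_def bij_betw_def inj_comb_iff_independent image_comb by blast

lemma frame_dim: "frame b k U \<Longrightarrow> dim U = k"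
  unfolding frame_iff by (metis dim_span_eq_card_independent card_image card_lessThan)

lemma frame_card: "frame b k U \<Longrightarrow> card U = CARD('a) ^ k"
  unfolding frame_def by (metis bij_betw_same_card[of "comb b k" "vecs k" U] card_vecs[where M = k and ?'a = 'a])

lemma frame_finite: "frame b k U \<Longrightarrow> finite U"
  unfolding frame_def using bij_betw_finite finite_vecs by blast

lemma frame_exE:
  assumes "frame b k U" "v \<in> U"
  obtains x where "x \<in> vecs k" "v = comb b k x"
  using assms unfolding frame_def bij_betw_def by blast

lemma ordered_basis_iff_frame: "ordered_basis b \<longleftrightarrow> frame (\<lambda>i. b (Suc i)) (dim UNIV) UNIV"
proof -
  have 1: "b ` {1..dim UNIV} = (\<lambda>i. b (Suc i)) ` {..<dim UNIV}"
    using image_image[of b Suc "{..<dim UNIV}"] by (simp add: image_Suc_lessThan)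
  have "inj_on b {1..dim UNIV} \<longleftrightarrow> inj_on (\<lambda>i. b (Suc i)) {..<dim UNIV}"
    using comp_inj_on_iff[of Suc "{..<dim UNIV}" b] by (simp add: image_Suc_lessThan comp_def)
  then show ?thesis unfolding ordered_basis_def frame_iff 1 by blast
qed

lemma subspace_frame:
  assumes "subspace U" "finite U"
  obtains b where "frame b (dim U) U"
proof -
  obtain B where B: "B \<subseteq> U" "independent B" "U \<subseteq> span B" "card B = dim U" by (rule basis_exists)
  have fB: "finite B" using B(1) assms(2) finite_subset by blast
  then obtain h where h: "bij_betw h {0..<card B} B" using ex_bij_betw_nat_finite by blast
  have "span B = U" using B(1,3) assms(1) by (simp add: span_subspace)
  then have "frame h (dim U) U" using h B(2,4) unfolding frame_iff bij_betw_def atLeast0LessThan by simp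
  then show ?thesis by (rule that)
qed

text \<open>The given frame of the smaller space goes to the end, the place where normal forms keep
  their radical.\<close>

lemma frame_prepend:
  assumes c: "frame c l R" and R: "R \<subseteq> U" and U: "subspace U" "finite U"
  obtains b where "frame b (dim U) U" "l \<le> dim U" "\<And>i. i < l \<Longrightarrow> b (dim U - l + i) = c i"
proof -
  have ci: "inj_on c {..<l}" "independent (c ` {..<l})" "span (c ` {..<l}) = R" using c by (auto simp: frame_iff)
  have cU: "c ` {..<l} \<subseteq> U" using R span_superset[of "c ` {..<l}"] unfolding ci(3) by blast
  obtain B where B: "c ` {..<l} \<subseteq> B" "B \<subseteq> U" "independent B" "U \<subseteq> span B"
    by (rule maximal_independent_subset_extend[OF cU ci(2)])
  have fB: "finite B" using B(2) U finite_subset by blast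
  have spB: "span B = U" using B U(1) by (simp add: span_subspace)
  have dU: "card B = dim U" using basis_card_eq_dim[OF B(2,4,3)] .
  define k where "k = dim U - l"
  have l: "l \<le> dim U" using card_mono[OF fB B(1)] ci(1) dU by (simp add: card_image)
  have cD: "card (B - c ` {..<l}) = k"
    using fB B(1) ci(1) dU by (simp add: card_Diff_subset card_image k_def)
  then obtain h where h: "bij_betw h {0..<k} (B - c ` {..<l})"
    using ex_bij_betw_nat_finite[of "B - c ` {..<l}"] fB by auto
  define b where "b i = (if i < k then h i else c (i - k))" for i
  have kl: "dim U = k + l" using l k_def by simp
  have "bij_betw b {0..<k} (B - c ` {..<l})"
    using h by (subst bij_betw_cong[where g = h]) (auto simp: b_def)
  moreover have "bij_betw b {k..<k + l} (c ` {..<l})"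
  proof -
    have "bij_betw (\<lambda>i. i - k) {k..<k + l} {..<l}"
      by (rule bij_betwI[where g = "\<lambda>i. i + k"]) auto
    then have "bij_betw (c \<circ> (\<lambda>i. i - k)) {k..<k + l} (c ` {..<l})"
      by (rule bij_betw_trans) (simp add: bij_betw_def ci(1))
    then show ?thesis by (subst bij_betw_cong[where g = "c \<circ> (\<lambda>i. i - k)"]) (auto simp: b_def)
  qed
  ultimately have "bij_betw b ({0..<k} \<union> {k..<k + l}) (B - c ` {..<l} \<union> c ` {..<l})"
    by (rule bij_betw_combine) auto
  moreover have "{0..<k} \<union> {k..<k + l} = {..<dim U}" using kl by auto
  moreover have "B - c ` {..<l} \<union> c ` {..<l} = B" using B(1) by blast
  ultimately have "bij_betw b {..<dim U} B" by simp
  then have "frame b (dim U) U" using B spB unfolding frame_iff bij_betw_def by simp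
  moreover have "b (dim U - l + i) = c i" for i by (simp add: b_def k_def)
  ultimately show ?thesis using l by (intro that[of b])
qed

text \<open>The link between the coordinates of the definitions, numbered from 1, and frames,
  numbered from 0.\<close>

lemma coord_comb:
  assumes b: "ordered_basis b" and i: "i < dim UNIV"
  shows "coord b (Suc i) (comb (\<lambda>i. b (Suc i)) (dim UNIV) x) = x i"
proof -
  let ?B = "b ` {1..dim UNIV}" and ?m = "dim UNIV"
  have B: "inj_on b {1..?m}" "independent ?B" using b by (auto simp: ordered_basis_def)
  have e: "comb (\<lambda>i. b (Suc i)) ?m x = (\<Sum>j=1..?m. scale (x (j - 1)) (b j))"
    by (simp add: comb_def sum.atLeast1_atMost_eq)
  have "representation ?B (comb (\<lambda>i. b (Suc i)) ?m x) (b (Suc i))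
      = (\<Sum>j=1..?m. x (j - 1) * representation ?B (b j) (b (Suc i)))"
    unfolding e using B(2)
    by (subst representation_sum) (auto simp: representation_scale span_base span_scale)
  also have "\<dots> = (\<Sum>j=1..?m. if j = Suc i then x i else 0)"
  proof (rule sum.cong[OF refl])
    fix j assume j: "j \<in> {1..?m}"
    have "representation ?B (b j) = (\<lambda>v. if v = b j then 1 else 0)"
      using B(2) j by (intro representation_basis) auto
    moreover have "b (Suc i) = b j \<longleftrightarrow> j = Suc i" using inj_on_eq_iff[OF B(1), of "Suc i" j] i j by auto
    ultimately show "x (j - 1) * representation ?B (b j) (b (Suc i)) = (if j = Suc i then x i else 0)"
      by simp
  qed
  also have "\<dots> = x i" using i by simp
  finally show ?thesis by (simp add: coord_def)
qed

lemma frame_UNIV_ordered_basis: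
  assumes "frame b k UNIV"
  shows "ordered_basis (\<lambda>i. b (i - 1))"
  using assms frame_dim[OF assms] unfolding ordered_basis_iff_frame by simp

section \<open>Bilinear and quadratic forms in coordinates\<close>

lemma symmetric_bilinearD:
  assumes "S \<in> symmetric_bilinear_forms"
  shows "S x y = S y x" "S x (y + z) = S x y + S x z" "S x (scale c y) = c * S x y"
    "S (y + z) x = S y x + S z x" "S (scale c y) x = c * S y x"
    "S x (y - z) = S x y - S x z" "S (y - z) x = S y x - S z x" "S x 0 = 0" "S 0 x = 0"
    "S x (sum f A) = (\<Sum>i\<in>A. S x (f i))" "S (sum f A) x = (\<Sum>i\<in>A. S (f i) x)"
proof -
  have lin: "Vector_Spaces.linear scale (*) (S x)" for x
    using assms unfolding symmetric_bilinear_forms_def by auto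
  have sym: "S x y = S y x" for x y
    using assms unfolding symmetric_bilinear_forms_def by auto
  interpret L: Vector_Spaces.linear scale "(*)" "S x" for x by (rule lin)
  show "S x y = S y x" by (rule sym)
  show "S x (y + z) = S x y + S x z" "S x (scale c y) = c * S x y"
    "S x (y - z) = S x y - S x z" "S x 0 = 0" "S x (sum f A) = (\<Sum>i\<in>A. S x (f i))"
    by (simp_all add: L.add L.scale L.diff L.sum)
  show "S (y + z) x = S y x + S z x" "S (scale c y) x = c * S y x"
    "S (y - z) x = S y x - S z x" "S 0 x = 0" "S (sum f A) x = (\<Sum>i\<in>A. S (f i) x)"
    unfolding sym[of _ x] by (simp_all add: L.add L.scale L.diff L.sum)
qed

lemma symmetric_bilinearI:
  assumes "\<And>x y. S x y = S y x" "\<And>x y z. S x (y + z) = S x y + S x z"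
    "\<And>x c y. S x (scale c y) = c * S x y"
  shows "S \<in> symmetric_bilinear_forms"
proof -
  have "vector_space ((*) :: 'a \<Rightarrow> 'a \<Rightarrow> 'a)" by unfold_locales (auto simp: algebra_simps)
  then show ?thesis
    unfolding symmetric_bilinear_forms_def Vector_Spaces.linear_iff using assms vector_space_axioms by auto
qed

lemma quadraticD:
  assumes "Q \<in> quadratic_forms"
  shows "Q (scale c x) = c ^ 2 * Q x" "polar_form Q \<in> symmetric_bilinear_forms"
    "Q (x + y) = Q x + Q y + polar_form Q x y" "Q 0 = 0" "polar_form Q x x = 2 * Q x"
proof -
  show h: "Q (scale c x) = c ^ 2 * Q x" for c x using assms unfolding quadratic_forms_def by blast
  show "polar_form Q \<in> symmetric_bilinear_forms" using assms unfolding quadratic_forms_def by blast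
  show "Q (x + y) = Q x + Q y + polar_form Q x y" by (simp add: polar_form_def)
  show "Q 0 = 0" using h[of 0 0] by simp
  have "x + x = scale 2 x" by (metis one_add_one scale_left_distrib scale_one)
  then have "Q (x + x) = 4 * Q x" using h[of 2 x] by (simp add: power2_eq_square)
  then show "polar_form Q x x = 2 * Q x" by (simp add: polar_form_def)
qed

lemma quadraticI:
  assumes "\<And>c x. Q (scale c x) = c ^ 2 * Q x" "polar_form Q \<in> symmetric_bilinear_forms"
  shows "Q \<in> quadratic_forms"
  using assms unfolding quadratic_forms_def by blast

lemma bilinear_comb:
  assumes "S \<in> symmetric_bilinear_forms"
  shows "S (comb b k x) (comb c l y) = (\<Sum>i<k. \<Sum>j<l. x i * y j * S (b i) (c j))"
  unfolding comb_def symmetric_bilinearD(11)[OF assms]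
  unfolding symmetric_bilinearD(10)[OF assms]
  by (simp add: symmetric_bilinearD(3,5)[OF assms] mult_ac)

definition represents :: "(nat \<Rightarrow> 'v) \<Rightarrow> nat \<Rightarrow> (nat \<Rightarrow> nat \<Rightarrow> 'a) \<Rightarrow> ('v \<Rightarrow> 'a) \<Rightarrow> bool" where
  "represents b M A Q \<longleftrightarrow> (\<forall>x\<in>vecs M. Q (comb b M x) = (\<Sum>i<M. \<Sum>j<M. A i j * x i * x j))"

lemma representsD:
  assumes "represents b M A Q"
  shows "Q (comb b M x) = (\<Sum>i<M. \<Sum>j<M. A i j * x i * x j)"
proof -
  have "(\<lambda>i. if i < M then x i else 0) \<in> vecs M" by (simp add: vecs_def)
  then have "Q (comb b M (\<lambda>i. if i < M then x i else 0))
      = (\<Sum>i<M. \<Sum>j<M. A i j * (if i < M then x i else 0) * (if j < M then x j else 0))"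
    using assms unfolding represents_def by blast
  then show ?thesis unfolding comb_restrict by simp
qed

definition form_matrix :: "(nat \<Rightarrow> 'v) \<Rightarrow> ('v \<Rightarrow> 'a) \<Rightarrow> nat \<Rightarrow> nat \<Rightarrow> 'a" where
  "form_matrix b Q i j = (if i < j then polar_form Q (b i) (b j) else if i = j then Q (b i) else 0)"

lemma represents_form_matrix:
  assumes Q: "Q \<in> quadratic_forms"
  shows "represents b M (form_matrix b Q) Q"
proof -
  note S = quadraticD(2)[OF Q]
  have "Q (comb b M x) = (\<Sum>i<M. \<Sum>j<M. form_matrix b Q i j * x i * x j)" for x
  proof (induction M)
    case 0
    then show ?case by (simp add: comb_def quadraticD(4)[OF Q])
  next
    case (Suc M)
    have "Q (comb b (Suc M) x) = Q (comb b M x) + Q (scale (x M) (b M))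
        + polar_form Q (comb b M x) (scale (x M) (b M))"
      unfolding comb_def sum.lessThan_Suc by (rule quadraticD(3)[OF Q])
    also have "polar_form Q (comb b M x) (scale (x M) (b M)) = (\<Sum>i<M. form_matrix b Q i M * x i * x M)"
      unfolding comb_def
      by (simp add: symmetric_bilinearD(3,5,11)[OF S] sum_distrib_left form_matrix_def mult_ac)
    also have "Q (scale (x M) (b M)) = form_matrix b Q M M * x M * x M"
      by (simp add: quadraticD(1)[OF Q] form_matrix_def power2_eq_square mult_ac)
    also have "\<dots> = (\<Sum>j<Suc M. form_matrix b Q M j * x M * x j)" by (simp add: form_matrix_def)
    finally show ?case
      unfolding Suc by (simp add: sum.distrib algebra_simps)
  qed
  then show ?thesis by (simp add: represents_def)
qed

end

text \<open>The difference \<open>C\<close> is alternating: unit vectors give a zero diagonal, sums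
  of two of them give \<open>C k l + C l k = 0\<close>. An alternating matrix pairs to 0 with a
  symmetric one.\<close>

lemma mat_pairing_unique:
  fixes A A' B :: "nat \<Rightarrow> nat \<Rightarrow> 'a::{field,finite}"
  assumes eq: "\<And>x. x \<in> vecs M \<Longrightarrow> (\<Sum>i<M. \<Sum>j<M. A i j * x i * x j) = (\<Sum>i<M. \<Sum>j<M. A' i j * x i * x j)"
    and B: "\<And>i j. B i j = B j i"
  shows "(\<Sum>i<M. \<Sum>j<M. A i j * B i j) = (\<Sum>i<M. \<Sum>j<M. A' i j * B i j)"
proof -
  define C where "C i j = A i j - A' i j" for i j
  have C: "(\<Sum>i<M. \<Sum>j<M. C i j * x i * x j) = 0" if "x \<in> vecs M" for x
    using eq[OF that] by (simp add: C_def left_diff_distrib sum_subtractf)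
  \<comment> \<open>The value at \<open>s e_k + t e_l\<close>; the case \<open>k = l\<close> with
    \<open>t = 0\<close> serves for the diagonal.\<close>
  have two: "(\<Sum>i<M. \<Sum>j<M. C i j * ((if i = k then s else 0) + (if i = l then t else 0)) *
        ((if j = k then s else 0) + (if j = l then t else 0)))
      = s * s * C k k + s * t * C k l + t * s * C l k + t * t * C l l" if "k < M" "l < M" for k l s t
  proof -
    have "(\<Sum>i<M. \<Sum>j<M. C i j * ((if i = k then s else 0) + (if i = l then t else 0)) *
        ((if j = k then s else 0) + (if j = l then t else 0)))
      = (\<Sum>i<M. ((if i = k then s else 0) + (if i = l then t else 0)) *
          (\<Sum>j<M. (if j = k then s * C i j else 0) + (if j = l then t * C i j else 0)))"
      unfolding sum_distrib_left by (intro sum.cong refl) (auto simp: algebra_simps)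
    also have "\<dots> = (\<Sum>i<M. (if i = k then s * (s * C i k + t * C i l) else 0)
        + (if i = l then t * (s * C i k + t * C i l) else 0))"
      using that by (intro sum.cong refl) (auto simp: sum.distrib algebra_simps)
    also have "\<dots> = s * s * C k k + s * t * C k l + t * s * C l k + t * t * C l l"
      using that by (simp add: sum.distrib algebra_simps)
    finally show ?thesis .
  qed
  have diag: "C k k = 0" if "k < M" for k
  proof -
    have "(\<lambda>i. (if i = k then 1 else 0) + (if i = k then 0 else 0)) \<in> (vecs M :: (nat \<Rightarrow> 'a) set)"
      using that by (simp add: vecs_def)
    from C[OF this] show ?thesis using two[of k k 1 0] that by simp
  qed
  have off: "C k l + C l k = 0" if "k < M" "l < M" for k l
  proof -
    have "(\<lambda>i. (if i = k then 1 else 0) + (if i = l then 1 else 0)) \<in> (vecs M :: (nat \<Rightarrow> 'a) set)"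
      using that by (auto simp: vecs_def)
    from C[OF this] show ?thesis using two[of k l 1 1] that diag by simp
  qed
  have "(\<Sum>i<N. \<Sum>j<N. C i j * B i j) = 0" if "N \<le> M" for N
    using that
  proof (induction N)
    case (Suc N)
    have "(\<Sum>i<N. C i N * B i N) + (\<Sum>j<N. C N j * B N j) = (\<Sum>i<N. (C i N + C N i) * B i N)"
      unfolding sum.distrib[symmetric] by (intro sum.cong refl) (simp add: algebra_simps B[of N])
    also have "\<dots> = 0" using off Suc.prems by (intro sum.neutral) auto
    finally show ?case using Suc diag[of N] by (simp add: sum.distrib algebra_simps)
  qed simp
  from this[of M] show ?thesis by (simp add: C_def left_diff_distrib sum_subtractf)
qed

lemma sum_swap_pairs:
  "(\<Sum>k\<in>A. \<Sum>l\<in>B. \<Sum>i\<in>C. \<Sum>j\<in>D. f k l i j) = (\<Sum>i\<in>C. \<Sum>j\<in>D. \<Sum>k\<in>A. \<Sum>l\<in>B. f k l i j)"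
proof -
  have rot: "(\<Sum>k\<in>A. \<Sum>l\<in>B. \<Sum>i\<in>C. g k l i) = (\<Sum>i\<in>C. \<Sum>k\<in>A. \<Sum>l\<in>B. g k l i)" for C g
    by (rule trans[OF sum.cong[OF refl sum.swap] sum.swap])
  show ?thesis
    by (rule trans[OF rot sum.cong[OF refl rot]])
qed

section \<open>The pairing of quadratic and symmetric forms in coordinates\<close>

locale form_space = finite_field_space scale + additive_character chi
  for scale :: "'a::{field,finite} \<Rightarrow> 'v::ab_group_add \<Rightarrow> 'v" and chi :: "'a \<Rightarrow> complex" +
  fixes u w :: "nat \<Rightarrow> 'v"
  assumes u_basis: "ordered_basis u" and w_basis: "ordered_basis w"
begin

abbreviation N :: nat where "N \<equiv> dim (UNIV :: 'v set)"

lemma u_frame: "frame (\<lambda>i. u (Suc i)) N UNIV" and w_frame: "frame (\<lambda>i. w (Suc i)) N UNIV"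
  using u_basis w_basis ordered_basis_iff_frame by auto

lemma finite_V [simp]: "finite (A :: 'v set)"
  by (rule finite_subset[OF subset_UNIV frame_finite[OF u_frame]])

lemma finite_forms [simp]: "finite (A :: ('v \<Rightarrow> 'v \<Rightarrow> 'a) set)" "finite (B :: ('v \<Rightarrow> 'a) set)"
proof -
  have V: "finite (UNIV :: 'v set)" by simp
  have Q: "finite (UNIV :: ('v \<Rightarrow> 'a) set)"
    using finite_set_of_finite_funs[OF V, of "UNIV :: 'a set" undefined] by simp
  have S: "finite (UNIV :: ('v \<Rightarrow> 'v \<Rightarrow> 'a) set)"
    using finite_set_of_finite_funs[OF V Q, of undefined] by simp
  show "finite A" by (rule finite_subset[OF subset_UNIV S])
  show "finite B" by (rule finite_subset[OF subset_UNIV Q])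
qed

lemma card_subspace: "subspace U \<Longrightarrow> card U = CARD('a) ^ dim U"
  using subspace_frame[of U] frame_card by (metis finite_V)

lemma frame_UNIV_iff_surj: "frame b N UNIV \<longleftrightarrow> comb b N ` vecs N = UNIV"
proof
  assume *: "comb b N ` vecs N = UNIV"
  have "card (comb b N ` vecs N) = card (vecs N :: (nat \<Rightarrow> 'a) set)"
    using * frame_card[OF u_frame] card_vecs[where M = N and ?'a = 'a] by simp
  then have "inj_on (comb b N) (vecs N)" by (intro eq_card_imp_inj_on) simp
  then show "frame b N UNIV" using * by (simp add: frame_def bij_betw_def)
qed (simp add: frame_def bij_betw_def)

definition crd :: "(nat \<Rightarrow> 'v) \<Rightarrow> 'v \<Rightarrow> nat \<Rightarrow> 'a" where
  "crd b x = the_inv_into (vecs N) (comb b N) x"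

lemma crd:
  assumes "frame b N UNIV"
  shows "crd b x \<in> vecs N" "comb b N (crd b x) = x" "\<xi> \<in> vecs N \<Longrightarrow> crd b (comb b N \<xi>) = \<xi>"
    "crd b (x + y) = (\<lambda>i. crd b x i + crd b y i)" "crd b (scale c x) = (\<lambda>i. c * crd b x i)"
proof -
  have inj: "inj_on (comb b N) (vecs N)" and surj: "comb b N ` vecs N = UNIV"
    using assms by (auto simp: frame_def bij_betw_def)
  show v: "crd b x \<in> vecs N" for x
    unfolding crd_def using the_inv_into_into[OF inj, of x "vecs N"] surj by auto
  show c: "comb b N (crd b x) = x" for x
    unfolding crd_def using f_the_inv_into_f[OF inj, of x] surj by auto
  show i: "\<xi> \<in> vecs N \<Longrightarrow> crd b (comb b N \<xi>) = \<xi>" for \<xi>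
    unfolding crd_def by (rule the_inv_into_f_f[OF inj])
  have "(\<lambda>i. crd b x i + crd b y i) \<in> vecs N" "(\<lambda>i. c * crd b x i) \<in> vecs N"
    using v[of x] v[of y] by (auto simp: vecs_def)
  from this[THEN i] show "crd b (x + y) = (\<lambda>i. crd b x i + crd b y i)"
    "crd b (scale c x) = (\<lambda>i. c * crd b x i)"
    by (simp_all add: comb_add comb_scale c)
qed

definition gram :: "(nat \<Rightarrow> 'v) \<Rightarrow> ('v \<Rightarrow> 'v \<Rightarrow> 'a) \<Rightarrow> nat \<Rightarrow> nat \<Rightarrow> 'a" where
  "gram b S i j = (if i < N \<and> j < N then S (b i) (b j) else 0)"

lemma gram_eval:
  assumes "S \<in> symmetric_bilinear_forms"
  shows "S (comb b N x) (comb b N y) = (\<Sum>i<N. \<Sum>j<N. x i * y j * gram b S i j)"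
  unfolding bilinear_comb[OF assms] by (simp add: gram_def)

lemma bij_gram:
  assumes b: "frame b N UNIV"
  shows "bij_betw (gram b) symmetric_bilinear_forms (symm N)"
proof (rule bij_betwI[where g = "\<lambda>B x y. \<Sum>i<N. \<Sum>j<N. crd b x i * crd b y j * B i j"])
  show "gram b \<in> symmetric_bilinear_forms \<rightarrow> symm N"
    using symmetric_bilinearD(1) by (fastforce simp: gram_def symm_def)
  show "(\<lambda>B x y. \<Sum>i<N. \<Sum>j<N. crd b x i * crd b y j * B i j) \<in> symm N \<rightarrow> symmetric_bilinear_forms"
  proof (intro funcsetI symmetric_bilinearI)
    fix B :: "nat \<Rightarrow> nat \<Rightarrow> 'a" and x y z :: 'v and c :: 'a assume B: "B \<in> symm N"
    show "(\<Sum>i<N. \<Sum>j<N. crd b x i * crd b y j * B i j) = (\<Sum>i<N. \<Sum>j<N. crd b y i * crd b x j * B i j)"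
      using B by (subst sum.swap) (simp add: symm_def mult_ac)
    show "(\<Sum>i<N. \<Sum>j<N. crd b x i * crd b (y + z) j * B i j) =
        (\<Sum>i<N. \<Sum>j<N. crd b x i * crd b y j * B i j) + (\<Sum>i<N. \<Sum>j<N. crd b x i * crd b z j * B i j)"
      by (simp add: crd[OF b] sum.distrib algebra_simps)
    show "(\<Sum>i<N. \<Sum>j<N. crd b x i * crd b (scale c y) j * B i j) =
        c * (\<Sum>i<N. \<Sum>j<N. crd b x i * crd b y j * B i j)"
      by (simp add: crd[OF b] sum_distrib_left mult_ac)
  qed
next
  fix S assume S: "S \<in> symmetric_bilinear_forms"
  have "S x y = (\<Sum>i<N. \<Sum>j<N. crd b x i * crd b y j * gram b S i j)" for x y
    using gram_eval[OF S, of b "crd b x" "crd b y"] by (simp add: crd[OF b])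
  then show "(\<lambda>x y. \<Sum>i<N. \<Sum>j<N. crd b x i * crd b y j * gram b S i j) = S" by (simp add: fun_eq_iff)
next
  fix B :: "nat \<Rightarrow> nat \<Rightarrow> 'a" assume B: "B \<in> symm N"
  have e: "crd b (b i) = (\<lambda>j. if j = i then 1 else 0)" if "i < N" for i
    using crd(3)[OF b, of "\<lambda>j. if j = i then 1 else 0"] that comb_unit[OF that, of b] by (simp add: vecs_def)
  have "(\<Sum>i<N. \<Sum>j<N. crd b (b k) i * crd b (b l) j * B i j) = B k l" if "k < N" "l < N" for k l
  proof -
    have "(\<Sum>i<N. \<Sum>j<N. crd b (b k) i * crd b (b l) j * B i j)
        = (\<Sum>i<N. (\<Sum>j<N. B i j * crd b (b l) j) * crd b (b k) i)"
      by (simp add: sum_distrib_left sum_distrib_right mult_ac)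
    then show ?thesis
      unfolding e[OF that(1)] e[OF that(2)] sum_times_unit[OF that(1)] sum_times_unit[OF that(2)] .
  qed
  moreover have "B k l = 0" if "\<not> (k < N \<and> l < N)" for k l
    using B that unfolding symm_def by (metis (mono_tags, lifting) mem_Collect_eq not_le)
  ultimately show "gram b (\<lambda>x y. \<Sum>i<N. \<Sum>j<N. crd b x i * crd b y j * B i j) = B"
    by (auto simp: gram_def fun_eq_iff)
qed

lemma radical_subspace:
  assumes "S \<in> symmetric_bilinear_forms"
  shows "subspace (symmetric_radical S)"
  by (auto simp: subspace_def symmetric_radical_def symmetric_bilinearD(4,5,9)[OF assms])

text \<open>\<open>comb\<close> maps the kernel of the Gram matrix bijectively onto the radical;
  dimensions are compared through cardinalities.\<close>

lemma symmetric_rank_eq_mrank: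
  assumes S: "S \<in> symmetric_bilinear_forms" and b: "frame b N UNIV"
  shows "symmetric_rank S = mrank N (gram b S)"
proof -
  have "comb b N ` ker N (gram b S) = symmetric_radical S"
  proof
    show "comb b N ` ker N (gram b S) \<subseteq> symmetric_radical S"
    proof clarify
      fix x assume x: "x \<in> ker N (gram b S)"
      have "S (comb b N x) y = 0" for y
      proof -
        have "S y (comb b N x) = (\<Sum>i<N. crd b y i * (\<Sum>j<N. gram b S i j * x j))"
          using gram_eval[OF S, of b "crd b y" x] by (simp add: crd[OF b] sum_distrib_left mult_ac)
        also have "\<dots> = 0" using x by (simp add: ker_def)
        finally show ?thesis using symmetric_bilinearD(1)[OF S] by simp
      qed
      then show "comb b N x \<in> symmetric_radical S" by (simp add: symmetric_radical_def)
    qed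
    show "symmetric_radical S \<subseteq> comb b N ` ker N (gram b S)"
    proof
      fix y assume y: "y \<in> symmetric_radical S"
      have "(\<Sum>j<N. gram b S i j * crd b y j) = 0" if i: "i < N" for i
      proof -
        have "S y (b i) = S (b i) (comb b N (crd b y))"
          using symmetric_bilinearD(1)[OF S] by (simp add: crd[OF b])
        also have "\<dots> = (\<Sum>j<N. gram b S i j * crd b y j)"
          using i by (simp add: comb_def symmetric_bilinearD[OF S] gram_def mult_ac)
        finally show ?thesis using y by (simp add: symmetric_radical_def)
      qed
      then have "crd b y \<in> ker N (gram b S)" using crd(1)[OF b] by (simp add: ker_def)
      then show "y \<in> comb b N ` ker N (gram b S)" using crd(2)[OF b, of y] by (metis image_eqI)
    qed
  qed
  moreover have "inj_on (comb b N) (ker N (gram b S))"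
    using b unfolding frame_def bij_betw_def by (auto simp: ker_def intro: inj_on_subset)
  ultimately have "card (ker N (gram b S)) = CARD('a) ^ dim (symmetric_radical S)"
    using card_subspace[OF radical_subspace[OF S]] by (metis card_image)
  moreover have "dim (symmetric_radical S) \<le> N"
  proof -
    have "CARD('a) ^ dim (symmetric_radical S) \<le> CARD('a) ^ N"
      using card_subspace[OF radical_subspace[OF S]] card_subspace[of UNIV] card_mono[of UNIV "symmetric_radical S"]
      by simp
    then show ?thesis using card_field_gt_1[where 'a = 'a] by simp
  qed
  ultimately show ?thesis
    by (intro mrank_eqI[symmetric]) (simp add: symmetric_rank_def flip: power_add)
qed

text \<open>By \<open>mat_pairing_unique\<close> every representing matrix gives the same value,
  which frees the pairing from the matrix picked by \<open>SOME\<close> and from the indices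
  starting at 1.\<close>

lemma form_pairing_eq:
  assumes Q: "Q \<in> quadratic_forms" and S: "S \<in> symmetric_bilinear_forms"
    and A: "represents (\<lambda>i. u (Suc i)) N A Q"
  shows "form_pairing chi u w Q S = chi (mat_pairing N A (gram (\<lambda>i. w (Suc i)) S))"
proof -
  let ?u = "\<lambda>i. u (Suc i)" and ?w = "\<lambda>i. w (Suc i)"
  let ?P = "\<lambda>A. \<forall>x :: nat \<Rightarrow> 'a. Q (\<Sum>i=1..N. scale (x i) (u i)) = (\<Sum>i=1..N. \<Sum>j=1..N. A i j * x i * x j)"
  have "?P (\<lambda>i j. form_matrix ?u Q (i - 1) (j - 1))"
  proof
    fix x :: "nat \<Rightarrow> 'a"
    show "Q (\<Sum>i=1..N. scale (x i) (u i))
        = (\<Sum>i=1..N. \<Sum>j=1..N. form_matrix ?u Q (i - 1) (j - 1) * x i * x j)"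
      using representsD[OF represents_form_matrix[OF Q], of ?u N "\<lambda>i. x (Suc i)"]
      by (simp add: sum.atLeast1_atMost_eq comb_def)
  qed
  then have qm: "?P (quadratic_matrix u Q)" unfolding quadratic_matrix_def by (rule someI[of "\<lambda>A. ?P A"])
  define A' where "A' i j = quadratic_matrix u Q (Suc i) (Suc j)" for i j
  have A': "Q (comb ?u N x) = (\<Sum>i<N. \<Sum>j<N. A' i j * x i * x j)" for x
    using qm[rule_format, of "\<lambda>i. x (i - 1)"] by (simp add: sum.atLeast1_atMost_eq comb_def A'_def)
  have "(\<Sum>i=1..N. \<Sum>j=1..N. quadratic_matrix u Q i j * S (w j) (w i))
      = (\<Sum>i<N. \<Sum>j<N. A' i j * gram ?w S i j)"
    unfolding One_nat_def sum.atLeast1_atMost_eq A'_def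
    by (intro sum.cong refl) (use symmetric_bilinearD(1)[OF S] in \<open>simp add: gram_def\<close>)
  also have "\<dots> = (\<Sum>i<N. \<Sum>j<N. A i j * gram ?w S i j)"
  proof (rule mat_pairing_unique)
    show "(\<Sum>i<N. \<Sum>j<N. A' i j * x i * x j) = (\<Sum>i<N. \<Sum>j<N. A i j * x i * x j)" for x
      using representsD[OF A, of x] A'[of x] by simp
    show "gram ?w S i j = gram ?w S j i" for i j
      using symmetric_bilinearD(1)[OF S, of "?w i" "?w j"] by (simp add: gram_def)
  qed
  finally show ?thesis by (simp add: form_pairing_def mat_pairing_def)
qed

lemma represents_add:
  assumes "represents b M A Q" "represents b M A' Q'"
  shows "represents b M (\<lambda>i j. A i j - A' i j) (\<lambda>x. Q x - Q' x)"
  using assms by (simp add: represents_def left_diff_distrib sum_subtractf)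

lemma quadratic_forms_diff:
  assumes "Q \<in> quadratic_forms" "Q' \<in> quadratic_forms"
  shows "(\<lambda>x. Q x - Q' x) \<in> quadratic_forms"
proof (rule quadraticI)
  note S = symmetric_bilinearD[OF quadraticD(2)[OF assms(1)]] symmetric_bilinearD[OF quadraticD(2)[OF assms(2)]]
  have p: "polar_form (\<lambda>x. Q x - Q' x) x y = polar_form Q x y - polar_form Q' x y" for x y
    by (simp add: polar_form_def)
  show "polar_form (\<lambda>x. Q x - Q' x) \<in> symmetric_bilinear_forms"
  proof (rule symmetric_bilinearI)
    fix x y z c
    show "polar_form (\<lambda>x. Q x - Q' x) x y = polar_form (\<lambda>x. Q x - Q' x) y x"
      unfolding p S(1)[of x y] S(12)[of x y] ..
    show "polar_form (\<lambda>x. Q x - Q' x) x (y + z)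
        = polar_form (\<lambda>x. Q x - Q' x) x y + polar_form (\<lambda>x. Q x - Q' x) x z"
      unfolding p S(2) S(13) by simp
    show "polar_form (\<lambda>x. Q x - Q' x) x (scale c y) = c * polar_form (\<lambda>x. Q x - Q' x) x y"
      unfolding p S(3) S(14) by (simp add: algebra_simps)
  qed
  show "Q (scale c x) - Q' (scale c x) = c ^ 2 * (Q x - Q' x)" for c x
    by (simp add: quadraticD(1)[OF assms(1)] quadraticD(1)[OF assms(2)] algebra_simps)
qed

lemma form_pairing_diff:
  assumes Q: "Q \<in> quadratic_forms" "Q' \<in> quadratic_forms" and S: "S \<in> symmetric_bilinear_forms"
  shows "form_pairing chi u w (\<lambda>x. Q x - Q' x) S = form_pairing chi u w Q S * cnj (form_pairing chi u w Q' S)"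
proof -
  let ?u = "\<lambda>i. u (Suc i)" and ?w = "\<lambda>i. w (Suc i)"
  note r = represents_form_matrix[OF Q(1), of ?u N] represents_form_matrix[OF Q(2), of ?u N]
  have "mat_pairing N (\<lambda>i j. form_matrix ?u Q i j - form_matrix ?u Q' i j) (gram ?w S)
      = mat_pairing N (form_matrix ?u Q) (gram ?w S) + - mat_pairing N (form_matrix ?u Q') (gram ?w S)"
    by (simp add: mat_pairing_def left_diff_distrib sum_subtractf)
  then show ?thesis
    using form_pairing_eq[OF quadratic_forms_diff[OF Q] S represents_add[OF r]]
      form_pairing_eq[OF Q(1) S r(1)] form_pairing_eq[OF Q(2) S r(2)]
    by (simp only: cnj_chi chi_add)
qed

text \<open>Changing the basis for the quadratic forms amounts to a contragredient change of the basis
  for the symmetric forms.\<close>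

lemma pairing_change_basis:
  assumes b: "frame b N UNIV"
  shows "\<exists>w'. frame w' N UNIV \<and>
    (\<forall>Q\<in>quadratic_forms. \<forall>S\<in>symmetric_bilinear_forms. \<forall>A. represents b N A Q \<longrightarrow>
      form_pairing chi u w Q S = chi (mat_pairing N A (gram w' S)))"
proof -
  let ?u = "\<lambda>i. u (Suc i)" and ?w = "\<lambda>i. w (Suc i)"
  define P where "P i = crd b (?u i)" for i
  define P' where "P' i = crd ?u (b i)" for i
  \<comment> \<open>If \<open>u = P b\<close>, a form with matrix \<open>A\<close> in
    \<open>b\<close> has matrix \<open>P A P^T\<close> in \<open>u\<close>. Moving \<open>P\<close>
    to the other side of the pairing replaces the Gram matrix \<open>G\<close> of \<open>w\<close>
    by \<open>P^T G P\<close>, the one of \<open>w'\<close>.\<close>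
  define w' where "w' k = (\<Sum>i<N. scale (P i k) (?w i))" for k
  have u: "?u i = (\<Sum>k<N. scale (P i k) (b k))" for i
    using crd(2)[OF b, of "?u i"] by (simp add: P_def comb_def)
  have b': "b k = (\<Sum>j<N. scale (P' k j) (?u j))" for k
    using crd(2)[OF u_frame, of "b k"] by (simp add: P'_def comb_def)
  \<comment> \<open>\<open>P'\<close> inverts \<open>P\<close>, so the vectors of \<open>w\<close>
    are combinations of those of \<open>w'\<close>, and \<open>w'\<close> spans.\<close>
  have PP: "(\<Sum>k<N. P i k * P' k j) = (if j = i then 1 else 0)" if ij: "i < N" "j < N" for i j
  proof -
    have "comb ?u N (\<lambda>j. if j < N then \<Sum>k<N. P i k * P' k j else 0)
        = (\<Sum>j<N. \<Sum>k<N. scale (P i k * P' k j) (?u j))"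
      unfolding comb_restrict comb_def by (simp add: scale_sum_left)
    also have "\<dots> = (\<Sum>k<N. scale (P i k) (\<Sum>j<N. scale (P' k j) (?u j)))"
      by (subst sum.swap) (simp add: scale_sum_right)
    also have "\<dots> = (\<Sum>k<N. scale (P i k) (b k))"
      by (simp flip: b')
    also have "\<dots> = comb ?u N (\<lambda>j. if j = i then 1 else 0)"
      using u[of i] comb_unit[OF ij(1), of ?u] by simp
    finally have "crd ?u (comb ?u N (\<lambda>j. if j < N then \<Sum>k<N. P i k * P' k j else 0))
        = crd ?u (comb ?u N (\<lambda>j. if j = i then 1 else 0))" by simp
    moreover have "(\<lambda>j. if j = i then 1 else 0 :: 'a) \<in> vecs N"
      "(\<lambda>j. if j < N then \<Sum>k<N. P i k * P' k j else 0) \<in> vecs N" using ij by (auto simp: vecs_def)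
    ultimately have "(\<lambda>j. if j < N then \<Sum>k<N. P i k * P' k j else 0) = (\<lambda>j. if j = i then 1 else 0)"
      using crd(3)[OF u_frame] by simp
    from fun_cong[OF this, of j] show ?thesis using ij by simp
  qed
  have wj: "?w j = comb w' N (\<lambda>k. P' k j)" if j: "j < N" for j
  proof -
    have "comb w' N (\<lambda>k. P' k j) = (\<Sum>k<N. \<Sum>i<N. scale (P i k * P' k j) (?w i))"
      by (simp add: comb_def w'_def scale_sum_right mult.commute)
    also have "\<dots> = (\<Sum>i<N. scale (\<Sum>k<N. P i k * P' k j) (?w i))"
      unfolding scale_sum_left by (rule sum.swap)
    also have "\<dots> = (\<Sum>i<N. if i = j then ?w j else 0)"
      using j by (intro sum.cong refl) (auto simp: PP)
    finally show ?thesis using j by simp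
  qed
  have "comb w' N ` vecs N = UNIV"
  proof -
    have "?w j \<in> span (w' ` {..<N})" if "j < N" for j
      unfolding wj[OF that] by (rule comb_span)
    then have "span (?w ` {..<N}) \<subseteq> span (w' ` {..<N})"
      by (intro span_minimal subspace_span) auto
    moreover have "span (?w ` {..<N}) = UNIV" using w_frame by (simp add: frame_iff)
    ultimately show ?thesis unfolding image_comb by blast
  qed
  then have w': "frame w' N UNIV" by (simp add: frame_UNIV_iff_surj)
  show ?thesis
  proof (intro exI[of _ w'] conjI ballI allI impI w')
    fix Q S A assume Q: "Q \<in> quadratic_forms" and S: "S \<in> symmetric_bilinear_forms" and A: "represents b N A Q"
    define A' where "A' i j = (\<Sum>k<N. \<Sum>l<N. P i k * P j l * A k l)" for i j
    have "represents ?u N A' Q"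
      unfolding represents_def
    proof
      fix x :: "nat \<Rightarrow> 'a" assume "x \<in> vecs N"
      have "comb ?u N x = comb b N (\<lambda>k. \<Sum>i<N. x i * P i k)"
      proof -
        have "comb ?u N x = (\<Sum>i<N. scale (x i) (\<Sum>k<N. scale (P i k) (b k)))"
          by (simp add: comb_def flip: u)
        also have "\<dots> = (\<Sum>k<N. \<Sum>i<N. scale (x i * P i k) (b k))"
          by (subst sum.swap) (simp add: scale_sum_right)
        finally show ?thesis by (simp add: comb_def scale_sum_left)
      qed
      then have "Q (comb ?u N x) = (\<Sum>k<N. \<Sum>l<N. A k l * (\<Sum>i<N. x i * P i k) * (\<Sum>j<N. x j * P j l))"
        using representsD[OF A] by simp
      also have "\<dots> = (\<Sum>k<N. \<Sum>l<N. \<Sum>i<N. \<Sum>j<N. P i k * P j l * A k l * x i * x j)"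
      proof (intro sum.cong refl)
        fix k l
        have "A k l * (\<Sum>i<N. x i * P i k) * (\<Sum>j<N. x j * P j l)
            = A k l * (\<Sum>i<N. \<Sum>j<N. (x i * P i k) * (x j * P j l))"
          by (simp only: sum_product mult.assoc)
        also have "\<dots> = (\<Sum>i<N. \<Sum>j<N. A k l * ((x i * P i k) * (x j * P j l)))"
          by (simp only: sum_distrib_left)
        also have "\<dots> = (\<Sum>i<N. \<Sum>j<N. P i k * P j l * A k l * x i * x j)"
          by (intro sum.cong refl) (simp only: mult_ac)
        finally show "A k l * (\<Sum>i<N. x i * P i k) * (\<Sum>j<N. x j * P j l)
            = (\<Sum>i<N. \<Sum>j<N. P i k * P j l * A k l * x i * x j)" .
      qed
      also have "\<dots> = (\<Sum>i<N. \<Sum>j<N. \<Sum>k<N. \<Sum>l<N. P i k * P j l * A k l * x i * x j)"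
        by (rule sum_swap_pairs)
      also have "\<dots> = (\<Sum>i<N. \<Sum>j<N. A' i j * x i * x j)"
        by (simp add: A'_def sum_distrib_right)
      finally show "Q (comb ?u N x) = (\<Sum>i<N. \<Sum>j<N. A' i j * x i * x j)" .
    qed
    from form_pairing_eq[OF Q S this]
    have "form_pairing chi u w Q S = chi (mat_pairing N A' (gram ?w S))" .
    also have "mat_pairing N A' (gram ?w S)
        = (\<Sum>i<N. \<Sum>j<N. \<Sum>k<N. \<Sum>l<N. A k l * (P j l * (P i k * S (?w i) (?w j))))"
      unfolding mat_pairing_def A'_def sum_distrib_right
      by (intro sum.cong refl) (simp add: gram_def mult_ac)
    also have "\<dots> = (\<Sum>k<N. \<Sum>l<N. \<Sum>i<N. \<Sum>j<N. A k l * (P j l * (P i k * S (?w i) (?w j))))"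
      by (rule sum_swap_pairs)
    also have "\<dots> = (\<Sum>k<N. \<Sum>l<N. A k l * S (w' k) (w' l))"
      unfolding w'_def symmetric_bilinearD(11)[OF S]
      unfolding symmetric_bilinearD(10)[OF S] symmetric_bilinearD(3,5)[OF S] sum_distrib_left ..
    also have "\<dots> = mat_pairing N A (gram w' S)"
      by (simp add: mat_pairing_def gram_def)
    finally show "form_pairing chi u w Q S = chi (mat_pairing N A (gram w' S))" .
  qed
qed

definition form_rank_sum :: "(nat \<Rightarrow> complex) \<Rightarrow> ('v \<Rightarrow> 'a) \<Rightarrow> complex" where
  "form_rank_sum \<psi> Q = (\<Sum>S\<in>symmetric_bilinear_forms. \<psi> (symmetric_rank S) * form_pairing chi u w Q S)"

text \<open>\<open>gram w'\<close> is a bijection onto all symmetric matrices of size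
  \<open>N\<close>, so the change of basis disappears in the sum.\<close>

lemma form_rank_sum_eq:
  assumes Q: "Q \<in> quadratic_forms" and b: "frame b N UNIV" and A: "represents b N A Q"
  shows "form_rank_sum \<psi> Q = rank_sum N \<psi> A"
proof -
  obtain w' where w': "frame w' N UNIV"
    and pair: "\<forall>Q\<in>quadratic_forms. \<forall>S\<in>symmetric_bilinear_forms. \<forall>A. represents b N A Q \<longrightarrow>
      form_pairing chi u w Q S = chi (mat_pairing N A (gram w' S))"
    using pairing_change_basis[OF b] by (elim exE conjE)
  have "form_rank_sum \<psi> Q = (\<Sum>S\<in>symmetric_bilinear_forms. \<psi> (mrank N (gram w' S)) * chi (mat_pairing N A (gram w' S)))"
    unfolding form_rank_sum_def
    by (intro sum.cong refl) (simp add: symmetric_rank_eq_mrank[OF _ w'] pair[rule_format, OF Q _ A])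
  also have "\<dots> = rank_sum N \<psi> A"
    unfolding rank_sum_def by (rule sum.reindex_bij_betw[OF bij_gram[OF w']])
  finally show ?thesis .
qed

end

section \<open>Splitting off hyperbolic planes\<close>

fun hyp_factor :: "real \<Rightarrow> nat \<Rightarrow> nat \<Rightarrow> nat \<Rightarrow> real" where
  "hyp_factor q n k 0 = 1"
| "hyp_factor q n k (Suc s) = q * (q ^ 2) ^ (n - 1) * ((q ^ 2) ^ k - 1) * hyp_factor q (n - 1) (k - 1) s"

text \<open>The second parameter reaches 0 after \<open>k\<close> steps, and the next factor is
  \<open>(q ^ 2) ^ 0 - 1 = 0\<close>.\<close>

lemma hyp_factor_eq_0: "k < s \<Longrightarrow> hyp_factor q n k s = 0"
proof (induction s arbitrary: n k)
  case (Suc s)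
  then show ?case by (cases k) auto
qed simp

lemma hyp_factor_nonzero:
  assumes q: "1 < q"
  shows "s \<le> k \<Longrightarrow> hyp_factor q n k s \<noteq> 0"
proof (induction s arbitrary: n k)
  case (Suc s)
  have "1 < (q ^ 2) ^ k" using Suc.prems q by (intro one_less_power) auto
  then have "(q ^ 2) ^ k - 1 \<noteq> 0" by linarith
  then show ?case using Suc.IH[of "k - 1" "n - 1"] Suc.prems q
    unfolding hyp_factor.simps mult_eq_0_iff power_eq_0_iff by auto
qed simp

context additive_character
begin

lemma rank_sum_cong:
  assumes "\<And>r. r \<le> M \<Longrightarrow> \<psi> r = \<phi> r"
  shows "rank_sum M \<psi> A = rank_sum M \<phi> A"
  unfolding rank_sum_def by (rule sum.cong[OF refl]) (simp add: assms card_ker_mrank(2))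

lemma rank_sum_scale: "rank_sum M (\<lambda>r. c * \<psi> r) A = c * rank_sum M \<psi> A"
  unfolding rank_sum_def by (simp add: sum_distrib_left mult.assoc)

lemma rank_sum_diff: "rank_sum M (\<lambda>r. \<psi> r - \<phi> r) A = rank_sum M \<psi> A - rank_sum M \<phi> A"
  unfolding rank_sum_def by (simp add: sum_subtractf left_diff_distrib)

lemma mat_pairing_add_scale:
  "mat_pairing M A (\<lambda>i j. B i j + c * C i j) = mat_pairing M A B + c * mat_pairing M A C"
  by (simp add: mat_pairing_def sum.distrib sum_distrib_left algebra_simps)

text \<open>Adding a multiple of the rank one matrix \<open>y y^T\<close> moves the pairing by that
  multiple of the value of the form at \<open>y\<close>, which is nonzero.\<close>

lemma sum_chi_rank_one:
  assumes X: "X \<subseteq> symm M" and y: "y \<in> vecs M" "(\<Sum>i<M. \<Sum>j<M. A i j * y i * y j) \<noteq> 0"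
    and closed: "\<And>B c. B \<in> X \<Longrightarrow> (\<lambda>i j. B i j + c * (y i * y j)) \<in> X"
  shows "(\<Sum>B\<in>X. chi (mat_pairing M A B)) = 0"
proof -
  have ne: "mat_pairing M A (\<lambda>i j. y i * y j) \<noteq> 0"
    using y(2) by (simp add: mat_pairing_def mult.assoc)
  obtain c where c: "chi (c * mat_pairing M A (\<lambda>i j. y i * y j)) \<noteq> 1"
    using chi_nontrivial_multiple[OF ne] by blast
  show ?thesis
  proof (rule twisted_sum_zero)
    show "finite X" by (rule finite_subset[OF X]) simp
    show "inj_on (\<lambda>B i j. B i j + c * (y i * y j)) X" by (auto simp: inj_on_def fun_eq_iff)
    show "(\<lambda>B i j. B i j + c * (y i * y j)) ` X \<subseteq> X" using closed by blast
    show "chi (mat_pairing M A (\<lambda>i j. B i j + c * (y i * y j)))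
        = chi (c * mat_pairing M A (\<lambda>i j. y i * y j)) * chi (mat_pairing M A B)" for B
      unfolding mat_pairing_add_scale chi_add by simp
  qed (rule c)
qed

lemma rank_one_symm:
  "B \<in> symm M \<Longrightarrow> y \<in> vecs M \<Longrightarrow> (\<lambda>i j. B i j + c * (y i * y j :: 'a)) \<in> symm M"
  by (simp add: symm_def vecs_def mult.commute)

lemma rank_sum_const:
  assumes "y \<in> vecs M" "(\<Sum>i<M. \<Sum>j<M. A i j * y i * y j) \<noteq> 0"
  shows "rank_sum M (\<lambda>r. z) A = 0"
  using sum_chi_rank_one[OF order_refl assms] rank_one_symm[OF _ assms(1)]
  by (simp add: rank_sum_def flip: sum_distrib_left)

text \<open>\<open>q ^ (M - r)\<close> counts the kernel vectors \<open>v\<close> of a matrix of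
  rank \<open>r\<close>, so the order of summation can be exchanged. For fixed \<open>v\<close>, the
  matrices that annihilate \<open>v\<close> are closed under adding multiples of
  \<open>y y^T\<close> with \<open>y\<close> orthogonal to \<open>v\<close>; hence the
  hypothesis.\<close>

lemma rank_sum_corank:
  assumes ex: "\<And>v. v \<in> vecs M \<Longrightarrow>
    \<exists>y\<in>vecs M. dot M y v = 0 \<and> (\<Sum>i<M. \<Sum>j<M. A i j * y i * y j) \<noteq> 0"
  shows "rank_sum M (\<lambda>r. of_nat (CARD('a) ^ (M - r))) A = 0"
proof -
  have "rank_sum M (\<lambda>r. of_nat (CARD('a) ^ (M - r))) A
      = (\<Sum>B\<in>symm M. \<Sum>v\<in>vecs M. if v \<in> ker M B then chi (mat_pairing M A B) else 0)"
    unfolding rank_sum_def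
  proof (rule sum.cong[OF refl])
    fix B :: "nat \<Rightarrow> nat \<Rightarrow> 'a" assume B: "B \<in> symm M"
    have "card (ker M B) * CARD('a) ^ mrank M B = CARD('a) ^ (M - mrank M B) * CARD('a) ^ mrank M B"
      using card_ker_mrank[OF B] by (simp flip: power_add)
    then have "card (ker M B) = CARD('a) ^ (M - mrank M B)"
      using card_field_gt_1[where 'a = 'a] by simp
    moreover have "(\<Sum>v\<in>vecs M. if v \<in> ker M B then chi (mat_pairing M A B) else 0)
        = of_nat (card (ker M B)) * chi (mat_pairing M A B)"
    proof -
      have "vecs M \<inter> {v. v \<in> ker M B} = ker M B" by (auto simp: ker_def)
      then show ?thesis by (simp add: sum.If_cases)
    qed
    ultimately show "of_nat (CARD('a) ^ (M - mrank M B)) * chi (mat_pairing M A B)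
        = (\<Sum>v\<in>vecs M. if v \<in> ker M B then chi (mat_pairing M A B) else 0)" by simp
  qed
  also have "\<dots> = (\<Sum>v\<in>vecs M. \<Sum>B\<in>{B \<in> symm M. v \<in> ker M B}. chi (mat_pairing M A B))"
    by (subst sum.swap) (simp add: sum.inter_filter[symmetric])
  also have "\<dots> = 0"
  proof (rule sum.neutral, rule ballI)
    fix v :: "nat \<Rightarrow> 'a" assume v: "v \<in> vecs M"
    then obtain y where y: "y \<in> vecs M" "dot M y v = 0" "(\<Sum>i<M. \<Sum>j<M. A i j * y i * y j) \<noteq> 0"
      using ex by blast
    show "(\<Sum>B\<in>{B \<in> symm M. v \<in> ker M B}. chi (mat_pairing M A B)) = 0"
    proof (rule sum_chi_rank_one[OF _ y(1,3)])
      fix B c assume B: "B \<in> {B \<in> symm M. v \<in> ker M B}"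
      have "(\<Sum>j<M. (B i j + c * (y i * y j)) * v j) = (\<Sum>j<M. B i j * v j) + c * y i * dot M y v" for i
        by (simp add: dot_def sum.distrib sum_distrib_left algebra_simps)
      then show "(\<lambda>i j. B i j + c * (y i * y j)) \<in> {B \<in> symm M. v \<in> ker M B}"
        using B y rank_one_symm[of B M y c] by (simp add: ker_def)
    qed auto
  qed
  finally show ?thesis .
qed

text \<open>The planes are appended after \<open>A\<close> because bordering adds indices at the
  end; each contributes a single entry 1 above the diagonal.\<close>

definition hyp_ext :: "nat \<Rightarrow> (nat \<Rightarrow> nat \<Rightarrow> 'a) \<Rightarrow> nat \<Rightarrow> nat \<Rightarrow> 'a" where
  "hyp_ext M A i j = (if i < M \<and> j < M then A i j
     else if M \<le> i \<and> even (i - M) \<and> j = Suc i then 1 else 0)"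

lemma rank_sum_hyp_ext:
  assumes "M + 2 * s = 2 * n"
  shows "rank_sum (M + 2 * s) (\<lambda>r. of_real (weight (real CARD('a)) n k r)) (hyp_ext M A) =
    of_real (hyp_factor (real CARD('a)) n k s) * rank_sum M (\<lambda>r. of_real (weight (real CARD('a)) (n - s) (k - s) r)) A"
  using assms
proof (induction s arbitrary: n k)
  case 0
  then show ?case by (auto simp: rank_sum_def mat_pairing_def hyp_ext_def)
next
  case (Suc s)
  let ?q = "real CARD('a)"
  have n: "M + 2 * s = 2 * (n - 1)" using Suc.prems by simp
  have "rank_sum (M + 2 * s + 2) (\<lambda>r. of_real (weight ?q n k r)) (hyp_ext M A)
      = rank_sum (M + 2 * s) (hyp_step (\<lambda>r. of_real (weight ?q n k r))) (hyp_ext M A)"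
  proof (rule rank_sum_hyperbolic)
    fix i j assume "i < M + 2 * s + 2" "j < M + 2 * s + 2"
    \<comment> \<open>Parity: the index \<open>M + 2 * s\<close> starts a plane, so it is not the
      second index of one.\<close>
    moreover have "\<not> (M \<le> i \<and> even (i - M) \<and> M + 2 * s = Suc i)" by presburger
    ultimately show "hyp_ext M A i j = (if i < M + 2 * s \<and> j < M + 2 * s then hyp_ext M A i j
        else if i = M + 2 * s \<and> j = M + 2 * s + 1 then 1 else 0)"
      by (auto simp: hyp_ext_def simp del: even_diff_nat)
  qed
  also have "\<dots> = rank_sum (M + 2 * s) (\<lambda>r. of_real (?q * (?q ^ 2) ^ (n - 1) * ((?q ^ 2) ^ k - 1)) *
      of_real (weight ?q (n - 1) (k - 1) r)) (hyp_ext M A)"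
    using Suc.prems by (intro rank_sum_cong) (subst hyp_step_weight; simp)
  also have "\<dots> = of_real (?q * (?q ^ 2) ^ (n - 1) * ((?q ^ 2) ^ k - 1)) *
      (of_real (hyp_factor (real CARD('a)) (n - 1) (k - 1) s) *
        rank_sum M (\<lambda>r. of_real (weight ?q (n - 1 - s) (k - 1 - s) r)) A)"
    unfolding rank_sum_scale Suc.IH[OF n] ..
  finally show ?case by simp
qed

end

context form_space
begin

text \<open>Normal forms list the hyperbolic pairs first, \<open>hyp_ext\<close> lists them last;
  rotating the basis reconciles the two.\<close>

lemma frame_rotate:
  assumes b: "frame b N UNIV" and s: "l \<le> N"
  defines "b' \<equiv> \<lambda>i. if i < N - l then b (l + i) else b (i - (N - l))"
  shows "frame b' N UNIV"
    and "comb b' N x = comb b N (\<lambda>i. if i < l then x (N - l + i) else x (i - l))"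
proof -
  obtain M where M: "N = l + M" using s by (metis le_add_diff_inverse)
  have c: "comb b' (M + l) x = comb b (l + M) (\<lambda>i. if i < l then x (M + i) else x (i - l))" for x
    unfolding comb_append[of b'] comb_append[of b] add.commute[of "comb b' M x"]
    by (intro arg_cong2[of _ _ _ _ "(+)"] comb_cong) (auto simp: b'_def M)
  then show e: "comb b' N x = comb b N (\<lambda>i. if i < l then x (N - l + i) else x (i - l))" for x
  proof -
    have "N - l = M" using M by simp
    then show ?thesis using c[of x] M by (metis add.commute)
  qed
  have "v \<in> comb b' N ` vecs N" for v
  proof -
    obtain x where x: "x \<in> vecs N" "v = comb b N x" by (rule frame_exE[OF b UNIV_I])
    define y where "y i = (if i < N then if i < M then x (l + i) else x (i - M) else 0)" for i
    have "y \<in> vecs N" by (simp add: vecs_def y_def)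
    moreover have "comb b' N y = v"
      unfolding e x(2) by (rule comb_cong) (auto simp: y_def M)
    ultimately show ?thesis by blast
  qed
  then show "frame b' N UNIV" unfolding frame_UNIV_iff_surj by blast
qed

lemma sum_hyp_ext:
  "(\<Sum>i<M + 2 * s. \<Sum>j<M + 2 * s. hyp_ext M A i j * x i * x j)
    = (\<Sum>i<M. \<Sum>j<M. A i j * x i * x j) + (\<Sum>i<s. x (M + 2 * i) * x (M + 2 * i + 1))"
proof (induction s)
  case 0
  then show ?case by (simp add: hyp_ext_def)
next
  case (Suc s)
  let ?K = "M + 2 * s"
  have z: "hyp_ext M A i ?K = 0" "hyp_ext M A (Suc ?K) i = 0" "hyp_ext M A ?K i = (if i = Suc ?K then 1 else 0)"
    if "i < Suc (Suc ?K)" for i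
  proof -
    have "\<not> (M \<le> i \<and> even (i - M) \<and> M + 2 * s = Suc i)"
      "\<not> (M \<le> Suc ?K \<and> even (Suc ?K - M))" by presburger+
    then show "hyp_ext M A i ?K = 0" "hyp_ext M A (Suc ?K) i = 0"
      "hyp_ext M A ?K i = (if i = Suc ?K then 1 else 0)"
      using that by (auto simp: hyp_ext_def simp del: even_diff_nat)
  qed
  have z': "hyp_ext M A i (Suc ?K) = 0" if "i < ?K" for i
    using that by (auto simp: hyp_ext_def)
  have "(\<Sum>i<Suc (Suc ?K). \<Sum>j<Suc (Suc ?K). hyp_ext M A i j * x i * x j)
      = (\<Sum>i<?K. \<Sum>j<?K. hyp_ext M A i j * x i * x j) + x ?K * x (Suc ?K)"
    by (simp add: z z')
  then show ?case using Suc by simp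
qed

lemma form_rank_sum_split:
  assumes Q: "Q \<in> quadratic_forms" and b: "frame b N UNIV" and N: "N = 2 * n" and s: "M + 2 * s = N"
    and eq: "\<And>x. Q (comb b N x) = (\<Sum>i<s. x (2 * i) * x (2 * i + 1))
      + (\<Sum>i<M. \<Sum>j<M. A i j * x (2 * s + i) * x (2 * s + j))"
  shows "form_rank_sum (\<lambda>r. of_real (weight (real CARD('a)) n k r)) Q =
    of_real (hyp_factor (real CARD('a)) n k s) * rank_sum M (\<lambda>r. of_real (weight (real CARD('a)) (n - s) (k - s) r)) A"
proof -
  define b' where "b' = (\<lambda>i. if i < N - 2 * s then b (2 * s + i) else b (i - (N - 2 * s)))"
  have sN: "2 * s \<le> N" and M: "N - 2 * s = M" using s by auto
  have b': "frame b' N UNIV" and c: "comb b' N x = comb b N (\<lambda>i. if i < 2 * s then x (N - 2 * s + i) else x (i - 2 * s))" for x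
    unfolding b'_def by (rule frame_rotate[OF b sN])+
  have "represents b' (M + 2 * s) (hyp_ext M A) Q"
    unfolding represents_def sum_hyp_ext
  proof
    fix x :: "nat \<Rightarrow> 'a"
    have "Q (comb b' N x) = (\<Sum>i<s. x (M + 2 * i) * x (M + (2 * i + 1))) + (\<Sum>i<M. \<Sum>j<M. A i j * x i * x j)"
      unfolding c eq M by (intro arg_cong2[of _ _ _ _ "(+)"] sum.cong refl) auto
    then show "Q (comb b' (M + 2 * s) x)
        = (\<Sum>i<M. \<Sum>j<M. A i j * x i * x j) + (\<Sum>i<s. x (M + 2 * i) * x (M + 2 * i + 1))"
      unfolding s by (simp add: add.assoc)
  qed
  then have "form_rank_sum (\<lambda>r. of_real (weight (real CARD('a)) n k r)) Q
      = rank_sum (M + 2 * s) (\<lambda>r. of_real (weight (real CARD('a)) n k r)) (hyp_ext M A)"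
    using form_rank_sum_eq[OF Q b'] s by simp
  then show ?thesis using rank_sum_hyp_ext[of M s n k A] s N by simp
qed

end

section \<open>Anisotropic binary forms\<close>

lemma card_squares:
  assumes "(2 :: 'a::{field,finite}) \<noteq> 0"
  shows "CARD('a) = 2 * card ((\<lambda>t :: 'a. t ^ 2) ` (UNIV - {0})) + 1"
proof -
  have fib: "card {t \<in> UNIV - {0}. t ^ 2 = y} = 2" if "y \<in> (\<lambda>t :: 'a. t ^ 2) ` (UNIV - {0})" for y
  proof -
    from that obtain t where "y = t ^ 2" "t \<in> UNIV - {0}" by (rule imageE)
    then have t: "t \<noteq> 0" "y = t ^ 2" by auto
    have "t \<noteq> - t"
    proof
      assume "t = - t"
      then have "t + t = 0" unfolding eq_neg_iff_add_eq_0 .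
      then have "2 * t = 0" unfolding mult_2 .
      then show False using assms t by simp
    qed
    moreover have "{t \<in> UNIV - {0}. t ^ 2 = y} = {t, - t}"
      using t by (auto simp: power2_eq_iff)
    ultimately show ?thesis by simp
  qed
  have "card (UNIV - {0 :: 'a}) = card ((\<lambda>t :: 'a. t ^ 2) ` (UNIV - {0})) * 2"
    using card_fibres[of "UNIV - {0 :: 'a}" "\<lambda>t. t ^ 2", OF _ fib] by simp
  moreover have "card (UNIV - {0 :: 'a}) = CARD('a) - 1" by (simp add: card_Diff_singleton)
  ultimately show ?thesis using card_field_gt_1[where 'a = 'a] by simp
qed

text \<open>The field is a vector space over the two-element field, and \<open>frame_card\<close>
  counts it.\<close>

lemma card_char2_power:
  assumes "(1 :: 'a::{field,finite}) + 1 = 0"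
  shows "\<exists>n. CARD('a) = 2 ^ n"
proof -
  have dbl: "x + x = 0" for x :: 'a
    using assms by (metis mult_2 mult_zero_left one_add_one)
  have gf2: "c = 0 \<or> c = 1" for c :: gf2 by transfer auto
  have two: "(1 :: gf2) + 1 = 0" by transfer simp
  interpret F: finite_field_space "\<lambda>(c :: gf2) (x :: 'a). if c = 0 then 0 else x"
  proof
    show "(if a + b = 0 then 0 else x) = (if a = 0 then 0 else x) + (if b = 0 then 0 else x)"
      for a b :: gf2 and x :: 'a
      using gf2[of a] gf2[of b] by (auto simp: two[unfolded one_add_one] dbl)
  qed auto
  obtain b where "F.frame b (F.dim UNIV) UNIV" by (rule F.subspace_frame[OF F.subspace_UNIV]) simp
  from F.frame_card[OF this] have "CARD('a) = CARD(gf2) ^ F.dim UNIV" .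
  moreover have "UNIV = {0, 1 :: gf2}" using gf2 by auto
  then have "CARD(gf2) = 2" using card_2_iff zero_neq_one by metis
  ultimately show ?thesis by metis
qed

text \<open>The definitions branch on the parity of \<open>CARD('a)\<close>, the computations on
  \<open>1 + 1 = 0\<close>. If 2 is nonzero, squaring is two-to-one on nonzero elements, which makes
  \<open>CARD('a)\<close> odd.\<close>

lemma even_card_iff_char2: "even CARD('a::{field,finite}) \<longleftrightarrow> (1 :: 'a) + 1 = 0"
proof
  show "(1 :: 'a) + 1 = 0" if "even CARD('a)"
  proof (rule ccontr)
    assume "(1 :: 'a) + 1 \<noteq> 0"
    then have "CARD('a) = 2 * card ((\<lambda>t :: 'a. t ^ 2) ` (UNIV - {0})) + 1" by (intro card_squares) simp
    then show False using that by presburger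
  qed
next
  assume "(1 :: 'a) + 1 = 0"
  then obtain n where n: "CARD('a) = 2 ^ n" using card_char2_power by blast
  then have "n \<noteq> 0" using card_field_gt_1[where 'a = 'a] by (intro notI) simp
  then show "even CARD('a)" using n by simp
qed

lemma power_card_eq: "(t :: 'a::{field,finite}) ^ CARD('a) = t"
proof (cases "t = 0")
  case False
  have "bij_betw (\<lambda>x. t * x) (UNIV - {0}) (UNIV - {0})"
    by (rule bij_betwI[where g = "\<lambda>x. x / t"]) (use False in auto)
  then have "(\<Prod>x\<in>UNIV - {0}. x) = (\<Prod>x\<in>UNIV - {0}. t * x)"
    by (rule prod.reindex_bij_betw[symmetric])
  also have "\<dots> = t ^ (CARD('a) - 1) * (\<Prod>x\<in>UNIV - {0}. x)"
    by (simp add: prod.distrib card_Diff_singleton)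
  finally have "t ^ (CARD('a) - 1) = 1" by simp
  then have "t * t ^ (CARD('a) - 1) = t" by simp
  moreover have "CARD('a) = Suc (CARD('a) - 1)" using card_field_gt_1[where 'a = 'a] by simp
  ultimately show ?thesis by (metis power_Suc)
qed (use card_field_gt_1[where 'a = 'a] in auto)

lemma char2_double: "even CARD('a) \<Longrightarrow> (x :: 'a::{field,finite}) + x = 0"
  using even_card_iff_char2[where 'a = 'a] by (metis mult_2 mult_zero_left one_add_one)

text \<open>The root is \<open>x ^ (CARD('a) div 2)\<close>, by
  \<open>power_card_eq\<close>.\<close>

lemma sqrt_char2:
  fixes x :: "'a::{field,finite}"
  assumes "even CARD('a)"
  shows "\<exists>s. s ^ 2 = x"
proof -
  have "(1 :: 'a) + 1 = 0" using assms even_card_iff_char2 by blast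
  then obtain n where n: "CARD('a) = 2 ^ n" using card_char2_power by blast
  then have "n \<noteq> 0" using card_field_gt_1[where 'a = 'a] by (intro notI) simp
  then obtain k where "CARD('a) = 2 ^ k * 2" using n by (cases n) auto
  then have "(x ^ 2 ^ k) ^ 2 = x" using power_card_eq[of x] by (simp flip: power_mult)
  then show ?thesis by blast
qed

text \<open>Powers of the Frobenius map are additive, so the trace sum telescopes to
  \<open>t ^ CARD('a) + t = t + t = 0\<close>.\<close>

lemma artin_schreier_trace:
  fixes t :: "'a::{field,finite}"
  assumes "even CARD('a)"
  shows "absolute_trace (t ^ 2 + t) = 0"
proof -
  have two: "(1 :: 'a) + 1 = 0" using assms even_card_iff_char2 by blast
  note dbl = char2_double[OF assms]
  have "of_nat 2 = (0 :: 'a)" using two by simp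
  then have dvd: "CHAR('a) dvd 2" unfolding of_nat_eq_0_iff_char_dvd .
  then have "CHAR('a) \<le> 2" by (intro dvd_imp_le) auto
  moreover have "CHAR('a) \<noteq> 0" using dvd by (intro notI) simp
  ultimately have char: "CHAR('a) = 2" using CHAR_not_1'[where 'a = 'a] by linarith
  obtain n where n: "CARD('a) = 2 ^ n" using card_char2_power[OF two] by blast
  have the: "(THE n. CARD('a) = CHAR('a) ^ n) = n" using n char by (intro the_equality) auto
  have frob: "(x + y) ^ 2 ^ i = x ^ 2 ^ i + y ^ 2 ^ i" for x y :: 'a and i
    using freshmans_dream'[of "2 ^ i" i x y] char by simp
  have "(\<Sum>i<k. (t ^ 2 + t) ^ 2 ^ i) = t ^ 2 ^ k + t" for k
  proof (induction k)
    case 0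
    then show ?case by (simp add: dbl)
  next
    case (Suc k)
    have "(t ^ 2) ^ 2 ^ k = t ^ 2 ^ Suc k" by (simp flip: power_mult)
    then have "(\<Sum>i<Suc k. (t ^ 2 + t) ^ 2 ^ i) = t ^ 2 ^ Suc k + t + (t ^ 2 ^ k + t ^ 2 ^ k)"
      using Suc by (simp add: frob algebra_simps)
    then show ?case by (simp add: dbl)
  qed
  from this[of n] show ?thesis
    unfolding absolute_trace_def the char using power_card_eq[of t] n dbl[of t] by simp
qed

text \<open>The nonzero squares and their multiples by \<open>eta\<close> are disjoint sets of equal
  size that together exhaust the nonzero elements.\<close>

lemma nonsquare_ratio:
  fixes x eta :: "'a::{field,finite}"
  assumes odd: "odd CARD('a)" and x: "\<nexists>t. x = t ^ 2" and eta: "\<nexists>t. eta = t ^ 2"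
  shows "\<exists>e. e \<noteq> 0 \<and> x = eta * e ^ 2"
proof -
  let ?S = "(\<lambda>t :: 'a. t ^ 2) ` (UNIV - {0})"
  have two: "(2 :: 'a) \<noteq> 0" using odd even_card_iff_char2[where 'a = 'a] by simp
  have ns: "y \<noteq> 0" if "\<nexists>t. y = t ^ 2" for y :: 'a
    using that[simplified not_ex, rule_format, of 0] by simp
  have eta0: "eta \<noteq> 0" and x0: "x \<noteq> 0" using ns eta x by auto
  have inj: "inj_on ((*) eta) ?S" using eta0 by (auto simp: inj_on_def)
  have disj: "?S \<inter> (*) eta ` ?S = {}"
  proof (rule ccontr)
    assume "?S \<inter> (*) eta ` ?S \<noteq> {}"
    then obtain s t where st: "t \<noteq> 0" "s ^ 2 = eta * t ^ 2" by auto
    then have "eta = (s / t) ^ 2" by (simp add: power_divide)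
    then show False using eta by blast
  qed
  have "card (?S \<union> (*) eta ` ?S) = 2 * card ?S"
    using disj inj by (subst card_Un_disjoint) (auto simp: card_image)
  then have "card (?S \<union> (*) eta ` ?S) = card (UNIV - {0 :: 'a})"
    using card_squares[OF two] by (simp add: card_Diff_singleton)
  moreover have "?S \<union> (*) eta ` ?S \<subseteq> UNIV - {0}" using eta0 by auto
  ultimately have "?S \<union> (*) eta ` ?S = UNIV - {0}" by (intro card_subset_eq) auto
  then have "x \<in> ?S \<union> (*) eta ` ?S" using x0 by simp
  moreover have "x \<notin> ?S" using x by blast
  ultimately obtain t where "t \<noteq> 0" "x = eta * t ^ 2" by blast
  then show ?thesis by blast
qed

text \<open>The map \<open>t \<mapsto> t ^ 2 + t\<close> is additive with fibres
  \<open>{t, t + 1}\<close>, so its image has index 2. Elements outside it lie in one coset, and in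
  characteristic 2 their difference is \<open>x + y\<close>.\<close>

lemma artin_schreier_diff:
  fixes x y :: "'a::{field,finite}"
  assumes even: "even CARD('a)" and x: "\<nexists>t. x = t ^ 2 + t" and y: "\<nexists>t. y = t ^ 2 + t"
  shows "\<exists>t. x + y = t ^ 2 + t"
proof -
  note dbl = char2_double[OF even]
  have neg: "- z = z" for z :: 'a using dbl[of z] by (simp add: minus_unique)
  have eq0: "z + z' = 0 \<longleftrightarrow> z = z'" for z z' :: 'a
    unfolding add_eq_0_iff neg by (rule eq_commute)
  let ?f = "\<lambda>t :: 'a. t ^ 2 + t"
  have add: "?f (s + t) = ?f s + ?f t" for s t
    using dbl[of "s * t"] by (simp add: power2_eq_square algebra_simps)
  have fib: "card {t \<in> UNIV. ?f t = z} = 2" if "z \<in> range ?f" for z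
  proof -
    from that obtain t where t: "z = ?f t" by (rule imageE)
    have "{s \<in> UNIV. ?f s = z} = {t, t + 1}"
    proof -
      have "?f s = ?f t \<longleftrightarrow> s = t \<or> s = t + 1" for s
      proof -
        have "?f s = ?f t \<longleftrightarrow> ?f (s + t) = 0"
          unfolding add eq0 ..
        also have "\<dots> \<longleftrightarrow> (s + t) * (s + t + 1) = 0" by (simp add: power2_eq_square algebra_simps)
        also have "\<dots> \<longleftrightarrow> s + t = 0 \<or> s + t + 1 = 0" by simp
        also have "\<dots> \<longleftrightarrow> s = t \<or> s = t + 1" unfolding add.assoc eq0 ..
        finally show ?thesis .
      qed
      then show ?thesis unfolding t by auto
    qed
    then show ?thesis by simp
  qed
  have half: "CARD('a) = card (range ?f) * 2"
    using card_fibres[of "UNIV :: 'a set" ?f, OF _ fib] by simp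
  have disj: "range ?f \<inter> (+) y ` range ?f = {}"
  proof (rule ccontr)
    assume "range ?f \<inter> (+) y ` range ?f \<noteq> {}"
    then obtain s t where "?f s = y + ?f t" by auto
    then have "?f s + (y + ?f t) = 0" unfolding eq0 .
    then have "y + (?f s + ?f t) = 0" by (simp only: add_ac)
    then have "y = ?f (s + t)" unfolding eq0 add .
    then show False using y by blast
  qed
  have "card (range ?f \<union> (+) y ` range ?f) = CARD('a)"
    using disj half by (subst card_Un_disjoint) (auto simp: card_image)
  then have "range ?f \<union> (+) y ` range ?f = UNIV" by (intro card_subset_eq) auto
  then have "x \<in> (+) y ` range ?f" using x by auto
  then obtain t where "x = y + ?f t" by auto
  then have "x + y = ?f t + (y + y)" by (simp only: add_ac)
  then show ?thesis unfolding dbl add_0_right by (rule exI)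
qed

definition plane_form :: "'a::{field,finite} \<Rightarrow> 'a \<Rightarrow> 'a \<Rightarrow> 'a \<Rightarrow> 'a" where
  "plane_form lam eta y z = (if even CARD('a) then y ^ 2 + y * z + lam * z ^ 2 else y ^ 2 - eta * z ^ 2)"

text \<open>A zero with \<open>z \<noteq> 0\<close> would make \<open>lam\<close> equal to
  \<open>(y / z) ^ 2 + y / z\<close>, of trace 0, or \<open>eta\<close> equal to a square.\<close>

lemma plane_form_anisotropic:
  fixes lam eta :: "'a::{field,finite}"
  assumes lam: "even CARD('a) \<Longrightarrow> absolute_trace lam = 1" and eta: "odd CARD('a) \<Longrightarrow> \<nexists>x. eta = x ^ 2"
    and 0: "plane_form lam eta y z = 0"
  shows "y = 0 \<and> z = 0"
proof (cases "z = 0")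
  case True
  then show ?thesis using 0 by (auto simp: plane_form_def split: if_splits)
next
  case False
  show ?thesis
  proof (cases "even CARD('a)")
    case True
    have "y ^ 2 + y * z + lam * z ^ 2 = 0" using 0 True by (simp add: plane_form_def)
    then have "lam * z ^ 2 = - (y ^ 2 + y * z)" by (metis add.commute eq_neg_iff_add_eq_0)
    moreover have "- x = x" for x :: 'a by (rule minus_unique[OF char2_double[OF True]])
    ultimately have "lam * z ^ 2 = y ^ 2 + y * z" by simp
    then have "lam = (y / z) ^ 2 + y / z" using False by (simp add: field_simps power2_eq_square)
    then show ?thesis using artin_schreier_trace[OF True, of "y / z"] lam[OF True] by simp
  next
    case odd: False
    then have "y ^ 2 = eta * z ^ 2" using 0 by (simp add: plane_form_def)
    then have "eta = (y / z) ^ 2" using False by (simp add: power_divide)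
    then show ?thesis using eta[OF odd] by blast
  qed
qed

text \<open>For odd order complete the square; for even order \<open>B \<noteq> 0\<close>, and the Artin-Schreier classes of
  \<open>lam\<close> and \<open>A * C / B ^ 2\<close> are both nontrivial, hence equal.\<close>

lemma anisotropic_binary_form:
  fixes lam eta A B C :: "'a::{field,finite}"
  assumes lam: "even CARD('a) \<Longrightarrow> absolute_trace lam = 1" and eta: "odd CARD('a) \<Longrightarrow> \<nexists>x. eta = x ^ 2"
    and an: "\<And>y z. A * y ^ 2 + B * y * z + C * z ^ 2 = 0 \<Longrightarrow> y = 0 \<and> z = 0"
  shows "\<exists>a g h. a \<noteq> 0 \<and> (\<forall>y z. A * (y + h * z) ^ 2 + B * (y + h * z) * (g * z) + C * (g * z) ^ 2
      = a * plane_form lam eta y z)"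
proof -
  have A: "A \<noteq> 0" using an[of 1 0] by auto
  show ?thesis
  proof (cases "even CARD('a)")
    case True
    have two: "(1 :: 'a) + 1 = 0" using True even_card_iff_char2 by blast
    note dbl = char2_double[OF True]
    have B: "B \<noteq> 0"
    proof
      assume "B = 0"
      \<comment> \<open>With \<open>B = 0\<close>, square roots of \<open>C\<close> and
        \<open>A\<close> are a zero of the form, with value
        \<open>A * C + C * A = 0\<close>.\<close>
      obtain s t where st: "s ^ 2 = C" "t ^ 2 = A" using sqrt_char2[OF True] by metis
      have "A * s ^ 2 + B * s * t + C * t ^ 2 = 0"
        using \<open>B = 0\<close> st dbl[of "A * C"] by (simp add: mult.commute)
      then have "t = 0" using an by blast
      then show False using st A by simp
    qed
    define mu where "mu = A * C / B ^ 2"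
    have mu: "\<nexists>t. mu = t ^ 2 + t"
    proof
      assume "\<exists>t. mu = t ^ 2 + t"
      then obtain t where t: "mu = t ^ 2 + t" by blast
      have C: "C = mu * B ^ 2 / A" using A B by (simp add: mu_def)
      \<comment> \<open>The zero of the form that a solution of \<open>mu = t ^ 2 + t\<close> would
        provide.\<close>
      have "A * (t * B / A) ^ 2 + B * (t * B / A) * 1 + C * 1 ^ 2 = (B ^ 2 / A) * (t ^ 2 + t + mu)"
        unfolding C using A by (simp add: field_simps power2_eq_square)
      also have "\<dots> = 0" using t dbl[of "t ^ 2 + t"] by simp
      finally show False using an[of "t * B / A" 1] by simp
    qed
    have "\<nexists>t. lam = t ^ 2 + t" using artin_schreier_trace[OF True] lam[OF True] by fastforce
    from artin_schreier_diff[OF True this mu] obtain h where h: "lam + mu = h ^ 2 + h" by blast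
    \<comment> \<open>This scaling of \<open>z\<close> turns the cross coefficient into
      \<open>A\<close> and the last one into \<open>A * mu\<close>; the shift by \<open>h\<close>
      then replaces \<open>mu\<close> by \<open>h ^ 2 + h + mu = lam\<close>.\<close>
    define g where "g = A / B"
    have Bg: "B * g = A" using B by (simp add: g_def)
    have Cg: "C * g ^ 2 = A * mu" using A B by (simp add: g_def mu_def power2_eq_square field_simps)
    have "A * (y + h * z) ^ 2 + B * (y + h * z) * (g * z) + C * (g * z) ^ 2 = A * plane_form lam eta y z" for y z
    proof -
      have "A * (y + h * z) ^ 2 + B * (y + h * z) * (g * z) + C * (g * z) ^ 2
          = A * (y + h * z) ^ 2 + (B * g) * (y + h * z) * z + (C * g ^ 2) * z ^ 2"
        by (simp add: power2_eq_square algebra_simps)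
      also have "\<dots> = A * (y ^ 2 + y * z + (h ^ 2 + h + mu) * z ^ 2) + A * h * y * z * (1 + 1)"
        unfolding Bg Cg by (simp add: power2_eq_square algebra_simps)
      also have "h ^ 2 + h + mu = lam" by (simp only: h[symmetric] add.assoc dbl add_0_right)
      finally show ?thesis using True two by (simp add: plane_form_def)
    qed
    then show ?thesis using A by blast
  next
    case odd: False
    have two: "(2 :: 'a) \<noteq> 0" using odd even_card_iff_char2[where 'a = 'a] by simp
    have four: "(4 :: 'a) \<noteq> 0"
    proof -
      have "(4 :: 'a) = 2 * 2" by simp
      then show ?thesis using two by (metis mult_eq_0_iff)
    qed
    define D where "D = C - B ^ 2 / (4 * A)"
    define t where "t = B / (2 * A)"
    have Bt: "B = 2 * A * t" using A two by (simp add: t_def)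
    have Ct: "C = D + A * t ^ 2" using A two four by (simp add: D_def t_def power2_eq_square field_simps)
    have complete: "A * (y - t * z) ^ 2 + B * (y - t * z) * z + C * z ^ 2 = A * y ^ 2 + D * z ^ 2" for y z
      unfolding Bt Ct by (simp add: power2_eq_square algebra_simps)
    have "\<nexists>s. - D / A = s ^ 2"
    proof
      assume "\<exists>s. - D / A = s ^ 2"
      then obtain s where "- D / A = s ^ 2" by blast
      then have "A * s ^ 2 = - D" using A by (simp add: field_simps)
      then have "A * s ^ 2 + D * 1 ^ 2 = 0" by simp
      then show False using complete[of s 1] an[of "s - t" 1] by simp
    qed
    \<comment> \<open>Scaling \<open>z\<close> by \<open>1 / e\<close> normalises the nonsquare
      \<open>- D / A\<close> to \<open>eta\<close>.\<close>
    from nonsquare_ratio[OF odd this eta[OF odd]] obtain e where e: "e \<noteq> 0" "- D / A = eta * e ^ 2" by blast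
    have De: "D * (1 / e) ^ 2 = - (A * eta)"
    proof -
      have "- D = A * (eta * e ^ 2)" using e(2) A by (simp add: field_simps)
      then have "D = - (A * (eta * e ^ 2))" by (metis minus_minus)
      then show ?thesis using e(1) by (simp add: power_divide)
    qed
    have "A * (y + - t * (1 / e) * z) ^ 2 + B * (y + - t * (1 / e) * z) * (1 / e * z)
        + C * (1 / e * z) ^ 2 = A * plane_form lam eta y z" for y z
    proof -
      have "A * (y + - t * (1 / e) * z) ^ 2 + B * (y + - t * (1 / e) * z) * (1 / e * z)
        + C * (1 / e * z) ^ 2 = A * y ^ 2 + D * (1 / e * z) ^ 2"
        using complete[of y "1 / e * z"] by (simp add: algebra_simps)
      also have "\<dots> = A * y ^ 2 + (D * (1 / e) ^ 2) * z ^ 2" by (simp add: power_divide)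
      finally show ?thesis unfolding De using odd by (simp add: plane_form_def algebra_simps)
    qed
    then show ?thesis using A by blast
  qed
qed

section \<open>Normal forms of quadratic forms\<close>

definition partner :: "nat \<Rightarrow> nat" where
  "partner i = (if even i then Suc i else i - 1)"

lemma partner_less: "i < 2 * s \<Longrightarrow> partner i < 2 * s"
  unfolding partner_def by (auto elim!: evenE)

lemma partner_partner [simp]: "partner (partner i) = i"
  unfolding partner_def by auto

section \<open>Hyperbolic pairs and their orthogonal complements\<close>

context form_space
begin

text \<open>\<open>p (2 * i)\<close> and \<open>p (2 * i + 1)\<close> form a hyperbolic pair; since
  \<open>partner i \<noteq> i\<close>, the condition includes
  \<open>S (p i) (p i) = 0\<close>.\<close>

definition hyp_pairs :: "('v \<Rightarrow> 'v \<Rightarrow> 'a) \<Rightarrow> nat \<Rightarrow> (nat \<Rightarrow> 'v) \<Rightarrow> bool" where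
  "hyp_pairs S s p \<longleftrightarrow> (\<forall>i<2 * s. \<forall>j<2 * s. S (p i) (p j) = (if j = partner i then 1 else 0))"

definition perp_space :: "('v \<Rightarrow> 'v \<Rightarrow> 'a) \<Rightarrow> nat \<Rightarrow> (nat \<Rightarrow> 'v) \<Rightarrow> 'v set" where
  "perp_space S s p = {v. \<forall>i<2 * s. S (p i) v = 0}"

definition glue :: "nat \<Rightarrow> (nat \<Rightarrow> 'v) \<Rightarrow> (nat \<Rightarrow> 'v) \<Rightarrow> nat \<Rightarrow> 'v" where
  "glue l p c i = (if i < l then p i else c (i - l))"

lemma comb_glue: "comb (glue l p c) (l + k) x = comb p l x + comb c k (\<lambda>i. x (l + i))"
  unfolding comb_append by (intro arg_cong2[of _ _ _ _ "(+)"] comb_cong) (auto simp: glue_def)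

context
  fixes S assumes S: "S \<in> symmetric_bilinear_forms"
begin

lemma perp_space_subspace: "subspace (perp_space S s p)"
  by (auto simp: subspace_def perp_space_def symmetric_bilinearD(2,3,8)[OF S])

lemma hyp_pairs_coeff:
  assumes p: "hyp_pairs S s p" and i: "i < 2 * s"
  shows "S (p (partner i)) (comb p (2 * s) x) = x i"
proof -
  have "S (p (partner i)) (comb p (2 * s) x) = (\<Sum>j<2 * s. x j * (if j = i then 1 else 0))"
    unfolding comb_def symmetric_bilinearD(10)[OF S]
    using p partner_less[OF i] by (intro sum.cong refl) (simp add: symmetric_bilinearD(3)[OF S] hyp_pairs_def)
  then show ?thesis using sum_times_unit[OF i] by simp
qed

lemma perp_space_proj:
  assumes p: "hyp_pairs S s p"
  shows "v - comb p (2 * s) (\<lambda>i. S (p (partner i)) v) \<in> perp_space S s p"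
  unfolding perp_space_def
proof (clarify)
  fix i assume i: "i < 2 * s"
  have "S (p i) (comb p (2 * s) (\<lambda>i. S (p (partner i)) v)) = S (p i) v"
    using hyp_pairs_coeff[OF p partner_less[OF i]] by simp
  then show "S (p i) (v - comb p (2 * s) (\<lambda>i. S (p (partner i)) v)) = 0"
    by (simp add: symmetric_bilinearD(6)[OF S])
qed

lemma comb_perp_space:
  assumes "z \<in> perp_space S s p"
  shows "S (comb p (2 * s) x) z = 0"
  using assms unfolding comb_def symmetric_bilinearD(11)[OF S]
  by (simp add: symmetric_bilinearD(5)[OF S] perp_space_def)

text \<open>Pairing with the partners recovers the first \<open>2 * s\<close> coordinates, so the
  span of \<open>p\<close> meets its complement only in 0; by \<open>perp_space_proj\<close> the two
  together span.\<close>

lemma hyp_pairs_frame: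
  assumes p: "hyp_pairs S s p" and c: "frame c k (perp_space S s p)"
  shows "frame (glue (2 * s) p c) N UNIV" "2 * s + k = N"
proof -
  have "frame (glue (2 * s) p c) (2 * s + k) UNIV"
    unfolding frame_def bij_betw_def
  proof
    show "inj_on (comb (glue (2 * s) p c) (2 * s + k)) (vecs (2 * s + k))"
      unfolding inj_comb_iff
    proof (intro ballI impI ext)
      fix x i assume x: "x \<in> vecs (2 * s + k)" "comb (glue (2 * s) p c) (2 * s + k) x = 0"
      have w: "comb c k (\<lambda>i. x (2 * s + i)) \<in> perp_space S s p"
        using c comb_span[of c k] by (simp add: frame_iff)
      have z: "x i = 0" if i: "i < 2 * s" for i
      proof -
        have "0 = S (p (partner i)) (comb p (2 * s) x + comb c k (\<lambda>i. x (2 * s + i)))"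
          using x(2) symmetric_bilinearD(8)[OF S] by (simp add: comb_glue)
        also have "\<dots> = x i"
          using w partner_less[OF i] hyp_pairs_coeff[OF p i]
          by (simp add: symmetric_bilinearD(2)[OF S] perp_space_def)
        finally show ?thesis by simp
      qed
      then have "comb p (2 * s) x = 0" by (simp add: comb_def)
      then have "comb c k (\<lambda>i. x (2 * s + i)) = 0" using x(2) by (simp add: comb_glue)
      moreover have "(\<lambda>i. x (2 * s + i)) \<in> vecs k" using x(1) by (simp add: vecs_def)
      ultimately have "(\<lambda>i. x (2 * s + i)) = (\<lambda>i. 0)"
        using c unfolding frame_def bij_betw_def inj_comb_iff by blast
      from fun_cong[OF this] have "x (2 * s + j) = 0" for j .
      then show "x i = 0" using z by (cases "i < 2 * s") (auto, metis le_add_diff_inverse not_less)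
    qed
    have "v \<in> comb (glue (2 * s) p c) (2 * s + k) ` vecs (2 * s + k)" for v
    proof -
      obtain y where y: "y \<in> vecs k" "v - comb p (2 * s) (\<lambda>i. S (p (partner i)) v) = comb c k y"
        by (rule frame_exE[OF c perp_space_proj[OF p, of v]])
      define x where "x i = (if i < 2 * s then S (p (partner i)) v else y (i - 2 * s))" for i
      have "comb (glue (2 * s) p c) (2 * s + k) x = comb p (2 * s) (\<lambda>i. S (p (partner i)) v) + comb c k y"
        unfolding comb_glue by (intro arg_cong2[of _ _ _ _ "(+)"] comb_cong) (auto simp: x_def)
      also have "\<dots> = v" using y(2) by (simp add: algebra_simps)
      finally have "v = comb (glue (2 * s) p c) (2 * s + k) x" ..
      moreover have "x \<in> vecs (2 * s + k)" using y(1) by (auto simp: vecs_def x_def)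
      ultimately show ?thesis by (rule image_eqI)
    qed
    then show "comb (glue (2 * s) p c) (2 * s + k) ` vecs (2 * s + k) = UNIV" by blast
  qed
  moreover from frame_dim[OF this] show "2 * s + k = N" by simp
  ultimately show "frame (glue (2 * s) p c) N UNIV" by simp
qed

lemma hyp_pairs_extend:
  assumes p: "hyp_pairs S s p" and xy: "x \<in> perp_space S s p" "y \<in> perp_space S s p"
    and "S x x = 0" "S y y = 0" "S x y = 1"
  shows "hyp_pairs S (Suc s) (p(2 * s := x, Suc (2 * s) := y))"
  unfolding hyp_pairs_def
proof (intro allI impI)
  fix i j assume ij: "i < 2 * Suc s" "j < 2 * Suc s"
  have perp: "S (p l) x = 0" "S (p l) y = 0" "S x (p l) = 0" "S y (p l) = 0" if "l < 2 * s" for l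
    using xy that symmetric_bilinearD(1)[OF S] by (auto simp: perp_space_def)
  have yx: "S y x = 1" using assms symmetric_bilinearD(1)[OF S, of y x] by simp
  have pl: "partner l < 2 * s" if "l < 2 * s" for l using partner_less that by blast
  have ps: "partner (2 * s) = Suc (2 * s)" "partner (Suc (2 * s)) = 2 * s" by (auto simp: partner_def)
  have trichotomy: "l < 2 * s \<or> l = 2 * s \<or> l = Suc (2 * s)" if "l < 2 * Suc s" for l
    using that by auto
  consider "i < 2 * s" | "i = 2 * s" | "i = Suc (2 * s)" using trichotomy[OF ij(1)] by blast
  then show "S ((p(2 * s := x, Suc (2 * s) := y)) i) ((p(2 * s := x, Suc (2 * s) := y)) j)
      = (if j = partner i then 1 else 0)"
  proof cases
    case 1
    consider "j < 2 * s" | "j = 2 * s" | "j = Suc (2 * s)" using trichotomy[OF ij(2)] by blast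
    then show ?thesis
    proof cases
      case 1
      then show ?thesis using p \<open>i < 2 * s\<close> by (simp add: hyp_pairs_def)
    qed (use 1 perp pl[OF 1] in auto)
  next
    case 2
    then show ?thesis using ij assms perp ps by (cases "j < 2 * s") (auto simp: less_Suc_eq)
  next
    case 3
    then show ?thesis using ij assms perp ps yx by (cases "j < 2 * s") (auto simp: less_Suc_eq)
  qed
qed

text \<open>A greatest \<open>s\<close> exists because \<open>hyp_pairs_frame\<close> bounds it by
  the dimension. The predicate \<open>P\<close> selects the admissible vectors: zeros of
  \<open>Q\<close> for a quadratic form, all vectors for a symmetric one.\<close>

lemma maximal_hyp_pairs:
  shows "\<exists>s p. hyp_pairs S s p \<and> (\<forall>i<2 * s. P (p i)) \<and>
    (\<forall>x\<in>perp_space S s p. \<forall>y\<in>perp_space S s p. P x \<longrightarrow> P y \<longrightarrow> S x x = 0 \<longrightarrow> S y y = 0 \<longrightarrow> S x y \<noteq> 1)"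
proof -
  define G where "G s \<longleftrightarrow> (\<exists>p. hyp_pairs S s p \<and> (\<forall>i<2 * s. P (p i)))" for s
  have "G 0" by (simp add: G_def hyp_pairs_def)
  moreover have bound: "s \<le> N" if "G s" for s
  proof -
    obtain p where p: "hyp_pairs S s p" using \<open>G s\<close> unfolding G_def by blast
    obtain c where "frame c (dim (perp_space S s p)) (perp_space S s p)"
      by (rule subspace_frame[OF perp_space_subspace finite_V])
    from hyp_pairs_frame(2)[OF p this] show ?thesis by simp
  qed
  ultimately have "G (GREATEST s. G s)" "\<And>s. G s \<Longrightarrow> s \<le> (GREATEST s. G s)"
    using GreatestI_nat[of G 0 N] Greatest_le_nat[of G _ N] by auto
  then obtain s where "G s" and max: "\<And>l. G l \<Longrightarrow> l \<le> s" by blast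
  then obtain p where p: "hyp_pairs S s p" "\<forall>i<2 * s. P (p i)"
    unfolding G_def by blast
  show ?thesis
  proof (intro exI[of _ s] exI[of _ p] conjI ballI impI p)
    fix x y assume xy: "x \<in> perp_space S s p" "y \<in> perp_space S s p"
      "P x" "P y" "S x x = 0" "S y y = 0"
    show "S x y \<noteq> 1"
    proof
      assume "S x y = 1"
      note ext = hyp_pairs_extend[OF p(1) xy(1,2,5,6) this]
      have "G (Suc s)"
        unfolding G_def
      proof (intro exI conjI)
        show "hyp_pairs S (Suc s) (p(2 * s := x, Suc (2 * s) := y))" by (rule ext)
        show "\<forall>i<2 * Suc s. P ((p(2 * s := x, Suc (2 * s) := y)) i)"
          using p(2) xy(3,4) by auto
      qed
      then show False using max[of "Suc s"] by simp
    qed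
  qed
qed

lemma hyp_pairs_bilinear:
  assumes p: "hyp_pairs S s p" and vz: "v \<in> perp_space S s p" "z \<in> perp_space S s p"
  shows "S (comb p (2 * s) x + v) (comb p (2 * s) y + z)
    = (\<Sum>i<s. x (2 * i) * y (2 * i + 1) + x (2 * i + 1) * y (2 * i)) + S v z"
proof -
  have 1: "S (comb p (2 * s) x) z = 0" "S v (comb p (2 * s) y) = 0"
    using comb_perp_space[OF vz(2), of x] comb_perp_space[OF vz(1), of y]
      symmetric_bilinearD(1)[OF S, of v] by auto
  have "S (comb p (2 * s) x) (comb p (2 * s) y) = (\<Sum>i<2 * s. x i * y (partner i))"
    unfolding comb_def[of p _ x] symmetric_bilinearD(11)[OF S]
    using hyp_pairs_coeff[OF p partner_less] by (intro sum.cong refl) (simp add: symmetric_bilinearD(5)[OF S])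
  also have "\<dots> = (\<Sum>i<s. x (2 * i) * y (2 * i + 1) + x (2 * i + 1) * y (2 * i))"
    by (induction s) (simp_all add: partner_def algebra_simps)
  finally show ?thesis using 1 by (simp add: symmetric_bilinearD(2,4)[OF S])
qed

end

lemma hyp_pairs_quadratic:
  assumes Q: "Q \<in> quadratic_forms" and p: "hyp_pairs (polar_form Q) s p"
    and z: "\<And>i. i < 2 * s \<Longrightarrow> Q (p i) = 0" and v: "v \<in> perp_space (polar_form Q) s p"
  shows "Q (comb p (2 * s) x + v) = (\<Sum>i<s. x (2 * i) * x (2 * i + 1)) + Q v"
proof -
  note S = quadraticD(2)[OF Q]
  have "Q (comb p (2 * l) x) = (\<Sum>i<l. x (2 * i) * x (2 * i + 1))" if "l \<le> s" for l
    using that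
  proof (induction l)
    case 0
    then show ?case by (simp add: comb_def quadraticD(4)[OF Q])
  next
    case (Suc l)
    have g: "polar_form Q (p i) (p j) = (if j = partner i then 1 else 0)" if "i < 2 * s" "j < 2 * s" for i j
      using p that by (simp add: hyp_pairs_def)
    have "polar_form Q (p i) (p (2 * l)) = 0" "polar_form Q (p i) (p (Suc (2 * l))) = 0" if "i < 2 * l" for i
      using that Suc.prems partner_less[OF that] by (auto simp: g)
    then have 1: "polar_form Q (comb p (2 * l) x) (p (2 * l)) = 0"
      "polar_form Q (comb p (2 * l) x) (p (Suc (2 * l))) = 0"
      unfolding comb_def symmetric_bilinearD(11)[OF S] symmetric_bilinearD(5)[OF S]
      by auto
    have "Q (scale (x (2 * l)) (p (2 * l)) + scale (x (Suc (2 * l))) (p (Suc (2 * l))))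
        = x (2 * l) * x (Suc (2 * l))"
      using Suc.prems
      by (simp add: quadraticD(3)[OF Q, of "scale (x (2 * l)) (p (2 * l))"] quadraticD(1)[OF Q] z
          symmetric_bilinearD(3,5)[OF S] g partner_def)
    moreover have "comb p (2 * Suc l) x = comb p (2 * l) x
        + (scale (x (2 * l)) (p (2 * l)) + scale (x (Suc (2 * l))) (p (Suc (2 * l))))"
      by (simp add: comb_def add.assoc)
    ultimately show ?case using Suc 1
      by (simp add: quadraticD(3)[OF Q, of "comb p (2 * l) x"] symmetric_bilinearD(2,3)[OF S])
  qed
  from this[OF order_refl] show ?thesis
    using comb_perp_space[OF S v, of x] by (simp add: quadraticD(3)[OF Q])
qed

text \<open>The zeros of \<open>Q\<close> on \<open>W\<close> are counted with the sums \<open>G c = \<Sum>x\<in>W. chi (c * Q x)\<close>. For \<open>c \<noteq> 0\<close>, squaring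
  gives \<open>|G c|\<^sup>2 \<le> |W| |rd|\<close>, where the radical \<open>rd\<close> of the polar form on \<open>W\<close> is at most \<open>q\<close> times larger
  than \<open>R\<close>.\<close>

lemma singular_codim_le_2:
  assumes Q: "Q \<in> quadratic_forms" and W: "subspace W"
    and rad: "\<And>x y. x \<in> W \<Longrightarrow> Q x = 0 \<Longrightarrow> y \<in> W \<Longrightarrow> polar_form Q x y = 0"
  defines "R \<equiv> {x \<in> W. Q x = 0}"
  shows "subspace R" "dim W \<le> dim R + 2"
proof -
  let ?q = "real CARD('a)" and ?k = "dim W" and ?l = "dim R"
  note S = quadraticD(2)[OF Q]
  have W0: "0 \<in> W" and Wadd: "\<And>x y. x \<in> W \<Longrightarrow> y \<in> W \<Longrightarrow> x + y \<in> W"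
    and Wsc: "\<And>c x. x \<in> W \<Longrightarrow> scale c x \<in> W" and Wdiff: "\<And>x y. x \<in> W \<Longrightarrow> y \<in> W \<Longrightarrow> x - y \<in> W"
    using W subspace_diff[OF W] by (auto simp: subspace_def)
  show R: "subspace R"
    unfolding subspace_def R_def using W0 Wadd Wsc rad
    by (auto simp: quadraticD(1,3,4)[OF Q])
  define G where "G c = (\<Sum>x\<in>W. chi (c * Q x))" for c
  define rd where "rd = {h \<in> W. \<forall>y\<in>W. polar_form Q y h = 0}"
  \<comment> \<open>\<open>Q\<close> is additive on \<open>rd\<close>, so subtracting a chosen
    element \<open>h (Q x)\<close> of the same value lands in \<open>R\<close>.\<close>
  have rd_card: "card rd \<le> CARD('a) * card R"
  proof -
    define h where "h a = (SOME x. x \<in> rd \<and> Q x = a)" for a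
    have h: "h (Q x) \<in> rd \<and> Q (h (Q x)) = Q x" if "x \<in> rd" for x
      unfolding h_def by (rule someI[of _ x]) (use that in simp)
    have "inj_on (\<lambda>x. (Q x, x - h (Q x))) rd" by (auto simp: inj_on_def)
    moreover have "(\<lambda>x. (Q x, x - h (Q x))) ` rd \<subseteq> UNIV \<times> R"
    proof (rule image_subsetI)
      fix x assume x: "x \<in> rd"
      define y where "y = h (Q x)"
      have y: "y \<in> rd" "Q y = Q x" using h[OF x] by (auto simp: y_def)
      have "Q x = Q (x - y) + Q y + polar_form Q (x - y) y"
        using quadraticD(3)[OF Q, of "x - y" y] by simp
      moreover have "polar_form Q (x - y) y = 0" using x y Wdiff by (simp add: rd_def)
      ultimately have "Q (x - y) = 0" using y by simp
      then show "(Q x, x - h (Q x)) \<in> UNIV \<times> R" using x y Wdiff by (simp add: R_def rd_def flip: y_def)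
    qed
    ultimately have "card rd \<le> card (UNIV \<times> R :: ('a \<times> 'v) set)" by (intro card_inj_on_le) auto
    then show ?thesis by (simp add: card_cartesian_product)
  qed
  have cW: "card W = CARD('a) ^ ?k" and cR: "card R = CARD('a) ^ ?l"
    using card_subspace[OF W] card_subspace[OF R] by auto
  have norm_G: "(norm (G c)) ^ 2 \<le> ?q ^ (?k + ?l + 1)" if c: "c \<noteq> 0" for c
  proof -
    have "of_real ((norm (G c)) ^ 2) = G c * cnj (G c)" by (rule complex_norm_square)
    also have "\<dots> = (\<Sum>y\<in>W. \<Sum>x\<in>W. chi (c * Q x) * chi (- (c * Q y)))"
      unfolding G_def cnj_sum cnj_chi sum_product by (rule sum.swap)
    \<comment> \<open>Substituting \<open>x = y + h\<close> leaves an exponent that is linear in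
      \<open>y\<close>; summing over \<open>y\<close> then selects
      \<open>h \<in> rd\<close>.\<close>
    also have "\<dots> = (\<Sum>y\<in>W. \<Sum>h\<in>W. chi (c * Q h) * chi (c * polar_form Q y h))"
    proof (rule sum.cong[OF refl])
      fix y assume y: "y \<in> W"
      have "bij_betw (\<lambda>h. y + h) W W"
        by (rule bij_betwI[where g = "\<lambda>x. x - y"]) (use y Wadd Wdiff in auto)
      then have "(\<Sum>x\<in>W. chi (c * Q x) * chi (- (c * Q y))) = (\<Sum>h\<in>W. chi (c * Q (y + h)) * chi (- (c * Q y)))"
        by (rule sum.reindex_bij_betw[symmetric])
      also have "\<dots> = (\<Sum>h\<in>W. chi (c * Q h) * chi (c * polar_form Q y h))"
      proof (rule sum.cong[OF refl])
        fix h
        have "c * Q (y + h) + - (c * Q y) = c * Q h + c * polar_form Q y h"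
          unfolding quadraticD(3)[OF Q, of y h] by (simp add: algebra_simps)
        then show "chi (c * Q (y + h)) * chi (- (c * Q y)) = chi (c * Q h) * chi (c * polar_form Q y h)"
          by (simp only: chi_add[symmetric])
      qed
      finally show "(\<Sum>x\<in>W. chi (c * Q x) * chi (- (c * Q y))) = (\<Sum>h\<in>W. chi (c * Q h) * chi (c * polar_form Q y h))" .
    qed
    also have "\<dots> = (\<Sum>h\<in>W. chi (c * Q h) * (\<Sum>y\<in>W. chi (c * polar_form Q y h)))"
      by (subst sum.swap) (simp add: sum_distrib_left)
    also have "\<dots> = (\<Sum>h\<in>W. if h \<in> rd then chi (c * Q h) * of_nat (card W) else 0)"
    proof (rule sum.cong[OF refl])
      fix h assume h: "h \<in> W"
      have "(\<Sum>y\<in>W. chi (c * polar_form Q y h)) = (if h \<in> rd then of_nat (card W) else 0)"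
      proof (cases "h \<in> rd")
        case True
        then show ?thesis by (simp add: rd_def chi_0)
      next
        case False
        then obtain y0 where y0: "y0 \<in> W" "polar_form Q y0 h \<noteq> 0" using h by (auto simp: rd_def)
        then have "c * polar_form Q y0 h \<noteq> 0" using c by simp
        then obtain e where e: "chi (e * (c * polar_form Q y0 h)) \<noteq> 1" by (rule chi_nontrivial_multiple)
        have "(\<Sum>y\<in>W. chi (c * polar_form Q y h)) = 0"
        proof (rule twisted_sum_zero)
          show "inj_on (\<lambda>y. y + scale e y0) W" by (auto simp: inj_on_def)
          show "(\<lambda>y. y + scale e y0) ` W \<subseteq> W" using Wadd Wsc y0 by auto
          show "chi (c * polar_form Q (y + scale e y0) h) = chi (e * (c * polar_form Q y0 h)) * chi (c * polar_form Q y h)" for y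
            by (simp add: symmetric_bilinearD(4,5)[OF S] algebra_simps flip: chi_add)
        qed (use e in auto)
        then show ?thesis using False by simp
      qed
      then show "chi (c * Q h) * (\<Sum>y\<in>W. chi (c * polar_form Q y h)) = (if h \<in> rd then chi (c * Q h) * of_nat (card W) else 0)"
        by simp
    qed
    finally have "(norm (G c)) ^ 2 = norm (\<Sum>h\<in>W. if h \<in> rd then chi (c * Q h) * of_nat (card W) else 0)"
      by (metis abs_of_nonneg norm_of_real zero_le_power2)
    also have "\<dots> \<le> (\<Sum>h\<in>W. norm (if h \<in> rd then chi (c * Q h) * of_nat (card W) else 0))"
      by (rule norm_sum)
    also have "\<dots> = (\<Sum>h\<in>W. if h \<in> rd then real (card W) else 0)"
      by (rule sum.cong[OF refl]) (simp add: norm_mult norm_chi)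
    also have "\<dots> = real (card rd) * real (card W)"
    proof -
      have "W \<inter> {h. h \<in> rd} = rd" by (auto simp: rd_def)
      then show ?thesis by (simp add: sum.If_cases)
    qed
    also have "\<dots> \<le> real (CARD('a) * card R) * real (card W)"
      using rd_card by (intro mult_right_mono) (auto simp del: of_nat_mult)
    also have "\<dots> = ?q ^ (?k + ?l + 1)" by (simp add: cW cR power_add)
    finally show ?thesis .
  qed
  \<comment> \<open>The numbers \<open>G c\<close> sum to \<open>q |R|\<close>. In codimension at
    least 3 the terms with \<open>c \<noteq> 0\<close> would be too small to compensate for
    \<open>G 0 = |W|\<close>.\<close>
  show "?k \<le> ?l + 2"
  proof (rule ccontr)
    assume "\<not> ?k \<le> ?l + 2"
    then have kl: "?l + 3 \<le> ?k" by simp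
    have q1: "1 < ?q" using card_field_gt_1[where 'a = 'a] by simp
    have nG: "norm (G c) \<le> ?q ^ (?k - 1)" if c: "c \<noteq> 0" for c
    proof (rule power2_le_imp_le)
      have "(norm (G c)) ^ 2 \<le> ?q ^ (?k + ?l + 1)" by (rule norm_G[OF c])
      also have "\<dots> \<le> ?q ^ (2 * (?k - 1))" using q1 kl by (intro power_increasing) auto
      finally show "(norm (G c)) ^ 2 \<le> (?q ^ (?k - 1)) ^ 2" by (simp add: mult.commute flip: power_mult)
    qed (use q1 in auto)
    have "(\<Sum>c\<in>UNIV. G c) = (\<Sum>x\<in>W. \<Sum>c\<in>UNIV. chi (c * Q x))"
      unfolding G_def by (rule sum.swap)
    also have "\<dots> = (\<Sum>x\<in>W. if Q x = 0 then of_nat CARD('a) else 0)"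
      by (simp add: sum_chi_mult)
    also have "\<dots> = of_nat (card R * CARD('a))"
    proof -
      have "W \<inter> {x. Q x = 0} = R" by (auto simp: R_def)
      then show ?thesis by (simp add: sum.If_cases)
    qed
    finally have tot: "(\<Sum>c\<in>UNIV. G c) = of_nat (card R * CARD('a))" .
    have "(\<Sum>c\<in>UNIV. G c) = G 0 + (\<Sum>c\<in>UNIV - {0}. G c)"
      by (rule sum.remove) auto
    moreover have "G 0 = of_nat (card W)" by (simp add: G_def chi_0)
    ultimately have "of_nat (card W) = of_nat (card R * CARD('a)) - (\<Sum>c\<in>UNIV - {0}. G c)"
      using tot by simp
    then have "norm (of_nat (card W) :: complex) \<le> norm (of_nat (card R * CARD('a)) :: complex) + norm (\<Sum>c\<in>UNIV - {0}. G c)"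
      by (metis norm_triangle_ineq4)
    also have "norm (\<Sum>c\<in>UNIV - {0}. G c) \<le> (\<Sum>c\<in>UNIV - {0 :: 'a}. ?q ^ (?k - 1))"
      by (rule order_trans[OF norm_sum sum_mono]) (use nG in auto)
    also have "\<dots> = (?q - 1) * ?q ^ (?k - 1)"
      using q1 by (simp add: card_Diff_singleton of_nat_diff)
    finally have "?q ^ ?k \<le> ?q ^ (?l + 1) + (?q - 1) * ?q ^ (?k - 1)"
      unfolding norm_of_nat cW cR by (simp add: mult.commute)
    moreover have "?q ^ ?k = ?q * ?q ^ (?k - 1)" using kl by (cases ?k) auto
    ultimately have "?q ^ (?k - 1) \<le> ?q ^ (?l + 1)" by (simp add: algebra_simps)
    moreover have "?q ^ (?l + 1) < ?q ^ (?k - 1)" using q1 kl by (intro power_strict_increasing) auto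
    ultimately show False by simp
  qed
qed

lemma frame_tail:
  assumes b: "frame b N UNIV" and N: "N = l + k"
  shows "frame (\<lambda>i. b (l + i)) k {comb b N x | x. \<forall>i<l. x i = 0}"
proof -
  let ?c = "\<lambda>i. b (l + i)"
  have shift: "comb ?c k y = comb b N (\<lambda>i. if i < l then 0 else y (i - l))" for y
  proof -
    have "comb b l (\<lambda>i. if i < l then 0 else y (i - l)) = 0" by (simp add: comb_def)
    then show ?thesis unfolding N comb_append by simp
  qed
  have "inj_on (comb ?c k) (vecs k)"
    unfolding inj_comb_iff
  proof (intro ballI impI)
    fix y assume y: "y \<in> vecs k" "comb ?c k y = 0"
    let ?y = "\<lambda>i. if i < l then 0 else y (i - l)"
    have "?y \<in> vecs N" using y(1) N by (auto simp: vecs_def)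
    then have "?y = (\<lambda>i. 0)"
      using b y(2) unfolding shift frame_def bij_betw_def inj_comb_iff by blast
    then have "?y (l + i) = 0" for i by (rule fun_cong)
    then show "y = (\<lambda>i. 0)" by auto
  qed
  moreover have "comb ?c k ` vecs k = {comb b N x | x. \<forall>i<l. x i = 0}"
  proof
    show "comb ?c k ` vecs k \<subseteq> {comb b N x | x. \<forall>i<l. x i = 0}" unfolding shift by auto
    show "{comb b N x | x. \<forall>i<l. x i = 0} \<subseteq> comb ?c k ` vecs k"
    proof clarify
      fix x :: "nat \<Rightarrow> 'a" assume x: "\<forall>i<l. x i = 0"
      let ?y = "\<lambda>i. if i < k then x (l + i) else 0"
      have "comb b N x = comb ?c k ?y"
        unfolding shift by (rule comb_cong) (use x N in auto)
      moreover have "?y \<in> vecs k" by (simp add: vecs_def)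
      ultimately show "comb b N x \<in> comb ?c k ` vecs k" by (rule image_eqI)
    qed
  qed
  ultimately show ?thesis by (simp add: frame_def bij_betw_def)
qed

definition hyp_sum :: "nat \<Rightarrow> (nat \<Rightarrow> 'a) \<Rightarrow> (nat \<Rightarrow> 'a) \<Rightarrow> 'a" where
  "hyp_sum s x y = (\<Sum>i<s. x (2 * i) * y (2 * i + 1) + x (2 * i + 1) * y (2 * i))"

lemma hyp_sum_unit:
  assumes j: "j < 2 * s"
  shows "hyp_sum s x (\<lambda>i. if i = j then 1 else 0) = x (partner j)"
proof -
  have "hyp_sum s x (\<lambda>i. if i = j then 1 else 0) = (\<Sum>i<s. if i = j div 2 then x (partner j) else 0)"
    unfolding hyp_sum_def
  proof (rule sum.cong[OF refl])
    fix i
    show "x (2 * i) * (if 2 * i + 1 = j then 1 else 0) + x (2 * i + 1) * (if 2 * i = j then 1 else 0)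
        = (if i = j div 2 then x (partner j) else 0)"
    proof (cases "even j")
      case True
      then obtain t where "j = 2 * t" by blast
      then show ?thesis by (auto simp: partner_def)
    next
      case False
      then obtain t where "j = 2 * t + 1" by (rule oddE)
      then show ?thesis by (auto simp: partner_def)
    qed
  qed
  also have "\<dots> = x (partner j)" using j by (simp add: less_mult_imp_div_less mult.commute)
  finally show ?thesis .
qed

end

section \<open>Existence of normal forms and the rank\<close>

locale typed_form_space = form_space scale chi u w
  for scale :: "'a::{field,finite} \<Rightarrow> 'v::ab_group_add \<Rightarrow> 'v" and chi :: "'a \<Rightarrow> complex"
    and u w :: "nat \<Rightarrow> 'v" +
  fixes lam eta :: 'a
  assumes lam: "even CARD('a) \<Longrightarrow> absolute_trace lam = 1"
    and eta: "odd CARD('a) \<Longrightarrow> \<nexists>x. eta = x ^ 2"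
begin

text \<open>The parameter \<open>\<rho>\<close> is the dimension of the anisotropic part.\<close>

definition core :: "nat \<Rightarrow> 'a \<Rightarrow> 'a \<Rightarrow> 'a" where
  "core \<rho> y z = (if \<rho> = 0 then 0 else if \<rho> = 1 then y ^ 2 else plane_form lam eta y z)"

text \<open>The scalar \<open>a\<close> sits on the core alone, so the planes keep the matrix of
  \<open>hyp_ext\<close>. For \<open>\<rho> < 2\<close> the index \<open>2 * s + 1\<close> may fall
  outside the basis, and \<open>core\<close> ignores that argument.\<close>

definition normal_form :: "('v \<Rightarrow> 'a) \<Rightarrow> nat \<Rightarrow> nat \<Rightarrow> 'a \<Rightarrow> (nat \<Rightarrow> 'v) \<Rightarrow> bool" where
  "normal_form Q s \<rho> a b \<longleftrightarrow> frame b N UNIV \<and> a \<noteq> 0 \<and> \<rho> \<le> 2 \<and> 2 * s + \<rho> \<le> N \<and>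
     (\<forall>x. Q (comb b N x) = (\<Sum>i<s. x (2 * i) * x (2 * i + 1)) + a * core \<rho> (x (2 * s)) (x (2 * s + 1)))"

lemma plane_anisotropic: "plane_form lam eta y z = 0 \<Longrightarrow> y = 0 \<and> z = 0"
  using plane_form_anisotropic lam eta by blast

lemma plane_0 [simp]: "plane_form lam eta 0 0 = 0" and plane_1 [simp]: "plane_form lam eta 1 0 = 1"
  by (auto simp: plane_form_def)

text \<open>The zeros of \<open>Q\<close> in \<open>W\<close> form a subspace \<open>R\<close> in
  the radical of \<open>W\<close>, of codimension \<open>\<rho> \<le> 2\<close>. On the first
  \<open>\<rho>\<close> vectors of a frame that ends in \<open>R\<close> the form is anisotropic,
  hence a multiple of \<open>core\<close> after a change of these vectors.\<close>

lemma exists_core_frame: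
  assumes Q: "Q \<in> quadratic_forms" and W: "subspace W"
    and rad: "\<And>x y. x \<in> W \<Longrightarrow> Q x = 0 \<Longrightarrow> y \<in> W \<Longrightarrow> polar_form Q x y = 0"
  shows "\<exists>\<rho> a e. \<rho> \<le> 2 \<and> \<rho> \<le> dim W \<and> a \<noteq> 0 \<and> frame e (dim W) W \<and>
    (\<forall>y. Q (comb e (dim W) y) = a * core \<rho> (y 0) (y 1))"
proof -
  note S = quadraticD(2)[OF Q]
  define R where "R = {x \<in> W. Q x = 0}"
  have R: "subspace R" and codim: "dim W \<le> dim R + 2"
    unfolding R_def using singular_codim_le_2[OF Q W rad] by auto
  obtain c where c: "frame c (dim R) R" by (rule subspace_frame[OF R finite_V])
  have RW: "R \<subseteq> W" by (auto simp: R_def)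
  obtain d where d: "frame d (dim W) W" and lk: "dim R \<le> dim W"
    and dc: "\<And>i. i < dim R \<Longrightarrow> d (dim W - dim R + i) = c i"
    by (rule frame_prepend[OF c RW W finite_V]) blast
  define \<rho> where "\<rho> = dim W - dim R"
  have k: "dim W = \<rho> + dim R" and \<rho>2: "\<rho> \<le> 2" using lk codim by (auto simp: \<rho>_def)
  have tail: "comb (\<lambda>i. d (\<rho> + i)) (dim R) y = comb c (dim R) y" for y
    by (rule comb_cong) (auto simp: dc \<rho>_def)
  have inR: "comb c (dim R) y \<in> R" for y using c comb_span[of c "dim R"] by (simp add: frame_iff)
  have inW: "comb d l y \<in> W" if "l \<le> dim W" for l y
  proof -
    have "comb d l y \<in> span (d ` {..<l})" by (rule comb_span)
    also have "\<dots> \<subseteq> span (d ` {..<dim W})" using that by (intro span_mono) auto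
    finally show ?thesis using d by (simp add: frame_iff)
  qed
  have Qd: "Q (comb d (dim W) y) = Q (comb d \<rho> y)" for y
  proof -
    define r where "r = comb c (dim R) (\<lambda>i. y (\<rho> + i))"
    have r: "r \<in> R" using inR by (simp add: r_def)
    have "comb d (dim W) y = comb d \<rho> y + r" unfolding k comb_append tail r_def ..
    moreover have "polar_form Q r (comb d \<rho> y) = 0"
      using rad[of r] r inW[of \<rho> y] k by (simp add: R_def)
    then have "polar_form Q (comb d \<rho> y) r = 0" using symmetric_bilinearD(1)[OF S] by simp
    ultimately show ?thesis using r by (simp add: quadraticD(3)[OF Q] R_def)
  qed
  \<comment> \<open>A zero supported on the first \<open>\<rho>\<close> coordinates lies in
    \<open>R\<close>, so it also has an expansion in the last ones; uniqueness of coordinates makes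
    it 0.\<close>
  have aniso: "y = (\<lambda>i. 0)" if y: "y \<in> vecs \<rho>" "Q (comb d \<rho> y) = 0" for y
  proof -
    have "comb d \<rho> y \<in> R" using y inW[of \<rho> y] k by (simp add: R_def)
    then obtain z where z: "z \<in> vecs (dim R)" "comb d \<rho> y = comb c (dim R) z" by (rule frame_exE[OF c])
    define z' where "z' i = (if i < \<rho> then 0 else z (i - \<rho>))" for i
    have "comb d (dim W) z' = comb d \<rho> z' + comb c (dim R) (\<lambda>i. z' (\<rho> + i))" unfolding k comb_append tail ..
    also have "\<dots> = comb c (dim R) z"
    proof -
      have "comb d \<rho> z' = 0" by (simp add: comb_def z'_def)
      moreover have "(\<lambda>i. z' (\<rho> + i)) = z" by (auto simp: z'_def)
      ultimately show ?thesis by simp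
    qed
    also have "\<dots> = comb d (dim W) y"
    proof -
      have "comb (\<lambda>i. d (\<rho> + i)) (dim R) (\<lambda>i. y (\<rho> + i)) = 0"
        using y(1) by (simp add: comb_def vecs_def)
      then show ?thesis unfolding z(2)[symmetric] k comb_append by simp
    qed
    finally have e: "comb d (dim W) z' = comb d (dim W) y" .
    have "z' = y"
      by (rule inj_onD[of "comb d (dim W)" "vecs (dim W)", OF _ e]) (use d y(1) z(1) k in \<open>auto simp: frame_def bij_betw_def vecs_def z'_def\<close>)
    then show ?thesis using y(1) by (auto simp: fun_eq_iff z'_def vecs_def) (metis not_le)
  qed
  consider "\<rho> = 0" | "\<rho> = 1" | "\<rho> = 2" using \<rho>2 by linarith
  then show ?thesis
  proof cases
    case 1
    have "\<forall>y. Q (comb d (dim W) y) = 1 * core 0 (y 0) (y 1)"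
      unfolding Qd 1 by (simp add: core_def comb_def quadraticD(4)[OF Q])
    then show ?thesis using d by (intro exI[of _ 0] exI[of _ "1 :: 'a"] exI[of _ d]) auto
  next
    case 2
    have Q0: "Q (d 0) \<noteq> 0"
    proof
      assume "Q (d 0) = 0"
      then have "(\<lambda>i :: nat. if i = 0 then 1 else 0 :: 'a) = (\<lambda>i. 0)"
        by (intro aniso) (auto simp: 2 vecs_def comb_def)
      from fun_cong[OF this, of 0] show False by simp
    qed
    have "\<forall>y. Q (comb d (dim W) y) = Q (d 0) * core 1 (y 0) (y 1)"
      unfolding Qd 2 by (simp add: core_def comb_def quadraticD(1)[OF Q])
    then show ?thesis using d Q0 k 2 by (intro exI[of _ 1] exI[of _ "Q (d 0)"] exI[of _ d]) auto
  next
    case 3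
    define A where "A = Q (d 0)"
    define B where "B = polar_form Q (d 0) (d 1)"
    define C where "C = Q (d 1)"
    have Q2: "Q (comb d \<rho> y) = A * y 0 ^ 2 + B * y 0 * y 1 + C * y 1 ^ 2" for y
      unfolding 3 A_def B_def C_def
      by (simp add: comb_def numeral_2_eq_2 quadraticD(1,3)[OF Q] symmetric_bilinearD(3,5)[OF S] algebra_simps)
    have an: "y = 0 \<and> z = 0" if "A * y ^ 2 + B * y * z + C * z ^ 2 = 0" for y z
    proof -
      have "(\<lambda>i :: nat. if i = 0 then y else if i = 1 then z else 0) = (\<lambda>i. 0)"
        by (intro aniso) (use that in \<open>auto simp: 3 vecs_def Q2[unfolded 3]\<close>)
      from fun_cong[OF this, of 0] fun_cong[OF this, of 1] show ?thesis by simp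
    qed
    from anisotropic_binary_form[OF lam eta an] obtain a g h where a: "a \<noteq> 0"
      and ag: "\<And>y z. A * (y + h * z) ^ 2 + B * (y + h * z) * (g * z) + C * (g * z) ^ 2 = a * plane_form lam eta y z"
      by blast
    \<comment> \<open>The substitution of \<open>(y + h z, g z)\<close> for \<open>(y, z)\<close>,
      expressed in basis vectors.\<close>
    define e where "e i = (if i = 1 then scale g (d 1) + scale h (d 0) else d i)" for i
    have ce: "comb e (dim W) y = comb d (dim W) (\<lambda>i. if i = 0 then y 0 + h * y 1 else if i = 1 then g * y 1 else y i)" for y
      unfolding k 3 comb_append
    proof (rule arg_cong2[of _ _ _ _ "(+)"])
      show "comb e 2 y = comb d 2 (\<lambda>i. if i = 0 then y 0 + h * y 1 else if i = 1 then g * y 1 else y i)"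
        by (simp add: comb_def numeral_2_eq_2 e_def scale_right_distrib scale_left_distrib mult.commute add_ac)
    qed (rule comb_cong; simp add: e_def)
    have Qe: "Q (comb e (dim W) y) = a * plane_form lam eta (y 0) (y 1)" for y
      unfolding ce Qd Q2 using ag[of "y 0" "y 1"] by simp
    \<comment> \<open>Nothing is known about \<open>g\<close>; injectivity follows from the
      anisotropy of the plane form.\<close>
    have inj: "inj_on (comb e (dim W)) (vecs (dim W))"
      unfolding inj_comb_iff
    proof (intro ballI impI)
      fix y assume y: "y \<in> vecs (dim W)" "comb e (dim W) y = 0"
      then have "a * plane_form lam eta (y 0) (y 1) = 0" using Qe[of y] quadraticD(4)[OF Q] by simp
      then have "plane_form lam eta (y 0) (y 1) = 0" using a by simp
      from plane_anisotropic[OF this] have 0: "y 0 = 0" "y 1 = 0" by auto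
      then have "(\<lambda>i. if i = 0 then y 0 + h * y 1 else if i = 1 then g * y 1 else y i) = y" by auto
      then have "comb d (dim W) y = 0" using y(2) unfolding ce by simp
      then show "y = (\<lambda>i. 0)" using d y(1) unfolding frame_def bij_betw_def inj_comb_iff by blast
    qed
    have "comb e (dim W) ` vecs (dim W) = W"
    proof (rule card_subset_eq)
      show "comb e (dim W) ` vecs (dim W) \<subseteq> W" unfolding ce using inW by auto
      show "card (comb e (dim W) ` vecs (dim W)) = card W"
        unfolding card_image[OF inj] card_vecs card_subspace[OF W] ..
    qed simp
    then have "frame e (dim W) W" using inj by (simp add: frame_def bij_betw_def)
    moreover have "\<forall>y. Q (comb e (dim W) y) = a * core 2 (y 0) (y 1)" using Qe by (simp add: core_def)
    ultimately show ?thesis using a k 3 by (intro exI[of _ 2] exI[of _ a] exI[of _ e]) auto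
  qed
qed

text \<open>After splitting off a maximal family of hyperbolic pairs of singular vectors, every
  singular vector of the complement is orthogonal to the whole complement, as
  \<open>exists_core_frame\<close> requires.\<close>

lemma normal_form_exists:
  assumes Q: "Q \<in> quadratic_forms"
  shows "\<exists>s \<rho> a b. normal_form Q s \<rho> a b"
proof -
  note S = quadraticD(2)[OF Q]
  obtain s p where p: "hyp_pairs (polar_form Q) s p" and z': "\<forall>i<2 * s. Q (p i) = 0"
    and max: "\<forall>x\<in>perp_space (polar_form Q) s p. \<forall>y\<in>perp_space (polar_form Q) s p. Q x = 0 \<longrightarrow> Q y = 0 \<longrightarrow>
      polar_form Q x x = 0 \<longrightarrow> polar_form Q y y = 0 \<longrightarrow> polar_form Q x y \<noteq> 1"
    using maximal_hyp_pairs[OF S, of "\<lambda>x. Q x = 0"] by (elim exE conjE)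
  have z: "Q (p i) = 0" if "i < 2 * s" for i using z' that by simp
  define W where "W = perp_space (polar_form Q) s p"
  have W: "subspace W" unfolding W_def by (rule perp_space_subspace[OF S])
  have rad: "polar_form Q x y = 0" if x: "x \<in> W" "Q x = 0" and y: "y \<in> W" for x y
  proof (rule ccontr)
    assume t: "polar_form Q x y \<noteq> 0"
    define y1 where "y1 = scale (1 / polar_form Q x y) y"
    \<comment> \<open>The correction makes \<open>y2\<close> singular and keeps
      \<open>polar_form Q x y2 = 1\<close>, against maximality.\<close>
    define y2 where "y2 = y1 - scale (Q y1) x"
    have y1: "y1 \<in> W" "polar_form Q x y1 = 1"
      using W y t by (auto simp: y1_def subspace_def symmetric_bilinearD(3)[OF S])
    have xx: "polar_form Q x x = 0" using x(2) by (simp add: quadraticD(5)[OF Q])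
    have y2W: "y2 \<in> W" using W y1(1) x(1) by (simp add: y2_def subspace_diff subspace_scale)
    have xy2: "polar_form Q x y2 = 1"
      using y1 xx by (simp add: y2_def symmetric_bilinearD(3,6)[OF S])
    have "Q y1 = Q y2 + Q (scale (Q y1) x) + polar_form Q y2 (scale (Q y1) x)"
      using quadraticD(3)[OF Q, of y2 "scale (Q y1) x"] by (simp add: y2_def)
    then have "Q y2 = 0"
      using x(2) xy2 symmetric_bilinearD(1)[OF S, of y2 x]
      by (simp add: quadraticD(1)[OF Q] symmetric_bilinearD(3)[OF S])
    then show False
      using max[rule_format, of x y2] x y2W xy2 xx by (simp add: W_def quadraticD(5)[OF Q])
  qed
  obtain \<rho> a e where e: "\<rho> \<le> 2" "\<rho> \<le> dim W" "a \<noteq> 0" "frame e (dim W) W"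
    "\<And>y. Q (comb e (dim W) y) = a * core \<rho> (y 0) (y 1)"
    using exists_core_frame[OF Q W rad] by blast
  have fr: "frame (glue (2 * s) p e) N UNIV" and N: "2 * s + dim W = N"
    using hyp_pairs_frame[OF S p] e(4) W_def by auto
  have "Q (comb (glue (2 * s) p e) N x)
      = (\<Sum>i<s. x (2 * i) * x (2 * i + 1)) + a * core \<rho> (x (2 * s)) (x (2 * s + 1))" for x
  proof -
    have v: "comb e (dim W) (\<lambda>i. x (2 * s + i)) \<in> perp_space (polar_form Q) s p"
      using e(4) comb_span[of e "dim W"] by (simp add: frame_iff W_def)
    have "Q (comb (glue (2 * s) p e) N x)
        = (\<Sum>i<s. x (2 * i) * x (2 * i + 1)) + Q (comb e (dim W) (\<lambda>i. x (2 * s + i)))"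
      unfolding N[symmetric] comb_glue by (rule hyp_pairs_quadratic[OF Q p z v])
    then show ?thesis unfolding e(5) by simp
  qed
  then have "normal_form Q s \<rho> a (glue (2 * s) p e)"
    using fr e N by (simp add: normal_form_def)
  then show ?thesis by blast
qed

lemma normal_formD:
  assumes "normal_form Q s \<rho> a b"
  shows "frame b N UNIV" "a \<noteq> 0" "\<rho> \<le> 2" "2 * s + \<rho> \<le> N"
    "Q (comb b N x) = (\<Sum>i<s. x (2 * i) * x (2 * i + 1)) + a * core \<rho> (x (2 * s)) (x (2 * s + 1))"
  using assms unfolding normal_form_def by auto

lemma core_eq_0: "core \<rho> y z = 0 \<Longrightarrow> (1 \<le> \<rho> \<longrightarrow> y = 0) \<and> (2 \<le> \<rho> \<longrightarrow> z = 0)"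
  using plane_anisotropic[of y z] by (auto simp: core_def split: if_splits)

lemma core_cong:
  assumes "\<rho> \<le> 2" "1 \<le> \<rho> \<Longrightarrow> y = y'" "2 \<le> \<rho> \<Longrightarrow> z = z'"
  shows "core \<rho> y z = core \<rho> y' z'"
proof -
  consider "\<rho> = 0" | "\<rho> = 1" | "\<rho> = 2" using assms(1) by linarith
  then show ?thesis using assms by cases (auto simp: core_def)
qed

lemma core_0_0 [simp]: "core \<rho> 0 0 = 0" by (simp add: core_def)

lemma polar_normal_form:
  assumes "normal_form Q s \<rho> a b"
  shows "polar_form Q (comb b N x) (comb b N y) = hyp_sum s x y + a *
    (core \<rho> (x (2 * s) + y (2 * s)) (x (2 * s + 1) + y (2 * s + 1)) - core \<rho> (x (2 * s)) (x (2 * s + 1)) - core \<rho> (y (2 * s)) (y (2 * s + 1)))"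
proof -
  have "(\<Sum>i<s. (x (2 * i) + y (2 * i)) * (x (2 * i + 1) + y (2 * i + 1)))
      = hyp_sum s x y + (\<Sum>i<s. x (2 * i) * x (2 * i + 1)) + (\<Sum>i<s. y (2 * i) * y (2 * i + 1))"
    unfolding hyp_sum_def sum.distrib[symmetric] by (intro sum.cong refl) (simp add: algebra_simps)
  then show ?thesis
    unfolding polar_form_def comb_add[symmetric] normal_formD(5)[OF assms] by (simp add: algebra_simps)
qed

text \<open>For a radical vector, polarity with unit vectors at partner indices kills the hyperbolic
  coordinates; then \<open>Q x = 0\<close> and the anisotropy of the core kill the rest. The value
  of \<open>Q\<close> is decisive for \<open>\<rho> = 1\<close> in characteristic 2, where the polar
  form vanishes on the core.\<close>

lemma quadratic_rank_normal_form:
  assumes Q: "Q \<in> quadratic_forms" and nf: "normal_form Q s \<rho> a b"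
  shows "quadratic_rank Q = 2 * s + \<rho>"
proof -
  note D = normal_formD[OF nf] and P = polar_normal_form[OF nf]
  let ?l = "2 * s + \<rho>"
  obtain k where N: "N = ?l + k" using D(4) le_Suc_ex by blast
  have "quadratic_radical Q = {comb b N x | x. \<forall>i<?l. x i = 0}"
  proof
    show "{comb b N x | x. \<forall>i<?l. x i = 0} \<subseteq> quadratic_radical Q"
    proof clarify
      fix x :: "nat \<Rightarrow> 'a" assume x: "\<forall>i<?l. x i = 0"
      have c: "core \<rho> (x (2 * s) + t) (x (2 * s + 1) + t') = core \<rho> t t'" for t t'
        by (rule core_cong[OF D(3)]) (use x in auto)
      have c0: "core \<rho> (x (2 * s)) (x (2 * s + 1)) = 0" using c[of 0 0] by simp
      have "polar_form Q (comb b N x) v = 0" for v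
      proof -
        obtain y where y: "v = comb b N y" by (rule frame_exE[OF D(1) UNIV_I])
        have "hyp_sum s x y = 0" unfolding hyp_sum_def by (intro sum.neutral) (use x in auto)
        then show ?thesis unfolding y P c c0 by simp
      qed
      moreover have "(\<Sum>i<s. x (2 * i) * x (2 * i + 1)) = 0" by (intro sum.neutral) (use x in auto)
      then have "Q (comb b N x) = 0" unfolding D(5) c0 by simp
      ultimately show "comb b N x \<in> quadratic_radical Q" by (simp add: quadratic_radical_def)
    qed
    show "quadratic_radical Q \<subseteq> {comb b N x | x. \<forall>i<?l. x i = 0}"
    proof
      fix v assume v: "v \<in> quadratic_radical Q"
      obtain x where x: "v = comb b N x" by (rule frame_exE[OF D(1) UNIV_I])
      have h: "x i = 0" if i: "i < 2 * s" for i
      proof -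
        let ?d = "\<lambda>k. if k = partner i then 1 else 0 :: 'a"
        have j: "partner i < 2 * s" by (rule partner_less[OF i])
        then have d: "?d (2 * s) = 0" "?d (2 * s + 1) = 0" by auto
        have "0 = polar_form Q v (comb b N ?d)" using v by (simp add: quadratic_radical_def)
        also have "\<dots> = x i" unfolding x P d hyp_sum_unit[OF j] by simp
        finally show ?thesis by simp
      qed
      then have "(\<Sum>i<s. x (2 * i) * x (2 * i + 1)) = 0" by (intro sum.neutral) auto
      then have "core \<rho> (x (2 * s)) (x (2 * s + 1)) = 0"
        using v D(2) D(5)[of x] x by (simp add: quadratic_radical_def)
      note c0 = core_eq_0[OF this]
      have "x i = 0" if "i < ?l" for i
      proof -
        consider "i < 2 * s" | "i = 2 * s" "1 \<le> \<rho>" | "i = 2 * s + 1" "2 \<le> \<rho>"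
          using \<open>i < ?l\<close> D(3) by fastforce
        then show ?thesis using h c0 by cases auto
      qed
      then show "v \<in> {comb b N x | x. \<forall>i<?l. x i = 0}" using x by blast
    qed
  qed
  then have "dim (quadratic_radical Q) = k" using frame_dim[OF frame_tail[OF D(1) N]] by simp
  then show ?thesis unfolding quadratic_rank_def using N by simp
qed

section \<open>The transform of the weight\<close>

definition weight_sum :: "nat \<Rightarrow> ('v \<Rightarrow> 'a) \<Rightarrow> complex" where
  "weight_sum k Q = form_rank_sum (\<lambda>r. of_real (weight (real CARD('a)) (N div 2) k r)) Q"

context
  fixes Q s \<rho> a b
  assumes Q: "Q \<in> quadratic_forms" and nf: "normal_form Q s \<rho> a b" and even_N: "even N"
begin

private lemma tail_value:
  "Q (comb (\<lambda>i. b (2 * s + i)) (N - 2 * s) y) = a * core \<rho> (if N - 2 * s = 0 then 0 else y 0) (if N - 2 * s \<le> 1 then 0 else y 1)"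
proof -
  note D = normal_formD[OF nf]
  obtain M where N: "N = 2 * s + M" using D(4) by (metis add_leD1 le_Suc_ex)
  let ?y = "\<lambda>i. if i < 2 * s then 0 else y (i - 2 * s)"
  have M: "N - 2 * s = M" using N by simp
  have "comb b (2 * s) ?y = 0" by (simp add: comb_def)
  then have c: "comb (\<lambda>i. b (2 * s + i)) M y = comb b N ?y" unfolding N comb_append by simp
  have "(\<Sum>i<s. ?y (2 * i) * ?y (2 * i + 1)) = 0" by (intro sum.neutral) auto
  then have "Q (comb b N ?y) = a * core \<rho> (y 0) (y 1)" unfolding D(5) by simp
  also have "core \<rho> (y 0) (y 1) = core \<rho> (if M = 0 then 0 else y 0) (if M \<le> 1 then 0 else y 1)"
    using D(4) N by (intro core_cong[OF D(3)]) auto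
  finally show ?thesis unfolding M c .
qed

private lemma weight_sum_split:
  "weight_sum k Q = of_real (hyp_factor (real CARD('a)) (N div 2) k s) *
     rank_sum (N - 2 * s) (\<lambda>r. of_real (weight (real CARD('a)) (N div 2 - s) (k - s) r))
       (form_matrix (\<lambda>i. b (2 * s + i)) Q)"
  unfolding weight_sum_def
proof (rule form_rank_sum_split[OF Q normal_formD(1)[OF nf]])
  note D = normal_formD[OF nf]
  show "N = 2 * (N div 2)" using even_N by simp
  show "N - 2 * s + 2 * s = N" using D(4) by simp
  fix x :: "nat \<Rightarrow> 'a"
  have "core \<rho> (if N - 2 * s = 0 then 0 else x (2 * s + 0)) (if N - 2 * s \<le> 1 then 0 else x (2 * s + 1))
      = core \<rho> (x (2 * s)) (x (2 * s + 1))"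
    using D(4) by (intro core_cong[OF D(3)]) auto
  then show "Q (comb b N x) = (\<Sum>i<s. x (2 * i) * x (2 * i + 1)) +
      (\<Sum>i<N - 2 * s. \<Sum>j<N - 2 * s. form_matrix (\<lambda>i. b (2 * s + i)) Q i j * x (2 * s + i) * x (2 * s + j))"
    using representsD[OF represents_form_matrix[OF Q], of "\<lambda>i. b (2 * s + i)" "N - 2 * s" "\<lambda>i. x (2 * s + i)"]
      tail_value[of "\<lambda>i. x (2 * s + i)"] D(5)[of x]
    by argo
qed

private lemma tail_matrix_value:
  "(\<Sum>i<N - 2 * s. \<Sum>j<N - 2 * s. form_matrix (\<lambda>i. b (2 * s + i)) Q i j * y i * y j)
    = a * core \<rho> (if N - 2 * s = 0 then 0 else y 0) (if N - 2 * s \<le> 1 then 0 else y 1)"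
  unfolding tail_value[symmetric] representsD[OF represents_form_matrix[OF Q]] ..

text \<open>In the case \<open>k = s + 1\<close>, \<open>rank_sum_corank\<close> applies because the
  anisotropic plane meets the orthogonal complement of every vector in a nonzero vector.\<close>

lemma weight_sum_vanish:
  assumes k: "2 * k \<le> 2 * s + \<rho>" and ne: "\<not> (s = k \<and> \<rho> = 0)"
  shows "weight_sum k Q = 0"
proof -
  note D = normal_formD[OF nf]
  consider "k < s" | "k = s" "1 \<le> \<rho>" | "k = Suc s" "\<rho> = 2" using k ne D(3) by linarith
  then show ?thesis
  proof cases
    case 1
    then show ?thesis by (simp add: weight_sum_split hyp_factor_eq_0)
  next
    case 2
    let ?y = "\<lambda>i :: nat. if i = 0 then 1 else 0 :: 'a"
    have "core \<rho> 1 0 = 1" using 2 by (simp add: core_def)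
    then have "rank_sum (N - 2 * s) (\<lambda>r. 2) (form_matrix (\<lambda>i. b (2 * s + i)) Q) = 0"
      using 2 D(2,4) by (intro rank_sum_const[of ?y]) (auto simp: vecs_def tail_matrix_value)
    then show ?thesis using 2 by (simp add: weight_sum_split weight_0_right)
  next
    case 3
    let ?M = "N - 2 * s" and ?A = "form_matrix (\<lambda>i. b (2 * s + i)) Q" and ?q = "real CARD('a)"
    have M: "2 * (N div 2 - s) = ?M" "2 \<le> ?M" using even_N D(4) 3 by auto
    have "rank_sum ?M (\<lambda>r. of_real (weight ?q (N div 2 - s) 1 r)) ?A
        = rank_sum ?M (\<lambda>r. of_real (?q + 1) * (of_nat (CARD('a) ^ (?M - r)) - 1)) ?A"
    proof (rule rank_sum_cong)
      fix r assume "r \<le> ?M"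
      then have w1: "weight ?q (N div 2 - s) 1 r = (?q + 1) * (?q ^ (?M - r) - 1)"
        using weight_1[of r "N div 2 - s" ?q] unfolding M(1) by blast
      show "of_real (weight ?q (N div 2 - s) 1 r) = of_real (?q + 1) * (of_nat (CARD('a) ^ (?M - r)) - (1 :: complex))"
        unfolding w1 by simp
    qed
    also have "\<dots> = of_real (?q + 1) * (rank_sum ?M (\<lambda>r. of_nat (CARD('a) ^ (?M - r))) ?A - rank_sum ?M (\<lambda>r. 1) ?A)"
      unfolding rank_sum_scale rank_sum_diff ..
    also have "rank_sum ?M (\<lambda>r. of_nat (CARD('a) ^ (?M - r))) ?A = 0"
    proof (rule rank_sum_corank)
      fix v :: "nat \<Rightarrow> 'a" assume "v \<in> vecs ?M"
      \<comment> \<open>A nonzero vector of the plane orthogonal to \<open>v\<close>: the rotated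
        pair \<open>(v 1, - v 0)\<close>, or a unit vector if both entries are 0.\<close>
      define y where "y i = (if v 0 = 0 \<and> v 1 = 0 then if i = 0 then 1 else 0
        else if i = 0 then v 1 else if i = 1 then - v 0 else 0)" for i :: nat
      obtain l where l: "?M = Suc (Suc l)" using M(2) by (metis add_2_eq_Suc le_Suc_ex)
      have "dot ?M y v = (\<Sum>i<2 + l. y i * v i)" unfolding dot_def l by simp
      also have "\<dots> = y 0 * v 0 + y 1 * v 1"
      proof -
        have "y (Suc (Suc i)) = 0" for i by (simp add: y_def)
        then show ?thesis unfolding sum.lessThan_Suc_shift add_2_eq_Suc by simp
      qed
      also have "\<dots> = 0" by (simp add: y_def)
      finally have "dot ?M y v = 0" .
      moreover have "core \<rho> (y 0) (y 1) \<noteq> 0"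
        using core_eq_0[of \<rho> "y 0" "y 1"] 3 by (auto simp: y_def split: if_splits)
      then have "(\<Sum>i<?M. \<Sum>j<?M. ?A i j * y i * y j) \<noteq> 0"
      proof -
        have "(if ?M = 0 then 0 else y 0) = y 0" "(if ?M \<le> 1 then 0 else y 1) = y 1" using M(2) by auto
        with \<open>core \<rho> (y 0) (y 1) \<noteq> 0\<close> show ?thesis unfolding tail_matrix_value using D(2) by simp
      qed
      moreover have "y \<in> vecs ?M" using M(2) by (auto simp: vecs_def y_def)
      ultimately show "\<exists>y\<in>vecs ?M. dot ?M y v = 0 \<and> (\<Sum>i<?M. \<Sum>j<?M. ?A i j * y i * y j) \<noteq> 0" by blast
    qed
    also have "rank_sum ?M (\<lambda>r. 1) ?A = 0"
      using 3 D(2,4) by (intro rank_sum_const[of "\<lambda>i :: nat. if i = 0 then 1 else 0"])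
        (auto simp: vecs_def tail_matrix_value core_def)
    finally have "rank_sum ?M (\<lambda>r. of_real (weight ?q (N div 2 - s) 1 r)) ?A = 0" by simp
    then show ?thesis using 3(1) by (simp add: weight_sum_split)
  qed
qed

text \<open>The remaining form is identically 0, so every pairing is 1 and the sum is twice the
  number of symmetric matrices, times a nonzero factor.\<close>

lemma weight_sum_hyperbolic:
  assumes "\<rho> = 0"
  shows "weight_sum s Q \<noteq> 0"
proof -
  let ?M = "N - 2 * s" and ?A = "form_matrix (\<lambda>i. b (2 * s + i)) Q"
  have "(\<Sum>i<?M. \<Sum>j<?M. ?A i j * B i j) = (\<Sum>i<?M. \<Sum>j<?M. 0 * B i j)" if "B \<in> symm ?M" for B
  proof (rule mat_pairing_unique)
    show "(\<Sum>i<?M. \<Sum>j<?M. ?A i j * x i * x j) = (\<Sum>i<?M. \<Sum>j<?M. 0 * x i * x j)" for x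
      unfolding tail_matrix_value using assms by (simp add: core_def)
    show "B i j = B j i" for i j using that by (simp add: symm_def)
  qed
  then have "rank_sum ?M (\<lambda>r. 2) ?A = (\<Sum>B\<in>(symm ?M :: (nat \<Rightarrow> nat \<Rightarrow> 'a) set). 2)"
    unfolding rank_sum_def by (intro sum.cong refl) (simp add: mat_pairing_def chi_0)
  moreover have "(\<lambda>i j. 0) \<in> (symm ?M :: (nat \<Rightarrow> nat \<Rightarrow> 'a) set)" by (simp add: symm_def)
  then have "card (symm ?M :: (nat \<Rightarrow> nat \<Rightarrow> 'a) set) \<noteq> 0" by auto
  moreover have "hyp_factor (real CARD('a)) (N div 2) s s \<noteq> 0"
    using card_field_gt_1[where 'a = 'a] by (intro hyp_factor_nonzero) auto
  ultimately show ?thesis by (simp add: weight_sum_split weight_0_right)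
qed

end

section \<open>Equivalence and types of quadratic forms\<close>

lemma linear_from_frames:
  assumes b: "frame b N UNIV" and c: "frame c N UNIV"
  shows "\<exists>L. Vector_Spaces.linear scale scale L \<and> bij L \<and> (\<forall>x. L (comb b N x) = comb c N x)"
proof -
  define L where "L v = comb c N (crd b v)" for v
  have eq: "L (comb b N x) = comb c N x" for x
  proof -
    have v: "(\<lambda>i. if i < N then x i else 0) \<in> vecs N" by (simp add: vecs_def)
    have "L (comb b N (\<lambda>i. if i < N then x i else 0)) = comb c N (\<lambda>i. if i < N then x i else 0)"
      unfolding L_def crd(3)[OF b v] ..
    then show ?thesis unfolding comb_restrict .
  qed
  have "Vector_Spaces.linear scale scale L"
    unfolding Vector_Spaces.linear_iff
    by (simp add: vector_space_axioms L_def crd(4,5)[OF b] comb_add comb_scale)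
  moreover have "bij L"
  proof (rule finite_UNIV_surj_inj[THEN conjI[THEN iffD2[OF bij_def]], rotated])
    show "surj L"
    proof (rule surjI)
      fix v show "L (comb b N (crd c v)) = v" unfolding eq by (rule crd(2)[OF c])
    qed
    then show "surj L" .
  qed simp
  ultimately show ?thesis using eq by blast
qed

lemma linear_frame_image:
  assumes "Vector_Spaces.linear scale scale L" "bij L" "frame b N UNIV"
  shows "frame (\<lambda>i. L (b i)) N UNIV" "comb (\<lambda>i. L (b i)) N x = L (comb b N x)"
proof -
  interpret L: Vector_Spaces.linear scale scale L by fact
  show c: "comb (\<lambda>i. L (b i)) N x = L (comb b N x)" for x
    unfolding comb_def by (simp add: L.sum L.scale)
  have "comb (\<lambda>i. L (b i)) N ` vecs N = L ` (comb b N ` vecs N)"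
    unfolding image_image c ..
  also have "\<dots> = UNIV" using assms(2,3) by (simp add: frame_def bij_betw_def bij_def)
  finally show "frame (\<lambda>i. L (b i)) N UNIV" by (simp add: frame_UNIV_iff_surj)
qed

definition transform :: "'a \<Rightarrow> ('v \<Rightarrow> 'v) \<Rightarrow> ('v \<Rightarrow> 'v \<Rightarrow> 'a) \<Rightarrow> 'v \<Rightarrow> 'v \<Rightarrow> 'a" where
  "transform a L S x y = a * S (L x) (L y)"

lemma transform_bilinear:
  assumes "Vector_Spaces.linear scale scale L" "S \<in> symmetric_bilinear_forms"
  shows "transform a L S \<in> symmetric_bilinear_forms"
proof (rule symmetric_bilinearI)
  interpret L: Vector_Spaces.linear scale scale L by fact
  fix x y z c
  show "transform a L S x y = transform a L S y x"
    using symmetric_bilinearD(1)[OF assms(2)] by (simp add: transform_def)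
  show "transform a L S x (y + z) = transform a L S x y + transform a L S x z"
    by (simp add: transform_def L.add symmetric_bilinearD(2)[OF assms(2)] algebra_simps)
  show "transform a L S x (scale c y) = c * transform a L S x y"
    by (simp add: transform_def L.scale symmetric_bilinearD(3)[OF assms(2)])
qed

lemma transform_rank:
  assumes L: "Vector_Spaces.linear scale scale L" "bij L" and a: "a \<noteq> 0" and S: "S \<in> symmetric_bilinear_forms"
  shows "symmetric_rank (transform a L S) = symmetric_rank S"
proof -
  have "bij_betw L (symmetric_radical (transform a L S)) (symmetric_radical S)"
    unfolding bij_betw_def
  proof
    show "inj_on L (symmetric_radical (transform a L S))"
      using L(2) by (meson bij_is_inj inj_on_subset subset_UNIV)
    show "L ` symmetric_radical (transform a L S) = symmetric_radical S"
    proof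
      show "L ` symmetric_radical (transform a L S) \<subseteq> symmetric_radical S"
      proof (rule image_subsetI)
        fix x assume x: "x \<in> symmetric_radical (transform a L S)"
        have "S (L x) y = 0" for y
        proof -
          obtain z where "y = L z" using bij_is_surj[OF L(2)] by (rule surjE)
          then show ?thesis using x a by (simp add: symmetric_radical_def transform_def)
        qed
        then show "L x \<in> symmetric_radical S" by (simp add: symmetric_radical_def)
      qed
      show "symmetric_radical S \<subseteq> L ` symmetric_radical (transform a L S)"
      proof
        fix y assume y: "y \<in> symmetric_radical S"
        obtain z where z: "y = L z" using bij_is_surj[OF L(2)] by (rule surjE)
        then have "z \<in> symmetric_radical (transform a L S)" using y by (simp add: symmetric_radical_def transform_def)
        then show "y \<in> L ` symmetric_radical (transform a L S)" using z by blast
      qed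
    qed
  qed
  then have "card (symmetric_radical (transform a L S)) = card (symmetric_radical S)"
    by (rule bij_betw_same_card)
  then have "CARD('a) ^ dim (symmetric_radical (transform a L S)) = CARD('a) ^ dim (symmetric_radical S)"
    using card_subspace radical_subspace S transform_bilinear[OF L(1) S] by metis
  then show ?thesis using card_field_gt_1[where 'a = 'a] by (simp add: symmetric_rank_def)
qed

text \<open>Passing from \<open>Q\<close> to \<open>a * Q (L x)\<close> is undone in the pairing by
  transforming \<open>S\<close> with the scalar \<open>1 / a\<close> and a map \<open>M\<close>
  contragredient to \<open>L\<close>. As \<open>X\<close> and \<open>f\<close> are invariant, this
  permutes the summands. With \<open>f\<close> a function of the rank it serves
  \<open>weight_sum\<close>, with \<open>f = 1\<close> the sums over a class.\<close>

lemma pairing_sum_equivalent: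
  assumes Q: "Q \<in> quadratic_forms" and eqv: "quadratic_equivalent Q Q'"
    and X: "X \<subseteq> symmetric_bilinear_forms"
    and closed: "\<And>a L S. a \<noteq> 0 \<Longrightarrow> Vector_Spaces.linear scale scale L \<Longrightarrow> bij L \<Longrightarrow> S \<in> X \<Longrightarrow>
      transform a L S \<in> X \<and> f (transform a L S) = f S"
  shows "Q' \<in> quadratic_forms"
    and "(\<Sum>S\<in>X. f S * form_pairing chi u w Q S) = (\<Sum>S\<in>X. f S * form_pairing chi u w Q' S)"
proof -
  obtain a L where a: "a \<noteq> 0" and L: "Vector_Spaces.linear scale scale L" "bij L" and Q': "\<And>x. Q' x = a * Q (L x)"
    using eqv unfolding quadratic_equivalent_def by blast
  interpret L: Vector_Spaces.linear scale scale L by (rule L(1))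
  have polar: "polar_form Q' = transform a L (polar_form Q)"
    by (simp add: fun_eq_iff polar_form_def transform_def Q' L.add algebra_simps)
  show Q'q: "Q' \<in> quadratic_forms"
  proof (rule quadraticI)
    show "polar_form Q' \<in> symmetric_bilinear_forms"
      unfolding polar by (rule transform_bilinear[OF L(1) quadraticD(2)[OF Q]])
  qed (simp add: Q' L.scale quadraticD(1)[OF Q])
  let ?u = "\<lambda>i. u (Suc i)" and ?w = "\<lambda>i. w (Suc i)"
  define b where "b i = L (?u i)" for i
  have b: "frame b N UNIV" "comb b N x = L (comb ?u N x)" for x
    unfolding b_def using linear_frame_image[OF L u_frame] by auto
  let ?A = "form_matrix b Q"
  have A: "represents b N ?A Q" by (rule represents_form_matrix[OF Q])
  have A': "represents ?u N (\<lambda>i j. a * ?A i j) Q'"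
    unfolding represents_def
    using representsD[OF A] by (simp add: Q' flip: b(2)) (simp add: sum_distrib_left mult.assoc)
  obtain w' where w': "frame w' N UNIV"
    and pair: "\<forall>Q\<in>quadratic_forms. \<forall>S\<in>symmetric_bilinear_forms. \<forall>A. represents b N A Q \<longrightarrow>
      form_pairing chi u w Q S = chi (mat_pairing N A (gram w' S))"
    using pairing_change_basis[OF b(1)] by (elim exE conjE)
  obtain M where M: "Vector_Spaces.linear scale scale M" "bij M" "\<And>x. M (comb ?w N x) = comb w' N x"
    using linear_from_frames[OF w_frame w'] by blast
  have Mw: "M (?w i) = w' i" if "i < N" for i
    using M(3)[of "\<lambda>j. if j = i then 1 else 0"] that by (simp add: comb_unit)
  define g where "g = transform (1 / a) M"
  have pg: "form_pairing chi u w Q' (g S) = form_pairing chi u w Q S" if S: "S \<in> symmetric_bilinear_forms" for S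
  proof -
    have "mat_pairing N (\<lambda>i j. a * ?A i j) (gram ?w (g S)) = mat_pairing N ?A (gram w' S)"
      unfolding mat_pairing_def using a
      by (intro sum.cong refl) (simp add: gram_def g_def transform_def Mw)
    then show ?thesis
      using form_pairing_eq[OF Q'q _ A', of "g S"] transform_bilinear[OF M(1) S] pair[rule_format, OF Q S A]
      by (simp add: g_def)
  qed
  have cg: "g S \<in> X" "f (g S) = f S" if "S \<in> X" for S
    unfolding g_def using closed[OF _ M(1,2) that, of "1 / a"] a by auto
  have inj: "inj_on g X"
  proof
    fix S T assume e: "g S = g T"
    have "S x y = T x y" for x y
    proof -
      obtain x' y' where "x = M x'" "y = M y'" using bij_is_surj[OF M(2)] by (metis surjE)
      then show ?thesis using fun_cong[OF fun_cong[OF e, of x'], of y'] a by (simp add: g_def transform_def)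
    qed
    then show "S = T" by (simp add: fun_eq_iff)
  qed
  have "g ` X = X" by (rule endo_inj_surj[OF _ _ inj]) (use cg in auto)
  then have "(\<Sum>S\<in>X. f S * form_pairing chi u w Q' S) = (\<Sum>S\<in>X. f (g S) * form_pairing chi u w Q' (g S))"
    using sum.reindex[OF inj, of "\<lambda>S. f S * form_pairing chi u w Q' S"] by simp
  also have "\<dots> = (\<Sum>S\<in>X. f S * form_pairing chi u w Q S)"
    using X by (intro sum.cong refl) (simp add: cg pg subset_iff)
  finally show "(\<Sum>S\<in>X. f S * form_pairing chi u w Q S) = (\<Sum>S\<in>X. f S * form_pairing chi u w Q' S)" ..
qed

lemma weight_sum_equivalent:
  assumes "Q \<in> quadratic_forms" "quadratic_equivalent Q Q'"
  shows "weight_sum k Q = weight_sum k Q'"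
  unfolding weight_sum_def form_rank_sum_def
  by (rule pairing_sum_equivalent(2)[OF assms order_refl]) (simp add: transform_bilinear transform_rank)

lemma symmetric_equivalent_transform:
  assumes L: "Vector_Spaces.linear scale scale L" "bij L" and a: "a \<noteq> 0" and eqv: "symmetric_equivalent S T"
  shows "symmetric_equivalent (transform a L S) T"
proof -
  interpret L: Vector_Spaces.linear scale scale L by (rule L(1))
  obtain c K where c: "c \<noteq> 0" and K: "Vector_Spaces.linear scale scale K" "bij K" and T: "\<And>x y. T x y = c * S (K x) (K y)"
    using eqv unfolding symmetric_equivalent_def by blast
  interpret K: Vector_Spaces.linear scale scale K by (rule K(1))
  have Li: "L (inv L x) = x" for x using L(2) by (simp add: bij_is_surj surj_f_inv_f)
  have iL: "inv L (L x) = x" for x using L(2) by (simp add: bij_is_inj)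
  have "Vector_Spaces.linear scale scale (inv L \<circ> K)"
    unfolding Vector_Spaces.linear_iff comp_def
  proof (intro conjI allI vector_space_axioms)
    fix x y e
    show "inv L (K (x + y)) = inv L (K x) + inv L (K y)"
      using iL[of "inv L (K x) + inv L (K y)"] by (simp add: L.add K.add Li)
    show "inv L (K (scale e x)) = scale e (inv L (K x))"
      using iL[of "scale e (inv L (K x))"] by (simp add: L.scale K.scale Li)
  qed
  moreover have "bij (inv L \<circ> K)" using K(2) L(2) by (intro bij_comp bij_imp_bij_inv)
  moreover have "T x y = (c / a) * transform a L S ((inv L \<circ> K) x) ((inv L \<circ> K) y)" for x y
    using a by (simp add: T transform_def Li)
  ultimately show ?thesis using a c unfolding symmetric_equivalent_def
    by (intro exI[of _ "c / a"] exI[of _ "inv L \<circ> K"]) simp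
qed

lemma symmetric_class_closed:
  assumes "a \<noteq> 0" "Vector_Spaces.linear scale scale L" "bij L" "S \<in> symmetric_class eta k"
  shows "transform a L S \<in> symmetric_class eta k"
proof -
  have S: "S \<in> symmetric_bilinear_forms" using assms(4) by (simp add: symmetric_class_def split: form_index.splits)
  note r = transform_rank[OF assms(2,3,1) S] and t = transform_bilinear[OF assms(2) S, of a]
  have "symmetric_has_type eta (transform a L S) \<tau>" if "symmetric_has_type eta S \<tau>" for \<tau>
    using that symmetric_equivalent_transform[OF assms(2,3,1)]
    unfolding symmetric_has_type_def r by blast
  then show ?thesis using assms(4) r t by (simp add: symmetric_class_def split: form_index.splits)
qed

lemma frame_rescale:
  assumes b: "frame b N UNIV" and c: "\<And>i. c i \<noteq> 0"
  shows "frame (\<lambda>i. scale (c i) (b i)) N UNIV" "comb (\<lambda>i. scale (c i) (b i)) N x = comb b N (\<lambda>i. c i * x i)"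
proof -
  show e: "comb (\<lambda>i. scale (c i) (b i)) N x = comb b N (\<lambda>i. c i * x i)" for x
    by (simp add: comb_def mult.commute)
  have "v \<in> comb (\<lambda>i. scale (c i) (b i)) N ` vecs N" for v
  proof -
    obtain x where x: "x \<in> vecs N" "v = comb b N x" by (rule frame_exE[OF b UNIV_I])
    have "v = comb (\<lambda>i. scale (c i) (b i)) N (\<lambda>i. x i / c i)"
      unfolding x(2) e by (rule comb_cong) (use c in auto)
    moreover have "(\<lambda>i. x i / c i) \<in> vecs N" using x(1) by (simp add: vecs_def)
    ultimately show ?thesis by (rule image_eqI)
  qed
  then show "frame (\<lambda>i. scale (c i) (b i)) N UNIV" unfolding frame_UNIV_iff_surj by blast
qed

lemma frame_rescale_odd:
  assumes b: "frame b N UNIV" and a: "a \<noteq> 0"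
  shows "\<exists>b'. frame b' N UNIV \<and>
    (\<forall>x. comb b' N x = comb b N (\<lambda>i. if i < 2 * s \<and> odd i then a * x i else x i))"
proof -
  let ?c = "\<lambda>i. if i < 2 * s \<and> odd i then a else 1"
  have c: "?c i \<noteq> 0" for i using a by simp
  have "comb (\<lambda>i. scale (?c i) (b i)) N x = comb b N (\<lambda>i. if i < 2 * s \<and> odd i then a * x i else x i)" for x
    unfolding frame_rescale(2)[OF b c] by (rule comb_cong) auto
  then show ?thesis using frame_rescale(1)[OF b c] by (intro exI[of _ "\<lambda>i. scale (?c i) (b i)"]) simp
qed

text \<open>Rescaling one vector of every hyperbolic pair by \<open>a\<close> spreads the scalar
  over the whole form, where equivalence absorbs it.\<close>

lemma scaled_normal_form:
  assumes "normal_form Q s \<rho> a b"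
  shows "\<exists>b'. frame b' N UNIV \<and>
    (\<forall>x. Q (comb b' N x) = a * ((\<Sum>i<s. x (2 * i) * x (2 * i + 1)) + core \<rho> (x (2 * s)) (x (2 * s + 1))))"
proof -
  note D = normal_formD[OF assms]
  obtain b' where b': "frame b' N UNIV"
    and c: "\<And>x. comb b' N x = comb b N (\<lambda>i. if i < 2 * s \<and> odd i then a * x i else x i)"
    using frame_rescale_odd[OF D(1,2), of s] by blast
  have "Q (comb b' N x) = a * ((\<Sum>i<s. x (2 * i) * x (2 * i + 1)) + core \<rho> (x (2 * s)) (x (2 * s + 1)))" for x
  proof -
    have "(\<Sum>i<s. (if 2 * i < 2 * s \<and> odd (2 * i) then a * x (2 * i) else x (2 * i)) *
        (if 2 * i + 1 < 2 * s \<and> odd (2 * i + 1) then a * x (2 * i + 1) else x (2 * i + 1)))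
        = (\<Sum>i<s. a * (x (2 * i) * x (2 * i + 1)))"
      by (intro sum.cong refl) auto
    then show ?thesis unfolding c D(5) by (simp add: sum_distrib_left distrib_left)
  qed
  then show ?thesis using b' by blast
qed

lemma quadratic_equivalentI:
  assumes "frame b N UNIV" "frame b' N UNIV" "a \<noteq> 0" "a' \<noteq> 0"
    and Q: "\<And>x. Q (comb b N x) = a * f x" and Q': "\<And>x. Q' (comb b' N x) = a' * f x"
  shows "quadratic_equivalent Q Q'"
proof -
  obtain L where L: "Vector_Spaces.linear scale scale L" "bij L" "\<And>x. L (comb b' N x) = comb b N x"
    using linear_from_frames[OF assms(2,1)] by blast
  have "Q' y = (a' / a) * Q (L y)" for y
  proof -
    obtain x where "y = comb b' N x" by (rule frame_exE[OF assms(2) UNIV_I])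
    then show ?thesis using assms(3) by (simp add: L(3) Q Q')
  qed
  then show ?thesis using L assms(3,4) unfolding quadratic_equivalent_def
    by (intro exI[of _ "a' / a"] exI[of _ L]) simp
qed

lemma hyperbolic_normal_form:
  assumes b: "ordered_basis b" and s: "2 * s \<le> N"
  shows "normal_form (hyperbolic_quadratic b s) s 0 1 (\<lambda>i. b (Suc i))"
proof -
  have "hyperbolic_quadratic b s (comb (\<lambda>i. b (Suc i)) N x) = (\<Sum>i<s. x (2 * i) * x (2 * i + 1))" for x
    unfolding hyperbolic_quadratic_def One_nat_def sum.atLeast1_atMost_eq
    using coord_comb[OF b] s by (intro sum.cong refl) simp
  then show ?thesis
    using b s unfolding normal_form_def ordered_basis_iff_frame by (simp add: core_def)
qed

lemma elliptic_normal_form: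
  assumes b: "ordered_basis b" and s: "2 * Suc s \<le> N"
  shows "normal_form (elliptic_quadratic lam eta b (Suc s)) s 2 1 (\<lambda>i. b (Suc i))"
proof -
  have "elliptic_quadratic lam eta b (Suc s) (comb (\<lambda>i. b (Suc i)) N x)
      = (\<Sum>i<s. x (2 * i) * x (2 * i + 1)) + core 2 (x (2 * s)) (x (2 * s + 1))" for x
  proof -
    have "(\<Sum>i=1..Suc s - 1. coord b (2 * i - 1) (comb (\<lambda>i. b (Suc i)) N x) * coord b (2 * i) (comb (\<lambda>i. b (Suc i)) N x))
        = (\<Sum>i<s. x (2 * i) * x (2 * i + 1))"
      unfolding One_nat_def diff_Suc_Suc diff_zero sum.atLeast1_atMost_eq
      using coord_comb[OF b] s by (intro sum.cong refl) simp
    moreover have "coord b (2 * Suc s - 1) (comb (\<lambda>i. b (Suc i)) N x) = x (2 * s)"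
      "coord b (2 * Suc s) (comb (\<lambda>i. b (Suc i)) N x) = x (2 * s + 1)"
      using coord_comb[OF b, of "2 * s" x] coord_comb[OF b, of "2 * s + 1" x] s by simp_all
    ultimately show ?thesis unfolding elliptic_quadratic_def by (simp add: core_def plane_form_def)
  qed
  then show ?thesis
    using b s unfolding normal_form_def ordered_basis_iff_frame by simp
qed

lemma quadratic_equivalent_closed:
  "Q \<in> quadratic_forms \<Longrightarrow> quadratic_equivalent Q Q' \<Longrightarrow> Q' \<in> quadratic_forms"
  by (rule pairing_sum_equivalent(1)[where X = "{}"]) auto

text \<open>The two types are told apart by \<open>weight_sum s\<close>, which is invariant under equivalence, nonzero at
  hyperbolic forms of rank \<open>2 * s\<close> and zero at elliptic ones.\<close>

lemma has_type_iff:
  assumes Q: "Q \<in> quadratic_forms" and nf: "normal_form Q s \<rho> a b" and even_N: "even N" and \<rho>: "\<rho> \<noteq> 1"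
  shows "quadratic_has_type lam eta Q \<tau> \<longleftrightarrow> \<tau> = (if \<rho> = 0 then 1 else -1)"
proof -
  note D = normal_formD[OF nf]
  note rank = quadratic_rank_normal_form[OF Q nf]
  have \<rho>02: "\<rho> = 0 \<or> \<rho> = 2" using D(3) \<rho> by linarith
  show ?thesis
  proof
    assume "quadratic_has_type lam eta Q \<tau>"
    then consider "quadratic_rank Q = 0" "\<tau> = 1"
      | s' b' where "1 \<le> s'" "quadratic_rank Q = 2 * s'" "ordered_basis b'" "\<tau> = 1" "quadratic_equivalent Q (hyperbolic_quadratic b' s')"
      | s' b' where "1 \<le> s'" "quadratic_rank Q = 2 * s'" "ordered_basis b'" "\<tau> = -1" "quadratic_equivalent Q (elliptic_quadratic lam eta b' s')"
      unfolding quadratic_has_type_def by (elim disjE exE conjE) simp_all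
    then show "\<tau> = (if \<rho> = 0 then 1 else -1)"
    proof cases
      case 1
      then show ?thesis using rank by simp
    next
      case 2
      have le: "2 * s' \<le> N" using 2(2) rank D(4) by simp
      note h = quadratic_equivalent_closed[OF Q 2(5)]
      have "weight_sum s' Q \<noteq> 0"
        unfolding weight_sum_equivalent[OF Q 2(5)]
        by (rule weight_sum_hyperbolic[OF h hyperbolic_normal_form[OF 2(3) le] even_N refl])
      moreover have "2 * s' \<le> 2 * s + \<rho>" using 2(2) rank by simp
      ultimately have "s = s' \<and> \<rho> = 0"
        using weight_sum_vanish[OF Q nf even_N, of s'] by blast
      then show ?thesis using 2(4) by simp
    next
      case 3
      \<comment> \<open>The elliptic standard form of rank \<open>2 * s'\<close> has only
        \<open>s' - 1\<close> hyperbolic planes; its core has \<open>\<rho> = 2\<close>.\<close>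
      obtain t where t: "s' = Suc t" using 3(1) by (cases s') auto
      have le: "2 * Suc t \<le> N" using 3(2) rank D(4) t by simp
      note h = quadratic_equivalent_closed[OF Q 3(5)]
      have "weight_sum s' Q = 0"
        unfolding weight_sum_equivalent[OF Q 3(5)]
        by (rule weight_sum_vanish[OF h elliptic_normal_form[OF 3(3) le, folded t] even_N]) (auto simp: t)
      have "\<rho> \<noteq> 0"
      proof
        assume "\<rho> = 0"
        moreover from this have "s = s'" using 3(2) rank by simp
        ultimately show False using weight_sum_hyperbolic[OF Q nf even_N] \<open>weight_sum s' Q = 0\<close> by simp
      qed
      then show ?thesis using 3(4) by simp
    qed
  next
    assume \<tau>: "\<tau> = (if \<rho> = 0 then 1 else -1)"
    obtain b' where b': "frame b' N UNIV"
      and Qb: "\<And>x. Q (comb b' N x) = a * ((\<Sum>i<s. x (2 * i) * x (2 * i + 1)) + core \<rho> (x (2 * s)) (x (2 * s + 1)))"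
      using scaled_normal_form[OF nf] by blast
    let ?b = "\<lambda>i. b' (i - 1)"
    let ?f = "\<lambda>x. (\<Sum>i<s. x (2 * i) * x (2 * i + 1)) + core \<rho> (x (2 * s)) (x (2 * s + 1))"
    have ob: "ordered_basis ?b" by (rule frame_UNIV_ordered_basis[OF b'])
    show "quadratic_has_type lam eta Q \<tau>"
    proof (cases "\<rho> = 0")
      case True
      show ?thesis
      proof (cases "s = 0")
        case True
        then show ?thesis using rank \<tau> \<open>\<rho> = 0\<close> by (simp add: quadratic_has_type_def)
      next
        case False
        have le: "2 * s \<le> N" using D(4) by simp
        note st = normal_formD[OF hyperbolic_normal_form[OF ob le]]
        have "quadratic_equivalent Q (hyperbolic_quadratic ?b s)"
        proof (rule quadratic_equivalentI[where f = ?f and a = a and a' = 1, OF b' st(1) D(2)])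
          show "hyperbolic_quadratic ?b s (comb (\<lambda>i. b' (Suc i - 1)) N x) = 1 * ?f x" for x
            using st(5)[of x] True by (simp add: core_def)
        qed (simp, rule Qb)
        then show ?thesis using False ob rank \<tau> True unfolding quadratic_has_type_def
          by - (rule disjI2, intro exI[of _ s] conjI exI[of _ ?b], auto)
      qed
    next
      case False
      then have \<rho>2: "\<rho> = 2" using \<rho>02 by simp
      then have le: "2 * Suc s \<le> N" using D(4) by simp
      note st = normal_formD[OF elliptic_normal_form[OF ob le]]
      have "quadratic_equivalent Q (elliptic_quadratic lam eta ?b (Suc s))"
      proof (rule quadratic_equivalentI[where f = ?f and a = a and a' = 1, OF b' st(1) D(2)])
        show "elliptic_quadratic lam eta ?b (Suc s) (comb (\<lambda>i. b' (Suc i - 1)) N x) = 1 * ?f x" for x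
          using st(5)[of x] \<rho>2 by simp
      qed (simp, rule Qb)
      then show ?thesis using False ob rank \<tau> \<rho>2 unfolding quadratic_has_type_def
        by - (rule disjI2, intro exI[of _ "Suc s"] conjI exI[of _ ?b], auto)
    qed
  qed
qed

definition index_of :: "nat \<Rightarrow> nat \<Rightarrow> form_index" where
  "index_of s \<rho> = (if \<rho> = 1 then Odd_Rank (2 * int s + 1)
     else Even_Rank (2 * int s + int \<rho>) (if \<rho> = 0 then 1 else -1))"

lemma index_of_inj:
  assumes "index_of s \<rho> = index_of s' \<rho>'" "\<rho> \<le> 2" "\<rho>' \<le> 2"
  shows "s = s' \<and> \<rho> = \<rho>'"
  using assms by (auto simp: index_of_def split: if_splits)

lemma quadratic_class_iff:
  assumes Q: "Q \<in> quadratic_forms" and nf: "normal_form Q s \<rho> a b" and even_N: "even N"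
  shows "i \<in> form_indices \<and> Q \<in> quadratic_class lam eta i \<longleftrightarrow> i = index_of s \<rho>"
proof -
  note D = normal_formD[OF nf]
  note rank = quadratic_rank_normal_form[OF Q nf]
  show ?thesis
  proof (cases "\<rho> = 1")
    case True
    show ?thesis
    proof (cases i)
      case (Odd_Rank r)
      then show ?thesis using True rank Q
        by (auto simp: index_of_def form_indices_def quadratic_class_def)
    next
      case (Even_Rank r \<tau>)
      then have "\<not> (i \<in> form_indices \<and> Q \<in> quadratic_class lam eta i)"
        using True rank by (auto simp: form_indices_def quadratic_class_def) presburger+
      then show ?thesis using True Even_Rank by (simp add: index_of_def)
    qed
  next
    case False
    note type = has_type_iff[OF Q nf even_N False]
    have \<rho>02: "\<rho> = 0 \<or> \<rho> = 2" using D(3) False by linarith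
    show ?thesis
    proof (cases i)
      case (Odd_Rank r)
      then have "\<not> (i \<in> form_indices \<and> Q \<in> quadratic_class lam eta i)"
        using \<rho>02 rank by (auto simp: form_indices_def quadratic_class_def) presburger+
      then show ?thesis using False Odd_Rank by (simp add: index_of_def)
    next
      case (Even_Rank r \<tau>)
      have "\<exists>t. 2 * int s + int \<rho> = 2 * t"
        using \<rho>02 by (intro exI[of _ "int s + int \<rho> div 2"]) auto
      then show ?thesis using False Even_Rank rank Q \<rho>02 type
        by (auto simp: index_of_def form_indices_def quadratic_class_def)
    qed
  qed
qed

section \<open>Classes as orbits and the dual inner distribution\<close>

lemma quadratic_class_unique:
  assumes "Q \<in> quadratic_forms" "even N"
  shows "\<exists>i0. \<forall>i. i \<in> form_indices \<and> Q \<in> quadratic_class lam eta i \<longleftrightarrow> i = i0"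
proof -
  obtain s \<rho> a b where "normal_form Q s \<rho> a b" using normal_form_exists[OF assms(1)] by blast
  from quadratic_class_iff[OF assms(1) this assms(2)] show ?thesis by (intro exI allI)
qed

text \<open>Equal indices mean equal \<open>s\<close> and \<open>\<rho>\<close>, and the scaled
  normal forms then differ by a scalar. Through \<open>class_sum_eq\<close> this makes
  \<open>Q_number\<close> independent of the representative picked by \<open>SOME\<close>.\<close>

lemma quadratic_class_equivalent:
  assumes i: "i \<in> form_indices" and Q: "Q \<in> quadratic_class lam eta i" and Q': "Q' \<in> quadratic_class lam eta i"
    and even_N: "even N"
  shows "Q \<in> quadratic_forms" "quadratic_equivalent Q Q'"
proof -
  show Qf: "Q \<in> quadratic_forms"
    using Q by (simp add: quadratic_class_def split: form_index.splits)
  have Qf': "Q' \<in> quadratic_forms"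
    using Q' by (simp add: quadratic_class_def split: form_index.splits)
  obtain s \<rho> a b where nf: "normal_form Q s \<rho> a b" using normal_form_exists[OF Qf] by blast
  obtain s' \<rho>' a' b' where nf': "normal_form Q' s' \<rho>' a' b'" using normal_form_exists[OF Qf'] by blast
  have "i = index_of s \<rho>" "i = index_of s' \<rho>'"
    using quadratic_class_iff[OF Qf nf even_N, of i] quadratic_class_iff[OF Qf' nf' even_N, of i] i Q Q' by simp_all
  then have "index_of s' \<rho>' = index_of s \<rho>" by simp
  from index_of_inj[OF this normal_formD(3)[OF nf'] normal_formD(3)[OF nf]]
  have e: "s' = s" "\<rho>' = \<rho>" by auto
  obtain c where c: "frame c N UNIV"
    "\<And>x. Q (comb c N x) = a * ((\<Sum>i<s. x (2 * i) * x (2 * i + 1)) + core \<rho> (x (2 * s)) (x (2 * s + 1)))"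
    using scaled_normal_form[OF nf] by blast
  obtain c' where c': "frame c' N UNIV"
    "\<And>x. Q' (comb c' N x) = a' * ((\<Sum>i<s. x (2 * i) * x (2 * i + 1)) + core \<rho> (x (2 * s)) (x (2 * s + 1)))"
    using scaled_normal_form[OF nf'] unfolding e by blast
  show "quadratic_equivalent Q Q'"
    by (rule quadratic_equivalentI[where
        f = "\<lambda>x. (\<Sum>i<s. x (2 * i) * x (2 * i + 1)) + core \<rho> (x (2 * s)) (x (2 * s + 1))" and a = a and a' = a',
        OF c(1) c'(1) normal_formD(2)[OF nf] normal_formD(2)[OF nf'] c(2) c'(2)])
qed

lemma class_sum_eq:
  assumes "i \<in> form_indices" "Q \<in> quadratic_class lam eta i" "Q' \<in> quadratic_class lam eta i" "even N"
  shows "(\<Sum>S\<in>symmetric_class eta k. form_pairing chi u w Q S) = (\<Sum>S\<in>symmetric_class eta k. form_pairing chi u w Q' S)"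
proof -
  have X: "symmetric_class eta k \<subseteq> symmetric_bilinear_forms"
    by (auto simp: symmetric_class_def split: form_index.splits)
  have "(\<Sum>S\<in>symmetric_class eta k. 1 * form_pairing chi u w Q S) = (\<Sum>S\<in>symmetric_class eta k. 1 * form_pairing chi u w Q' S)"
    by (rule pairing_sum_equivalent(2)[OF quadratic_class_equivalent[OF assms] X])
       (simp add: symmetric_class_closed)
  then show ?thesis by simp
qed

lemma sum_pairing_diff:
  assumes Y: "Y \<subseteq> quadratic_forms" and S: "S \<in> symmetric_bilinear_forms"
  shows "(\<Sum>P\<in>Y \<times> Y. form_pairing chi u w (\<lambda>x. fst P x - snd P x) S)
    = of_real ((cmod (\<Sum>Q\<in>Y. form_pairing chi u w Q S)) ^ 2)"
proof -
  have "(\<Sum>P\<in>Y \<times> Y. form_pairing chi u w (\<lambda>x. fst P x - snd P x) S)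
      = (\<Sum>P\<in>Y \<times> Y. form_pairing chi u w (fst P) S * cnj (form_pairing chi u w (snd P) S))"
    using Y S by (intro sum.cong refl form_pairing_diff) auto
  also have "\<dots> = (\<Sum>Q\<in>Y. form_pairing chi u w Q S) * cnj (\<Sum>Q\<in>Y. form_pairing chi u w Q S)"
    unfolding cnj_sum sum_product sum.cartesian_product by (simp add: case_prod_unfold)
  finally show ?thesis unfolding complex_norm_square .
qed

text \<open>Each difference of two elements of \<open>Y\<close> lies in exactly one class, so
  \<open>Q_number\<close> can be evaluated at the difference itself, and the sum over classes
  regroups into one over all pairs.\<close>

lemma dual_inner_distribution_eq:
  assumes Y: "Y \<subseteq> quadratic_forms" and even_N: "even N"
  shows "dual_inner_distribution lam eta chi u w Y k =
    (\<Sum>S\<in>symmetric_class eta k. of_real ((cmod (\<Sum>Q\<in>Y. form_pairing chi u w Q S)) ^ 2)) / of_nat (card Y)"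
proof -
  define K where "K Q = (\<Sum>S\<in>symmetric_class eta k. form_pairing chi u w Q S)" for Q
  define I where "I = {i. i \<in> form_indices \<and> quadratic_class lam eta i \<noteq> {}}"
  define df where "df P = (\<lambda>x. fst P x - snd P x)" for P :: "('v \<Rightarrow> 'a) \<times> ('v \<Rightarrow> 'a)"
  have df: "df P \<in> quadratic_forms" if "P \<in> Y \<times> Y" for P
    unfolding df_def using that Y by (intro quadratic_forms_diff) auto
  define ix where "ix Q = (SOME i0. \<forall>i. i \<in> form_indices \<and> Q \<in> quadratic_class lam eta i \<longleftrightarrow> i = i0)" for Q
  have ix: "i \<in> form_indices \<and> Q \<in> quadratic_class lam eta i \<longleftrightarrow> i = ix Q" if "Q \<in> quadratic_forms" for i Q
    using someI_ex[OF quadratic_class_unique[OF that even_N]] unfolding ix_def by (rule spec)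
  have Iix: "I = ix ` quadratic_forms"
  proof
    show "I \<subseteq> ix ` quadratic_forms"
    proof
      fix i assume "i \<in> I"
      then obtain Q where Q: "i \<in> form_indices" "Q \<in> quadratic_class lam eta i" by (auto simp: I_def)
      then have "Q \<in> quadratic_forms" by (simp add: quadratic_class_def split: form_index.splits)
      then show "i \<in> ix ` quadratic_forms" using ix Q by (metis image_eqI)
    qed
    show "ix ` quadratic_forms \<subseteq> I"
    proof (rule image_subsetI)
      fix Q assume "Q \<in> quadratic_forms"
      then show "ix Q \<in> I" using ix[of Q "ix Q"] by (auto simp: I_def)
    qed
  qed
  have fI: "finite I" unfolding Iix by simp
  have Qn: "Q_number lam eta chi u w k i = K Q" if "i \<in> form_indices" "Q \<in> quadratic_class lam eta i" for i Q
    unfolding Q_number_def K_def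
    by (rule class_sum_eq[OF that(1) _ that(2) even_N]) (rule someI[of "\<lambda>Q. Q \<in> quadratic_class lam eta i", OF that(2)])
  have "dual_inner_distribution lam eta chi u w Y k
      = (\<Sum>i\<in>I. Q_number lam eta chi u w k i * of_nat (card {P \<in> Y \<times> Y. ix (df P) = i})) / of_nat (card Y)"
  proof -
    have "{(Q, Q'). (Q, Q') \<in> Y \<times> Y \<and> (\<lambda>x. Q x - Q' x) \<in> quadratic_class lam eta i} = {P \<in> Y \<times> Y. ix (df P) = i}"
      if "i \<in> I" for i
    proof -
      have "(\<lambda>x. fst P x - snd P x) \<in> quadratic_class lam eta i \<longleftrightarrow> ix (df P) = i" if "P \<in> Y \<times> Y" for P
        using ix[OF df[OF that], of i] \<open>i \<in> I\<close> by (auto simp: I_def df_def)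
      then show ?thesis by auto
    qed
    then show ?thesis
      unfolding dual_inner_distribution_def inner_distribution_def I_def[symmetric] sum_divide_distrib
      by (intro sum.cong refl) (simp add: case_prod_unfold)
  qed
  also have "(\<Sum>i\<in>I. Q_number lam eta chi u w k i * of_nat (card {P \<in> Y \<times> Y. ix (df P) = i}))
      = (\<Sum>i\<in>I. \<Sum>P\<in>{P \<in> Y \<times> Y. ix (df P) = i}. K (df P))"
  proof (rule sum.cong[OF refl])
    fix i assume i: "i \<in> I"
    have "K (df P) = Q_number lam eta chi u w k i" if "P \<in> {P \<in> Y \<times> Y. ix (df P) = i}" for P
    proof -
      have "i \<in> form_indices \<and> df P \<in> quadratic_class lam eta i" using that ix[OF df, of P i] by auto
      then show ?thesis using Qn[of i "df P"] by simp
    qed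
    then show "Q_number lam eta chi u w k i * of_nat (card {P \<in> Y \<times> Y. ix (df P) = i})
        = (\<Sum>P\<in>{P \<in> Y \<times> Y. ix (df P) = i}. K (df P))" by simp
  qed
  also have "\<dots> = (\<Sum>P\<in>Y \<times> Y. K (df P))"
  proof (rule sum.group)
    show "(\<lambda>P. ix (df P)) ` (Y \<times> Y) \<subseteq> I" unfolding Iix using df by blast
  qed (use fI in simp_all)
  also have "\<dots> = (\<Sum>S\<in>symmetric_class eta k. \<Sum>P\<in>Y \<times> Y. form_pairing chi u w (df P) S)"
    unfolding K_def by (rule sum.swap)
  also have "\<dots> = (\<Sum>S\<in>symmetric_class eta k. of_real ((cmod (\<Sum>Q\<in>Y. form_pairing chi u w Q S)) ^ 2))"
  proof (rule sum.cong[OF refl])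
    fix S assume "S \<in> symmetric_class eta k"
    then have S: "S \<in> symmetric_bilinear_forms" by (simp add: symmetric_class_def split: form_index.splits)
    show "(\<Sum>P\<in>Y \<times> Y. form_pairing chi u w (df P) S) = of_real ((cmod (\<Sum>Q\<in>Y. form_pairing chi u w Q S)) ^ 2)"
      unfolding df_def by (rule sum_pairing_diff[OF Y S])
  qed
  finally show ?thesis .
qed

section \<open>Types of symmetric bilinear forms\<close>

lemma symmetric_rank_frame:
  assumes S: "S \<in> symmetric_bilinear_forms" and b: "frame b N UNIV" and l: "l \<le> N"
    and z: "\<And>x y. \<forall>i<l. x i = 0 \<Longrightarrow> S (comb b N x) (comb b N y) = 0"
    and nd: "\<And>x. \<forall>y. S (comb b N x) (comb b N y) = 0 \<Longrightarrow> \<forall>i<l. x i = 0"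
  shows "symmetric_rank S = l"
proof -
  obtain k where N: "N = l + k" using l le_Suc_ex by blast
  have "symmetric_radical S = {comb b N x | x. \<forall>i<l. x i = 0}"
  proof
    show "{comb b N x | x. \<forall>i<l. x i = 0} \<subseteq> symmetric_radical S"
    proof clarify
      fix x :: "nat \<Rightarrow> 'a" assume x: "\<forall>i<l. x i = 0"
      have "S (comb b N x) v = 0" for v
      proof -
        obtain y where "v = comb b N y" by (rule frame_exE[OF b UNIV_I])
        then show ?thesis using z[OF x] by simp
      qed
      then show "comb b N x \<in> symmetric_radical S" by (simp add: symmetric_radical_def)
    qed
    show "symmetric_radical S \<subseteq> {comb b N x | x. \<forall>i<l. x i = 0}"
    proof
      fix v assume v: "v \<in> symmetric_radical S"
      obtain x where x: "v = comb b N x" by (rule frame_exE[OF b UNIV_I])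
      have "\<forall>i<l. x i = 0" by (rule nd) (use v x in \<open>simp add: symmetric_radical_def\<close>)
      then show "v \<in> {comb b N x | x. \<forall>i<l. x i = 0}" using x by blast
    qed
  qed
  then have "dim (symmetric_radical S) = k" using frame_dim[OF frame_tail[OF b N]] by simp
  then show ?thesis using N by (simp add: symmetric_rank_def)
qed

definition sym_core :: "nat \<Rightarrow> 'a \<Rightarrow> 'a \<Rightarrow> 'a \<Rightarrow> 'a \<Rightarrow> 'a" where
  "sym_core \<rho> x0 x1 y0 y1 = (if \<rho> = 0 then 0 else if \<rho> = 1 then x0 * y0
     else if even CARD('a) then x0 * y1 + x1 * y0 + x1 * y1 else x0 * y0 - eta * (x1 * y1))"

lemma hyperbolic_symmetric_comb:
  assumes b: "ordered_basis b" and s: "2 * s \<le> N"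
  shows "hyperbolic_symmetric b s (comb (\<lambda>i. b (Suc i)) N x) (comb (\<lambda>i. b (Suc i)) N y) = hyp_sum s x y"
  unfolding hyperbolic_symmetric_def hyp_sum_def One_nat_def sum.atLeast1_atMost_eq
  using coord_comb[OF b] s by (intro sum.cong refl) simp

lemma elliptic_symmetric_comb:
  assumes b: "ordered_basis b" and s: "2 * Suc s \<le> N"
  shows "elliptic_symmetric eta b (Suc s) (comb (\<lambda>i. b (Suc i)) N x) (comb (\<lambda>i. b (Suc i)) N y)
    = hyp_sum s x y + sym_core 2 (x (2 * s)) (x (2 * s + 1)) (y (2 * s)) (y (2 * s + 1))"
proof -
  let ?x = "comb (\<lambda>i. b (Suc i)) N x" and ?y = "comb (\<lambda>i. b (Suc i)) N y"
  have "(\<Sum>i=1..Suc s - 1. coord b (2 * i - 1) ?x * coord b (2 * i) ?y + coord b (2 * i) ?x * coord b (2 * i - 1) ?y)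
      = hyp_sum s x y"
    unfolding One_nat_def diff_Suc_Suc diff_zero sum.atLeast1_atMost_eq hyp_sum_def
    using coord_comb[OF b] s by (intro sum.cong refl) simp
  moreover have "coord b (2 * Suc s - 1) (comb (\<lambda>i. b (Suc i)) N z) = z (2 * s)"
    "coord b (2 * Suc s) (comb (\<lambda>i. b (Suc i)) N z) = z (2 * s + 1)" for z
    using coord_comb[OF b, of "2 * s" z] coord_comb[OF b, of "2 * s + 1" z] s by simp_all
  ultimately show ?thesis unfolding elliptic_symmetric_def by (simp add: sym_core_def)
qed

lemma linear_id: "Vector_Spaces.linear scale scale (\<lambda>x. x)"
  unfolding Vector_Spaces.linear_iff using vector_space_axioms by simp

text \<open>The scalar is spread as in \<open>scaled_normal_form\<close>; then \<open>S\<close> is a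
  multiple of the standard form in the new basis, and the identity serves as the linear map.\<close>

lemma symmetric_has_typeI:
  assumes b: "frame b N UNIV" and a: "a \<noteq> 0" and \<rho>: "\<rho> = 0 \<or> \<rho> = 2" and le: "2 * s + \<rho> \<le> N"
    and rank: "symmetric_rank S = 2 * s + \<rho>"
    and eq: "\<And>x y. S (comb b N x) (comb b N y)
      = hyp_sum s x y + a * sym_core \<rho> (x (2 * s)) (x (2 * s + 1)) (y (2 * s)) (y (2 * s + 1))"
  shows "symmetric_has_type eta S (if \<rho> = 0 then 1 else -1)"
proof -
  obtain b' where b': "frame b' N UNIV"
    and c: "\<And>x. comb b' N x = comb b N (\<lambda>i. if i < 2 * s \<and> odd i then a * x i else x i)"
    using frame_rescale_odd[OF b a, of s] by blast
  let ?b = "\<lambda>i. b' (i - 1)"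
  have ob: "ordered_basis ?b" by (rule frame_UNIV_ordered_basis[OF b'])
  have eq': "S (comb b' N x) (comb b' N y)
      = a * (hyp_sum s x y + sym_core \<rho> (x (2 * s)) (x (2 * s + 1)) (y (2 * s)) (y (2 * s + 1)))" for x y
  proof -
    have "hyp_sum s (\<lambda>i. if i < 2 * s \<and> odd i then a * x i else x i) (\<lambda>i. if i < 2 * s \<and> odd i then a * y i else y i)
        = a * hyp_sum s x y"
      unfolding hyp_sum_def sum_distrib_left by (intro sum.cong refl) (auto simp: algebra_simps)
    then show ?thesis unfolding c eq by (simp add: distrib_left)
  qed
  have std: "symmetric_equivalent S T"
    if T: "\<And>x y. T (comb b' N x) (comb b' N y)
      = hyp_sum s x y + sym_core \<rho> (x (2 * s)) (x (2 * s + 1)) (y (2 * s)) (y (2 * s + 1))" for T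
    unfolding symmetric_equivalent_def
  proof (intro exI conjI allI)
    show "1 / a \<noteq> 0" using a by simp
    show "Vector_Spaces.linear scale scale (\<lambda>x. x)" by (rule linear_id)
    show "bij (\<lambda>x :: 'v. x)" by (rule bij_betw_byWitness[where f' = "\<lambda>x. x"]) auto
    fix v v'
    obtain x where x: "v = comb b' N x" by (rule frame_exE[OF b' UNIV_I])
    obtain y where y: "v' = comb b' N y" by (rule frame_exE[OF b' UNIV_I])
    show "T v v' = 1 / a * S v v'" unfolding x y T eq' using a by simp
  qed
  show ?thesis
  proof (cases "\<rho> = 0")
    case True
    show ?thesis
    proof (cases "s = 0")
      case True
      then show ?thesis using rank \<open>\<rho> = 0\<close> by (simp add: symmetric_has_type_def)
    next
      case False
      have le': "2 * s \<le> N" using le by simp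
      have "symmetric_equivalent S (hyperbolic_symmetric ?b s)"
        by (rule std) (use hyperbolic_symmetric_comb[OF ob le'] True in \<open>simp add: sym_core_def\<close>)
      then show ?thesis using False ob rank True unfolding symmetric_has_type_def
        by - (rule disjI2, intro exI[of _ s] conjI exI[of _ ?b], auto)
    qed
  next
    case False
    then have \<rho>2: "\<rho> = 2" using \<rho> by simp
    then have le': "2 * Suc s \<le> N" using le by simp
    have "symmetric_equivalent S (elliptic_symmetric eta ?b (Suc s))"
      by (rule std) (use elliptic_symmetric_comb[OF ob le'] \<rho>2 in simp)
    then show ?thesis using False ob rank \<rho>2 unfolding symmetric_has_type_def
      by - (rule disjI2, intro exI[of _ "Suc s"] conjI exI[of _ ?b], auto)
  qed
qed

lemma glue_frame:
  assumes W: "subspace W" and c: "frame c l Z" and ZW: "Z \<subseteq> W" and p: "\<And>i. i < r \<Longrightarrow> p i \<in> W"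
    and span: "\<And>x. x \<in> W \<Longrightarrow> \<exists>y. x - comb p r y \<in> Z"
    and indep: "\<And>x z. z \<in> Z \<Longrightarrow> comb p r x + z = 0 \<Longrightarrow> \<forall>i<r. x i = 0"
  shows "frame (glue r p c) (r + l) W"
  unfolding frame_def bij_betw_def
proof
  have inZ: "comb c l y \<in> Z" for y using c comb_span[of c l] by (simp add: frame_iff)
  show "inj_on (comb (glue r p c) (r + l)) (vecs (r + l))"
    unfolding inj_comb_iff
  proof (intro ballI impI ext)
    fix x i assume x: "x \<in> vecs (r + l)" "comb (glue r p c) (r + l) x = 0"
    have h: "\<forall>i<r. x i = 0" by (rule indep[OF inZ]) (use x(2) in \<open>simp add: comb_glue\<close>)
    then have "comb p r x = 0" by (simp add: comb_def)
    then have "comb c l (\<lambda>i. x (r + i)) = 0" using x(2) by (simp add: comb_glue)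
    moreover have "(\<lambda>i. x (r + i)) \<in> vecs l" using x(1) by (simp add: vecs_def)
    ultimately have "(\<lambda>i. x (r + i)) = (\<lambda>i. 0)"
      using c unfolding frame_def bij_betw_def inj_comb_iff by blast
    from fun_cong[OF this, of "i - r"] show "x i = 0" using h by (cases "i < r") auto
  qed
  show "comb (glue r p c) (r + l) ` vecs (r + l) = W"
  proof
    have "comb p r x \<in> W" for x
      unfolding comb_def by (intro subspace_sum[OF W] subspace_scale[OF W]) (use p in auto)
    then show "comb (glue r p c) (r + l) ` vecs (r + l) \<subseteq> W"
      unfolding comb_glue using inZ ZW subspace_add[OF W] by blast
    show "W \<subseteq> comb (glue r p c) (r + l) ` vecs (r + l)"
    proof
      fix v assume "v \<in> W"
      then obtain y where "v - comb p r y \<in> Z" using span by blast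
      then obtain z where z: "z \<in> vecs l" "v - comb p r y = comb c l z" by (rule frame_exE[OF c])
      define x where "x i = (if i < r then y i else z (i - r))" for i
      have "comb (glue r p c) (r + l) x = comb p r y + comb c l z"
        unfolding comb_glue by (intro arg_cong2[of _ _ _ _ "(+)"] comb_cong) (auto simp: x_def)
      also have "\<dots> = v" using z(2) by (simp add: algebra_simps)
      finally have "v = comb (glue r p c) (r + l) x" ..
      moreover have "x \<in> vecs (r + l)" using z(1) by (auto simp: vecs_def x_def)
      ultimately show "v \<in> comb (glue r p c) (r + l) ` vecs (r + l)" by (rule image_eqI)
    qed
  qed
qed

text \<open>In characteristic 2 the map \<open>x \<mapsto> S x x\<close> is additive and, every scalar being a square, its kernel \<open>H\<close>
  has codimension at most 1 in \<open>W\<close>; by maximality \<open>S\<close> vanishes on \<open>H\<close>.\<close>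

lemma exists_sym_core_frame:
  assumes even_q: "even CARD('a)" and S: "S \<in> symmetric_bilinear_forms" and W: "subspace W"
    and max: "\<And>x y. x \<in> W \<Longrightarrow> y \<in> W \<Longrightarrow> S x x = 0 \<Longrightarrow> S y y = 0 \<Longrightarrow> S x y \<noteq> 1"
  shows "\<exists>\<rho> e. \<rho> \<le> 2 \<and> \<rho> \<le> dim W \<and> frame e (dim W) W \<and>
    (\<forall>x y. S (comb e (dim W) x) (comb e (dim W) y) = sym_core \<rho> (x 0) (x 1) (y 0) (y 1))"
proof -
  note Sb = symmetric_bilinearD[OF S]
  note dbl = char2_double[OF even_q]
  have Wadd: "x + y \<in> W" if "x \<in> W" "y \<in> W" for x y using subspace_add[OF W that] .
  have Wsc: "scale t x \<in> W" if "x \<in> W" for t x using subspace_scale[OF W that] .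
  have Wdiff: "x - y \<in> W" if "x \<in> W" "y \<in> W" for x y using subspace_diff[OF W that] .
  \<comment> \<open>Otherwise scaling \<open>y\<close> would give \<open>S x y = 1\<close>, which
    \<open>max\<close> excludes.\<close>
  have iso: "S x y = 0" if "x \<in> W" "y \<in> W" "S x x = 0" "S y y = 0" for x y
  proof (rule ccontr)
    assume "S x y \<noteq> 0"
    then have "S x (scale (1 / S x y) y) = 1" by (simp add: Sb(3))
    then show False using max[of x "scale (1 / S x y) y"] that Wsc by (simp add: Sb(3,5))
  qed
  define H where "H = {x \<in> W. S x x = 0}"
  have H0: "0 \<in> H" using W by (simp add: H_def Sb(8) subspace_0)
  have Hadd: "x + y \<in> H" if "x \<in> H" "y \<in> H" for x y
    using that iso[of x y] iso[of y x] Wadd by (simp add: H_def Sb(2,4))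
  have Hsc: "scale t x \<in> H" if "x \<in> H" for t x
    using that Wsc by (simp add: H_def Sb(3,5))
  have isoH: "S x y = 0" if "x \<in> H" "y \<in> H" for x y using iso that by (simp add: H_def)
  show ?thesis
  proof (cases "\<forall>x\<in>W. S x x = 0")
    case True
    obtain e where e: "frame e (dim W) W" by (rule subspace_frame[OF W finite_V])
    have "comb e (dim W) x \<in> W" for x using e comb_span[of e "dim W"] by (simp add: frame_iff)
    then have "\<forall>x y. S (comb e (dim W) x) (comb e (dim W) y) = sym_core 0 (x 0) (x 1) (y 0) (y 1)"
      using True iso by (simp add: sym_core_def)
    then show ?thesis using e by (intro exI[of _ 0] exI[of _ e]) simp
  next
    case False
    then obtain u0 where u0: "u0 \<in> W" "S u0 u0 \<noteq> 0" by blast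
    obtain t where t: "t ^ 2 = 1 / S u0 u0" using sqrt_char2[OF even_q] by blast
    define z where "z = scale t u0"
    have z: "z \<in> W" "S z z = 1"
      using u0 Wsc t by (auto simp: z_def Sb(3,5) power2_eq_square mult.assoc[symmetric])
    \<comment> \<open>\<open>W\<close> is spanned by \<open>H\<close> and \<open>z\<close>, and
      \<open>S\<close> vanishes on \<open>H\<close>, so this is the part of \<open>H\<close> that is
      orthogonal to all of \<open>W\<close>.\<close>
    define Z where "Z = {h \<in> H. S z h = 0}"
    have Z: "subspace Z" unfolding subspace_def Z_def using H0 Hadd Hsc by (simp add: Sb(2,3,8))
    have ZW: "Z \<subseteq> W" by (auto simp: Z_def H_def)
    obtain c where c: "frame c (dim Z) Z" by (rule subspace_frame[OF Z finite_V])
    have inZ: "comb c (dim Z) x \<in> Z" for x using c comb_span[of c "dim Z"] by (simp add: frame_iff)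
    \<comment> \<open>In characteristic 2 the cross terms cancel, leaving
      \<open>S x x + \<beta> ^ 2\<close>; hence the square root of \<open>S x x\<close>.\<close>
    have proj: "\<exists>\<beta>. x - scale \<beta> z \<in> H" if x: "x \<in> W" for x
    proof -
      obtain \<beta> where \<beta>: "\<beta> ^ 2 = S x x" using sqrt_char2[OF even_q] by blast
      have "S (x - scale \<beta> z) (x - scale \<beta> z) = S x x - (\<beta> * S x z + \<beta> * S x z) + \<beta> ^ 2"
        using Sb(1)[of z x] z(2) by (simp add: Sb(3,5,6,7) power2_eq_square algebra_simps)
      also have "\<dots> = 0" unfolding dbl \<beta> by (simp add: dbl)
      finally show ?thesis using x z(1) Wsc Wdiff by (intro exI[of _ \<beta>]) (simp add: H_def)
    qed
    show ?thesis
    proof (cases "\<forall>h\<in>H. S z h = 0")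
      case True
      have ZH: "Z = H" using True by (auto simp: Z_def)
      have c1: "comb (\<lambda>i. z) 1 x = scale (x 0) z" for x by (simp add: comb_def)
      have fr: "frame (glue 1 (\<lambda>i. z) c) (1 + dim Z) W"
      proof (rule glue_frame[OF W c ZW z(1)])
        show "\<exists>y. x - comb (\<lambda>i. z) 1 y \<in> Z" if x: "x \<in> W" for x
        proof -
          obtain \<beta> where "x - scale \<beta> z \<in> H" using proj[OF x] by blast
          then show ?thesis unfolding c1 ZH by (intro exI[of _ "\<lambda>i. \<beta>"])
        qed
        fix x r assume r: "r \<in> Z" "comb (\<lambda>i. z) 1 x + r = 0"
        have "0 = S z (comb (\<lambda>i. z) 1 x + r)" unfolding r(2) by (simp add: Sb(8))
        also have "\<dots> = x 0" unfolding c1 using r(1) z(2) by (simp add: Sb(2,3) Z_def)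
        finally show "\<forall>i<1. x i = 0" by simp
      qed
      have dW: "dim W = 1 + dim Z" using frame_dim[OF fr] .
      have "S (comb (glue 1 (\<lambda>i. z) c) (dim W) x) (comb (glue 1 (\<lambda>i. z) c) (dim W) y)
          = sym_core 1 (x 0) (x 1) (y 0) (y 1)" for x y
      proof -
        define r where "r = comb c (dim Z) (\<lambda>i. x (1 + i))"
        define r' where "r' = comb c (dim Z) (\<lambda>i. y (1 + i))"
        have r: "r \<in> Z" "r' \<in> Z" using inZ by (auto simp: r_def r'_def)
        have "S r z = 0" "S z r' = 0" "S r r' = 0"
          using r Sb(1)[of r z] isoH by (auto simp: Z_def)
        then show ?thesis unfolding dW comb_glue c1 r_def[symmetric] r'_def[symmetric]
          using z(2) by (simp add: Sb(2,3,4,5) sym_core_def)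
      qed
      then show ?thesis using fr dW by (intro exI[of _ 1] exI[of _ "glue 1 (\<lambda>i. z) c"]) simp
    next
      case False
      then obtain v0 where v0: "v0 \<in> H" "S z v0 \<noteq> 0" by blast
      define v where "v = scale (1 / S z v0) v0"
      have v: "v \<in> H" "S z v = 1" using v0 Hsc by (auto simp: v_def Sb(3))
      have vz: "S v z = 1" "S v v = 0" "v \<in> W" using v Sb(1)[of v z] by (auto simp: H_def)
      \<comment> \<open>In the order \<open>v\<close>, \<open>z\<close> the Gram matrix has rows 0,
        1 and 1, 1, the even case of \<open>sym_core 2\<close>.\<close>
      define p where "p i = (if i = 0 then v else z)" for i :: nat
      have c2: "comb p 2 x = scale (x 0) v + scale (x 1) z" for x
        by (simp add: comb_def numeral_2_eq_2 p_def)
      have fr: "frame (glue 2 p c) (2 + dim Z) W"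
      proof (rule glue_frame[OF W c ZW])
        show "p i \<in> W" for i using z(1) vz(3) by (simp add: p_def)
        show "\<exists>y. x - comb p 2 y \<in> Z" if x: "x \<in> W" for x
        proof -
          obtain \<beta> where \<beta>: "x - scale \<beta> z \<in> H" using proj[OF x] by blast
          define h where "h = x - scale \<beta> z"
          have "h + scale (- S z h) v \<in> H" using Hadd[OF \<beta> Hsc[OF v(1)]] unfolding h_def .
          then have "h + scale (- S z h) v \<in> Z" using v(2) by (simp add: Z_def Sb(3,6))
          moreover have "h + scale (- S z h) v = x - comb p 2 (\<lambda>i. if i = 0 then S z h else \<beta>)"
            by (simp add: c2 h_def algebra_simps)
          ultimately show ?thesis by metis
        qed
        fix x r assume r: "r \<in> Z" "comb p 2 x + r = 0"
        have rH: "r \<in> H" "S z r = 0" "S v r = 0" using r(1) v(1) isoH by (auto simp: Z_def)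
        have "0 = S v (comb p 2 x + r)" unfolding r(2) by (simp add: Sb(8))
        also have "\<dots> = x 1" using rH vz by (simp add: c2 Sb(2,3))
        finally have x1: "x 1 = 0" by simp
        have "0 = S z (comb p 2 x + r)" unfolding r(2) by (simp add: Sb(8))
        also have "\<dots> = x 0" using rH v(2) x1 by (simp add: c2 Sb(2,3))
        finally show "\<forall>i<2. x i = 0" using x1 by (simp add: less_2_cases_iff)
      qed
      have dW: "dim W = 2 + dim Z" using frame_dim[OF fr] .
      have "S (comb (glue 2 p c) (dim W) x) (comb (glue 2 p c) (dim W) y)
          = sym_core 2 (x 0) (x 1) (y 0) (y 1)" for x y
      proof -
        define r where "r = comb c (dim Z) (\<lambda>i. x (2 + i))"
        define r' where "r' = comb c (dim Z) (\<lambda>i. y (2 + i))"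
        have r: "r \<in> Z" "r' \<in> Z" using inZ by (auto simp: r_def r'_def)
        have 0: "S r z = 0" "S z r' = 0" "S r r' = 0" "S r v = 0" "S v r' = 0"
          using r Sb(1)[of r z] isoH v(1) by (auto simp: Z_def)
        show ?thesis unfolding dW comb_glue c2 r_def[symmetric] r'_def[symmetric]
          using z(2) vz v(2) 0 even_q by (simp add: Sb(2,3,4,5) sym_core_def algebra_simps)
      qed
      then show ?thesis using fr dW by (intro exI[of _ 2] exI[of _ "glue 2 p c"]) simp
    qed
  qed
qed

text \<open>Maximal hyperbolic pairs leave a core of dimension at most 2 and a radical; since the
  rank is \<open>2 * s + \<rho>\<close>, its parity excludes \<open>\<rho> = 1\<close>.\<close>

lemma symmetric_type_even:
  assumes even_q: "even CARD('a)" and S: "S \<in> symmetric_bilinear_forms" and ev: "even (symmetric_rank S)"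
  shows "symmetric_has_type eta S 1 \<or> symmetric_has_type eta S (-1)"
proof -
  obtain s p where p: "hyp_pairs S s p"
    and max: "\<forall>x\<in>perp_space S s p. \<forall>y\<in>perp_space S s p. True \<longrightarrow> True \<longrightarrow>
      S x x = 0 \<longrightarrow> S y y = 0 \<longrightarrow> S x y \<noteq> 1"
    using maximal_hyp_pairs[OF S, of "\<lambda>x. True"] by (elim exE conjE)
  define W where "W = perp_space S s p"
  have W: "subspace W" unfolding W_def by (rule perp_space_subspace[OF S])
  have "\<exists>\<rho> e. \<rho> \<le> 2 \<and> \<rho> \<le> dim W \<and> frame e (dim W) W \<and>
    (\<forall>x y. S (comb e (dim W) x) (comb e (dim W) y) = sym_core \<rho> (x 0) (x 1) (y 0) (y 1))"
    by (rule exists_sym_core_frame[OF even_q S W]) (use max in \<open>simp add: W_def\<close>)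
  then obtain \<rho> e where \<rho>: "\<rho> \<le> 2" "\<rho> \<le> dim W" and e: "frame e (dim W) W"
    and eS: "\<And>x y. S (comb e (dim W) x) (comb e (dim W) y) = sym_core \<rho> (x 0) (x 1) (y 0) (y 1)"
    by blast
  define b where "b = glue (2 * s) p e"
  have fr: "frame b N UNIV" and N: "2 * s + dim W = N"
    using hyp_pairs_frame[OF S p] e unfolding b_def W_def by auto
  have eq: "S (comb b N x) (comb b N y)
      = hyp_sum s x y + sym_core \<rho> (x (2 * s)) (x (2 * s + 1)) (y (2 * s)) (y (2 * s + 1))" for x y
  proof -
    have inW: "comb e (dim W) x \<in> perp_space S s p" for x
      using e comb_span[of e "dim W"] by (simp add: frame_iff W_def)
    show ?thesis
      unfolding b_def N[symmetric] comb_glue hyp_pairs_bilinear[OF S p inW inW] eS hyp_sum_def by simp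
  qed
  have rank: "symmetric_rank S = 2 * s + \<rho>"
  proof (rule symmetric_rank_frame[OF S fr])
    show "2 * s + \<rho> \<le> N" using \<rho> N by simp
    fix x :: "nat \<Rightarrow> 'a"
    {
      fix y assume x: "\<forall>i<2 * s + \<rho>. x i = 0"
      then have "hyp_sum s x y = 0" unfolding hyp_sum_def by (intro sum.neutral) auto
      moreover have "sym_core \<rho> (x (2 * s)) (x (2 * s + 1)) (y (2 * s)) (y (2 * s + 1)) = 0"
        using x \<rho>(1) by (auto simp: sym_core_def)
      ultimately show "S (comb b N x) (comb b N y) = 0" unfolding eq by simp
    }
    assume x: "\<forall>y. S (comb b N x) (comb b N y) = 0"
    have h: "x i = 0" if i: "i < 2 * s" for i
    proof -
      have j: "partner i < 2 * s" by (rule partner_less[OF i])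
      have "sym_core \<rho> (x (2 * s)) (x (2 * s + 1)) (if 2 * s = partner i then 1 else 0) (if 2 * s + 1 = partner i then 1 else 0) = 0"
        using j by (simp add: sym_core_def)
      then show ?thesis
        using x[rule_format, of "\<lambda>k. if k = partner i then 1 else 0"] hyp_sum_unit[OF j, of x]
        unfolding eq by simp
    qed
    then have hs: "hyp_sum s x y = 0" for y unfolding hyp_sum_def by (intro sum.neutral) auto
    have t: "sym_core \<rho> (x (2 * s)) (x (2 * s + 1)) y0 y1 = 0" for y0 y1
      using x[rule_format, of "\<lambda>k. if k = 2 * s then y0 else y1"] unfolding eq hs by simp
    show "\<forall>i<2 * s + \<rho>. x i = 0"
    proof (intro allI impI)
      fix i assume i: "i < 2 * s + \<rho>"
      have "i < 2 * s \<or> i = 2 * s \<and> 1 \<le> \<rho> \<or> i = 2 * s + 1 \<and> \<rho> = 2" using i \<rho>(1) by auto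
      then show "x i = 0"
        using h[of i] t[of 1 0] t[of 0 1] even_q by (auto simp: sym_core_def split: if_splits)
    qed
  qed
  have "\<rho> = 0 \<or> \<rho> = 2" using ev \<rho>(1) unfolding rank by presburger
  moreover have "2 * s + \<rho> \<le> N" using \<rho> N by simp
  ultimately have "symmetric_has_type eta S (if \<rho> = 0 then 1 else -1)"
    using symmetric_has_typeI[OF fr one_neq_zero _ _ rank] eq by simp
  then show ?thesis by (auto split: if_splits)
qed

text \<open>As 2 is invertible, \<open>S\<close> is the polar form of
  \<open>Q x = S x x / 2\<close>, which has the same radical, so the normal form of \<open>Q\<close>
  carries over.\<close>

lemma symmetric_type_odd:
  assumes odd_q: "odd CARD('a)" and S: "S \<in> symmetric_bilinear_forms" and ev: "even (symmetric_rank S)"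
  shows "symmetric_has_type eta S 1 \<or> symmetric_has_type eta S (-1)"
proof -
  have two: "(2 :: 'a) \<noteq> 0" using odd_q even_card_iff_char2[where 'a = 'a] by simp
  note Sb = symmetric_bilinearD[OF S]
  define Q where "Q x = S x x / 2" for x
  have polar: "polar_form Q = S"
  proof (intro ext)
    fix x y
    have yx: "S y x = S x y" by (rule Sb(1))
    have "S (x + y) (x + y) - S x x - S y y = 2 * S x y"
      unfolding Sb(2) Sb(4) yx by simp
    moreover have "polar_form Q x y = (S (x + y) (x + y) - S x x - S y y) / 2"
      by (simp add: polar_form_def Q_def diff_divide_distrib)
    ultimately show "polar_form Q x y = S x y" using two by simp
  qed
  have Q: "Q \<in> quadratic_forms"
    by (rule quadraticI) (simp_all add: polar S, simp add: Q_def Sb(3,5) power2_eq_square)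
  have "quadratic_radical Q = symmetric_radical S"
    unfolding quadratic_radical_def symmetric_radical_def polar by (auto simp: Q_def)
  then have rk: "symmetric_rank S = quadratic_rank Q" by (simp add: symmetric_rank_def quadratic_rank_def)
  obtain s \<rho> a b where nf: "normal_form Q s \<rho> a b" using normal_form_exists[OF Q] by blast
  note D = normal_formD[OF nf]
  have rank: "symmetric_rank S = 2 * s + \<rho>" using quadratic_rank_normal_form[OF Q nf] rk by simp
  have \<rho>: "\<rho> = 0 \<or> \<rho> = 2" using ev D(3) unfolding rank by presburger
  \<comment> \<open>Polarising the core yields twice \<open>sym_core\<close>, whence the scalar
    \<open>2 * a\<close>.\<close>
  have eq: "S (comb b N x) (comb b N y)
      = hyp_sum s x y + (2 * a) * sym_core \<rho> (x (2 * s)) (x (2 * s + 1)) (y (2 * s)) (y (2 * s + 1))" for x y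
  proof -
    have "core \<rho> (x (2 * s) + y (2 * s)) (x (2 * s + 1) + y (2 * s + 1)) - core \<rho> (x (2 * s)) (x (2 * s + 1)) - core \<rho> (y (2 * s)) (y (2 * s + 1))
        = 2 * sym_core \<rho> (x (2 * s)) (x (2 * s + 1)) (y (2 * s)) (y (2 * s + 1))"
      using \<rho> odd_q by (auto simp: core_def plane_form_def sym_core_def power2_eq_square algebra_simps)
    then show ?thesis using polar_normal_form[OF nf, of x y] unfolding polar by simp
  qed
  have "symmetric_has_type eta S (if \<rho> = 0 then 1 else -1)"
    by (rule symmetric_has_typeI[OF D(1) _ \<rho> D(4) rank eq]) (use two D(2) in simp)
  then show ?thesis by (auto split: if_splits)
qed

text \<open>Turns the design condition, which speaks of classes, into one on single forms: by the
  two classification lemmas every form of even rank has a type.\<close>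

lemma symmetric_class_exists:
  assumes "S \<in> symmetric_bilinear_forms" "1 \<le> symmetric_rank S" "int (symmetric_rank S) \<le> t"
  shows "\<exists>k\<in>design_indices t. S \<in> symmetric_class eta k"
proof (cases "even (symmetric_rank S)")
  case True
  then obtain r where r: "symmetric_rank S = 2 * r" by blast
  obtain \<tau> where \<tau>: "\<tau> = 1 \<or> \<tau> = -1" "symmetric_has_type eta S \<tau>"
    using symmetric_type_even[OF _ assms(1) True] symmetric_type_odd[OF _ assms(1) True] by blast
  have "Even_Rank (2 * int r) \<tau> \<in> design_indices t"
    using assms r \<tau>(1) unfolding design_indices_def by (intro UnI2) auto
  moreover have "S \<in> symmetric_class eta (Even_Rank (2 * int r) \<tau>)"
    using assms(1) r \<tau>(2) by (simp add: symmetric_class_def)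
  ultimately show ?thesis by blast
next
  case False
  then obtain r where r: "symmetric_rank S = 2 * r + 1" by (rule oddE)
  \<comment> \<open>\<open>design_indices\<close> writes odd ranks as \<open>2 * s - 1\<close>, here
    with \<open>s = r + 1\<close>.\<close>
  have "Odd_Rank (2 * (int r + 1) - 1) \<in> design_indices t"
    using assms r unfolding design_indices_def by (intro UnI1 CollectI exI[of _ "int r + 1"]) auto
  moreover have "S \<in> symmetric_class eta (Odd_Rank (2 * (int r + 1) - 1))"
    using assms(1) r by (simp add: symmetric_class_def)
  ultimately show ?thesis by blast
qed

section \<open>The linear programming bound\<close>

lemma symmetric_rank_le: "S \<in> symmetric_bilinear_forms \<Longrightarrow> symmetric_rank S \<le> N"
  by (simp add: symmetric_rank_def)

lemma zero_symmetric: "(\<lambda>x y. 0) \<in> symmetric_bilinear_forms"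
  by (rule symmetric_bilinearI) simp_all

lemma symmetric_rank_eq_0_iff:
  assumes S: "S \<in> symmetric_bilinear_forms"
  shows "symmetric_rank S = 0 \<longleftrightarrow> S = (\<lambda>x y. 0)"
proof
  assume "symmetric_rank S = 0"
  then have "N \<le> dim (symmetric_radical S)" by (simp add: symmetric_rank_def)
  then have "card (UNIV :: 'v set) \<le> card (symmetric_radical S)"
    unfolding card_subspace[OF radical_subspace[OF S]] card_subspace[OF subspace_UNIV]
    using card_field_gt_1[where 'a = 'a] by (intro power_increasing) simp_all
  then have "symmetric_radical S = UNIV" by (intro card_seteq) simp_all
  then show "S = (\<lambda>x y. 0)" unfolding symmetric_radical_def fun_eq_iff by blast
next
  assume "S = (\<lambda>x y. 0)"
  then have "symmetric_radical S = UNIV" by (simp add: symmetric_radical_def)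
  then show "symmetric_rank S = 0" by (simp add: symmetric_rank_def)
qed

lemma form_pairing_0: "form_pairing chi u w Q (\<lambda>x y. 0) = 1"
  by (simp add: form_pairing_def chi_0)

lemma form_pairing_0_left:
  assumes Q: "Q \<in> quadratic_forms" and S: "S \<in> symmetric_bilinear_forms"
  shows "form_pairing chi u w (\<lambda>x. Q x - Q x) S = 1"
proof -
  have "cmod (form_pairing chi u w Q S) = 1" by (simp add: form_pairing_def norm_chi)
  then show ?thesis unfolding form_pairing_diff[OF Q Q S] complex_norm_square[symmetric] by simp
qed

lemma sum_weight_symmetric:
  assumes n: "N = 2 * n" "1 \<le> n" and k: "k \<le> n"
  shows "(\<Sum>S\<in>symmetric_bilinear_forms. weight (real CARD('a)) n k (symmetric_rank S)) =
    real CARD('a) ^ (n * (2 * (n - k) + 1)) * weight (real CARD('a)) n k 0"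
proof -
  have "(\<Sum>S\<in>symmetric_bilinear_forms. weight (real CARD('a)) n k (symmetric_rank S))
      = (\<Sum>S\<in>symmetric_bilinear_forms. weight (real CARD('a)) n k (mrank N (gram (\<lambda>i. u (Suc i)) S)))"
    by (rule sum.cong[OF refl]) (simp add: symmetric_rank_eq_mrank[OF _ u_frame])
  also have "\<dots> = (\<Sum>B\<in>symm N. weight (real CARD('a)) n k (mrank N (B :: nat \<Rightarrow> nat \<Rightarrow> 'a)))"
    by (rule sum.reindex_bij_betw[OF bij_gram[OF u_frame]])
  finally show ?thesis unfolding n(1) sum_weight[OF n(2) k] .
qed

lemma design_symmetric_class_rank:
  assumes "k \<in> design_indices t" "S \<in> symmetric_class eta k"
  shows "1 \<le> symmetric_rank S" "int (symmetric_rank S) \<le> t"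
  using assms by (auto simp: design_indices_def symmetric_class_def)

text \<open>An entry of the dual inner distribution is a sum of squared moduli over a class, up to a
  positive factor, so it vanishes iff every character sum over \<open>Y\<close> in that class
  does.\<close>

lemma is_design_iff:
  assumes Y: "Y \<subseteq> quadratic_forms" "Y \<noteq> {}" and even_N: "even N"
  shows "is_design lam eta chi u w t Y \<longleftrightarrow>
    (\<forall>S\<in>symmetric_bilinear_forms. 1 \<le> symmetric_rank S \<longrightarrow> int (symmetric_rank S) \<le> t \<longrightarrow>
      (\<Sum>Q\<in>Y. form_pairing chi u w Q S) = 0)"
proof -
  have card: "card Y \<noteq> 0" using Y(2) by simp
  have "dual_inner_distribution lam eta chi u w Y k = 0 \<longleftrightarrow>
      (\<forall>S\<in>symmetric_class eta k. (\<Sum>Q\<in>Y. form_pairing chi u w Q S) = 0)" for k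
  proof -
    have "dual_inner_distribution lam eta chi u w Y k
        = of_real (\<Sum>S\<in>symmetric_class eta k. (cmod (\<Sum>Q\<in>Y. form_pairing chi u w Q S)) ^ 2) / of_nat (card Y)"
      unfolding dual_inner_distribution_eq[OF Y(1) even_N] of_real_sum ..
    then have "dual_inner_distribution lam eta chi u w Y k = 0 \<longleftrightarrow>
        (\<Sum>S\<in>symmetric_class eta k. (cmod (\<Sum>Q\<in>Y. form_pairing chi u w Q S)) ^ 2) = 0"
      using card by (simp del: of_real_sum)
    also have "\<dots> \<longleftrightarrow> (\<forall>S\<in>symmetric_class eta k. (\<Sum>Q\<in>Y. form_pairing chi u w Q S) = 0)"
      by (subst sum_nonneg_eq_0_iff) simp_all
    finally show ?thesis .
  qed
  moreover have "symmetric_class eta k \<subseteq> symmetric_bilinear_forms" for k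
    by (auto simp: symmetric_class_def split: form_index.splits)
  ultimately show ?thesis
    unfolding is_design_def using Y(1) symmetric_class_exists design_symmetric_class_rank by blast
qed

context
  fixes Y d n \<delta>
  assumes code: "is_elliptic_code lam eta d Y" and Y: "Y \<noteq> {}"
    and N: "N = 2 * n" and d: "d = 2 * \<delta>" and \<delta>: "1 \<le> \<delta>" "\<delta> \<le> n"
begin

private lemma sub: "Y \<subseteq> quadratic_forms"
  using code by (simp add: is_elliptic_code_def is_code_def)

private abbreviation h where "h S \<equiv> weight (real CARD('a)) n \<delta> (symmetric_rank S)"

private abbreviation K where "K S \<equiv> (cmod (\<Sum>Q\<in>Y. form_pairing chi u w Q S)) ^ 2"

text \<open>The code hypothesis enters here: for distinct elements \<open>s = \<delta>\<close> and
  \<open>\<rho> = 0\<close> would mean a hyperbolic difference of rank \<open>d\<close>, so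
  \<open>weight_sum_vanish\<close> applies.\<close>

private lemma weight_sum_difference:
  assumes Q: "Q \<in> Y" and Q': "Q' \<in> Y"
  shows "weight_sum \<delta> (\<lambda>x. Q x - Q' x) =
    (if Q = Q' then of_real (real CARD('a) ^ (n * (2 * (n - \<delta>) + 1)) * weight (real CARD('a)) n \<delta> 0) else 0)"
proof (cases "Q = Q'")
  case True
  have "weight_sum \<delta> (\<lambda>x. Q x - Q x) = (\<Sum>S\<in>symmetric_bilinear_forms. of_real (h S))"
    unfolding weight_sum_def form_rank_sum_def
    by (rule sum.cong[OF refl]) (use Q sub form_pairing_0_left[of Q] in \<open>auto simp: N\<close>)
  also have "\<dots> = of_real (real CARD('a) ^ (n * (2 * (n - \<delta>) + 1)) * weight (real CARD('a)) n \<delta> 0)"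
    using sum_weight_symmetric[OF N _ \<delta>(2)] \<delta> by (simp flip: of_real_sum)
  finally show ?thesis using True by simp
next
  case False
  let ?D = "\<lambda>x. Q x - Q' x"
  have D: "?D \<in> quadratic_forms" using Q Q' sub by (intro quadratic_forms_diff) auto
  obtain s \<rho> a b where nf: "normal_form ?D s \<rho> a b" using normal_form_exists[OF D] by blast
  note rank = quadratic_rank_normal_form[OF D nf]
  have even_N: "even N" using N by simp
  have "d \<le> quadratic_rank ?D" "?D \<notin> quadratic_class lam eta (Even_Rank (int d) 1)"
    using code Q Q' False unfolding is_elliptic_code_def is_code_def by blast+
  moreover have "?D \<in> quadratic_class lam eta (Even_Rank (int d) 1)" if "s = \<delta> \<and> \<rho> = 0"
    using that D rank d has_type_iff[OF D nf even_N, of 1] by (simp add: quadratic_class_def)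
  ultimately have "2 * \<delta> \<le> 2 * s + \<rho>" "\<not> (s = \<delta> \<and> \<rho> = 0)"
    using rank d by (simp, blast)
  then have "weight_sum \<delta> ?D = 0" by (rule weight_sum_vanish[OF D nf even_N])
  then show ?thesis using False by simp
qed

private lemma weighted_sum:
  "(\<Sum>S\<in>symmetric_bilinear_forms. h S * K S) =
    real (card Y) * (real CARD('a) ^ (n * (2 * (n - \<delta>) + 1)) * weight (real CARD('a)) n \<delta> 0)"
    (is "_ = real (card Y) * ?c")
proof -
  have "complex_of_real (\<Sum>S\<in>symmetric_bilinear_forms. h S * K S)
      = (\<Sum>S\<in>symmetric_bilinear_forms. \<Sum>P\<in>Y \<times> Y. of_real (h S) * form_pairing chi u w (\<lambda>x. fst P x - snd P x) S)"
    unfolding of_real_sum of_real_mult sum_distrib_left[symmetric]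
    by (rule sum.cong[OF refl]) (simp only: sum_pairing_diff[OF sub])
  also have "\<dots> = (\<Sum>P\<in>Y \<times> Y. weight_sum \<delta> (\<lambda>x. fst P x - snd P x))"
    unfolding weight_sum_def form_rank_sum_def N by (subst sum.swap) simp
  also have "\<dots> = (\<Sum>P\<in>Y \<times> Y. if fst P = snd P then of_real ?c else 0)"
    by (rule sum.cong[OF refl]) (simp add: weight_sum_difference mem_Times_iff)
  also have "\<dots> = (\<Sum>Q\<in>Y. \<Sum>Q'\<in>Y. if Q = Q' then of_real ?c else 0)"
    by (simp only: sum.cartesian_product case_prod_unfold)
  also have "\<dots> = of_real (real (card Y) * ?c)" by simp
  finally show ?thesis by (simp only: of_real_eq_iff)
qed

private lemma weight_props:
  assumes "S \<in> symmetric_bilinear_forms"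
  shows "0 \<le> h S" "h S \<noteq> 0 \<longleftrightarrow> symmetric_rank S \<le> 2 * (n - \<delta>) + 1"
proof -
  have q: "1 < real CARD('a)" using card_field_gt_1[where 'a = 'a] by simp
  have r: "symmetric_rank S \<le> 2 * n" using symmetric_rank_le[OF assms] N by simp
  note w = weight_nonneg_pos[OF q \<delta>(2) r]
  show "0 \<le> h S" "h S \<noteq> 0 \<longleftrightarrow> symmetric_rank S \<le> 2 * (n - \<delta>) + 1"
    using w by (cases "symmetric_rank S \<le> 2 * (n - \<delta>) + 1"; force)+
qed

lemma elliptic_code_bound:
  "card Y \<le> CARD('a) ^ (n * (2 * (n - \<delta>) + 1))" (is ?le)
  "card Y = CARD('a) ^ (n * (2 * (n - \<delta>) + 1)) \<longleftrightarrow>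
    is_design lam eta chi u w (int (2 * (n - \<delta>) + 1)) Y" (is ?eq)
proof -
  let ?Z = "(\<lambda>x y. 0) :: 'v \<Rightarrow> 'v \<Rightarrow> 'a" and ?e = "CARD('a) ^ (n * (2 * (n - \<delta>) + 1))"
  define h0 where "h0 = weight (real CARD('a)) n \<delta> 0"
  define R where "R = (\<Sum>S\<in>symmetric_bilinear_forms - {?Z}. h S * K S)"
  have rank0: "symmetric_rank ?Z = 0" using symmetric_rank_eq_0_iff[OF zero_symmetric] by simp
  have h0: "0 < h0"
    using weight_props[OF zero_symmetric] unfolding rank0 h0_def by simp
  have y: "0 < real (card Y)" using Y by (simp add: card_gt_0_iff)
  have "(\<Sum>Q\<in>Y. form_pairing chi u w Q ?Z) = of_nat (card Y)"
    by (simp add: form_pairing_0)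
  then have "(\<Sum>S\<in>symmetric_bilinear_forms. h S * K S) = h0 * real (card Y) ^ 2 + R"
    unfolding R_def sum.remove[OF finite_forms(1) zero_symmetric] rank0 h0_def by simp
  \<comment> \<open>What the zero form leaves over is nonnegative and measures the distance of
    \<open>card Y\<close> from the bound.\<close>
  then have R: "R = h0 * real (card Y) * (real ?e - real (card Y))"
    unfolding weighted_sum h0_def[symmetric] by (simp add: power2_eq_square algebra_simps)
  have nonneg: "0 \<le> h S * K S" if "S \<in> symmetric_bilinear_forms - {?Z}" for S
    using that weight_props(1)[of S] by simp
  have "0 \<le> R" unfolding R_def by (rule sum_nonneg) (rule nonneg)
  then have "0 \<le> real ?e - real (card Y)"
    using mult_pos_pos[OF h0 y] unfolding R zero_le_mult_iff by linarith
  then have "real (card Y) \<le> real ?e" by linarith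
  then show ?le unfolding of_nat_le_iff .
  have "card Y = ?e \<longleftrightarrow> R = 0" using h0 y unfolding R mult_eq_0_iff right_minus_eq of_nat_eq_iff by auto
  also have "\<dots> \<longleftrightarrow> (\<forall>S\<in>symmetric_bilinear_forms - {?Z}. h S * K S = 0)"
    unfolding R_def by (rule sum_nonneg_eq_0_iff) (simp, rule nonneg)
  also have "\<dots> \<longleftrightarrow> is_design lam eta chi u w (int (2 * (n - \<delta>) + 1)) Y"
  proof -
    have "h S * K S = 0 \<longleftrightarrow>
        (int (symmetric_rank S) \<le> int (2 * (n - \<delta>) + 1) \<longrightarrow> (\<Sum>Q\<in>Y. form_pairing chi u w Q S) = 0)"
      if "S \<in> symmetric_bilinear_forms" for S
      using weight_props(2)[OF that] by (auto simp del: of_nat_add of_nat_mult)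
    moreover have "1 \<le> symmetric_rank S \<longleftrightarrow> S \<noteq> ?Z" if "S \<in> symmetric_bilinear_forms" for S
      using symmetric_rank_eq_0_iff[OF that] by linarith
    ultimately show ?thesis
      unfolding is_design_iff[OF sub Y, simplified N, simplified] by auto
  qed
  finally show ?eq .
qed

end

end

theorem theorem4p6:
  fixes scale :: "'a :: {field, finite} \<Rightarrow> 'v :: ab_group_add \<Rightarrow> 'v"
    and q m d :: nat
    and lam eta :: 'a
    and chi :: "'a \<Rightarrow> complex"
    and u w :: "nat \<Rightarrow> 'v"
    and Y :: "('v \<Rightarrow> 'a) set"
  assumes "finite_field_space scale"
    and "q = CARD('a)"
    and "m = vector_space.dim scale (UNIV :: 'v set)"
    and "even m" and "even d" and "2 \<le> d" and "d \<le> m"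
    and "even q \<Longrightarrow> absolute_trace lam = 1"
    and "odd q \<Longrightarrow> \<nexists>x. eta = x ^ 2"
    and "nontrivial_additive_character chi"
    and "finite_field_space.ordered_basis scale u"
    and "finite_field_space.ordered_basis scale w"
    and "Y \<noteq> {}"
    and "finite_field_space.is_elliptic_code scale lam eta d Y"
  shows "card Y \<le> q ^ (m * (m - d + 1) div 2) \<and>
    (card Y = q ^ (m * (m - d + 1) div 2) \<longleftrightarrow>
       finite_field_space.is_design scale lam eta chi u w (int m - int d + 1) Y)"
proof -
  interpret finite_field_space scale by (rule assms(1))
  interpret typed_form_space scale chi u w lam eta
    by unfold_locales (use assms in simp_all)
  obtain n \<delta> where n: "m = 2 * n" and \<delta>: "d = 2 * \<delta>" using assms(4,5) by (elim evenE)
  have le: "1 \<le> \<delta>" "\<delta> \<le> n" using assms(6,7) n \<delta> by simp_all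
  have "m - d + 1 = 2 * (n - \<delta>) + 1" using n \<delta> by simp
  \<comment> \<open>The division by 2 is exact because \<open>m\<close> is even.\<close>
  then have e: "m * (m - d + 1) div 2 = n * (2 * (n - \<delta>) + 1)" using n by simp
  have t: "int m - int d + 1 = int (2 * (n - \<delta>) + 1)" using n \<delta> le by simp
  have N: "dim UNIV = 2 * n" using assms(3) n by simp
  show ?thesis
    unfolding e t assms(2) using elliptic_code_bound[OF assms(14,13) N \<delta> le] by blast
qed

end
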